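(* Let $u,v\in W$ with $u\leqslant v$. Then $$\overline{m_{u,v}}(\mathbf{z})=q_v\,q_u^{-1}\sum_{u\leqslant w\leqslant v}c_{u,w}\,m_{w,v}(\mathbf{z}^{-1}),$$ where for $u\leqslant w$ in $W$ $$c_{u,w}=\sum_{u\leqslant x\leqslant y\leqslant t\leqslant w}\varepsilon_x\,\varepsilon_y\,q_y^{-1}\,q_u\,P_{x,y}\,\overline{Q_{y,t}}\,\varepsilon_t\,\varepsilon_w,$$ the sum being over all $x,y,t\in W$ with $u\leqslant x\leqslant y\leqslant t\leqslant w$.
   Context: Let $\hat T(\mathbb{C})$ be a maximal torus in a complex reductive group, $\Phi$ the root system in the character lattice $X^*(\hat T)$, $\Phi^+$ a choice of positive roots, and $W$ the Weyl group with its simple reflections $s=s_\alpha$ ($\alpha$ simple), length function $l$, Bruhat order $\leqslant$ and longest element $w_0$. For $\mathbf{z}\in\hat T(\mathbb{C})$ and $\lambda\in X^*(\hat T)$, $\mathbf{z}^\lambda$ is the value of $\lambda$ at $\mathbf{z}$; $W$ acts on $\hat T(\mathbb{C})$ by $(w\mathbf{z})^\lambda=\mathbf{z}^{w^{-1}\lambda}$. Let $q$ be an indeterminate, $q_w=q^{l(w)}$ and $\varepsilon_w=(-1)^{l(w)}$. For a rational function $f$ of $q$ and $\mathbf{z}$, $\overline f$ is the result of replacing $q$ by $q^{-1}$, leaving $\mathbf{z}$ unchanged. Let $\mathcal{H}$ be the Iwahori Hecke algebra of $W$, with scalars extended to the field of rational functions in $q$ and $\mathbf{z}$, with basis $T_w$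 ($w\in W$), where $T_wT_{w'}=T_{ww'}$ if $l(ww')=l(w)+l(w')$ and $T_s^2=(q-1)T_s+q$ for simple reflections $s$. For a simple reflection $s=s_\alpha$ put $$\mu_{\mathbf{z}}(s)=q^{-1}T_s+(1-q^{-1})\frac{\mathbf{z}^\alpha}{1-\mathbf{z}^\alpha}.$$ This extends uniquely (a known fact) to elements $\mu_{\mathbf{z}}(w)$, $w\in W$, with $\mu_{\mathbf{z}}(1)=1$ and $\mu_{\mathbf{z}}(w_1w_2)=\mu_{\mathbf{z}}(w_2)\,\mu_{w_2\mathbf{z}}(w_1)$ whenever $l(w_1w_2)=l(w_1)+l(w_2)$. Let $\Lambda$ be the linear functional on $\mathcal{H}$ with $\Lambda(T_1)=1$ and $\Lambda(T_w)=0$ for $w\neq1$, let $\psi_u=\sum_{x\geqslant u}T_x$, and define $m_{u,v}=m_{u,v}(\mathbf{z})=\Lambda(\psi_u\,\mu_{\mathbf{z}}(v))$. $P_{u,v}$ are the Kazhdan-Lusztig polynomials of $W$ (zero unless $u\leqslant v$), and $Q_{u,v}=P_{w_0v,w_0u}$ are the inverse Kazhdan-Lusztig polynomials. *)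

theory Defs
  imports
    "HOL-Library.Poly_Mapping"
    "HOL-Computational_Algebra.Computational_Algebra"
    Complex_Main
begin

section \<open>Rational functions in \<open>q\<close> and \<open>z\<close>\<close>

text \<open>
  Let \<open>'x\<close> be the character lattice of the torus. The coordinate ring of the torus is the group
  algebra \<open>'x \<Rightarrow>\<^sub>0 complex\<close>, its function field is \<open>'x torus_field\<close>, and the field of rational
  functions in \<open>q\<close> and \<open>z\<close> is the field of rational functions in \<open>q\<close> over \<open>'x torus_field\<close>.

  The class \<open>linordered_ab_group_add\<close> on \<open>'x\<close> only serves the instance that makes the group algebra
  an integral domain. Every lattice carries such an order (for example a lexicographic one); it is
  not used for anything else, and in particular it is unrelated to the choice of positive roots.
\<close>

type_synonym 'x torus_field = "('x \<Rightarrow>\<^sub>0 complex) fract"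
type_synonym 'x qz_field = "'x torus_field poly fract"

definition cst :: "'f::field \<Rightarrow> 'f poly fract"
  where "cst c = Fract [:c:] 1"

definition qq :: "'f::field poly fract"
  where "qq = Fract [:0, 1:] 1"

definition at_inv_q :: "'f::field poly \<Rightarrow> 'f poly fract"
  where "at_inv_q p = poly (map_poly cst p) (inverse qq)"

text \<open>Replacing \<open>q\<close> by its inverse; \<open>bar_Fract\<close> below shows that this is well defined.\<close>

definition bar :: "'f::field poly fract \<Rightarrow> 'f poly fract"
  where "bar f = (THE g. \<exists>a b. b \<noteq> 0 \<and> f = Fract a b \<and> g = at_inv_q a / at_inv_q b)"

lemma cst_0: "cst 0 = 0" by (simp add: cst_def Zero_fract_def)
lemma cst_add: "cst (a + b) = cst a + cst b" by (simp add: cst_def)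
lemma cst_mult: "cst (a * b) = cst a * cst b" by (simp add: cst_def mult.commute)

lemma qq_nonzero: "qq \<noteq> 0"
  by (simp add: qq_def Zero_fract_def eq_fract)

lemma at_inv_q_0: "at_inv_q 0 = 0"
  by (simp add: at_inv_q_def)

lemma at_inv_q_pCons: "at_inv_q (pCons a p) = cst a + inverse qq * at_inv_q p"
  by (cases "a = 0 \<and> p = 0") (auto simp: at_inv_q_def map_poly_pCons cst_0)

lemma at_inv_q_add: "at_inv_q (p + r) = at_inv_q p + at_inv_q r"
  by (induction p r rule: poly_induct2) (simp_all add: at_inv_q_pCons at_inv_q_0 cst_add algebra_simps)

lemma at_inv_q_smult: "at_inv_q (smult c p) = cst c * at_inv_q p"
  by (induction p) (simp_all add: at_inv_q_pCons at_inv_q_0 cst_mult algebra_simps)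

lemma at_inv_q_mult: "at_inv_q (p * r) = at_inv_q p * at_inv_q r"
  by (induction p)
    (simp_all add: at_inv_q_pCons at_inv_q_0 at_inv_q_add at_inv_q_smult cst_0 algebra_simps)

lemma poly_cst_qq: "poly (map_poly cst p) qq = Fract p 1"
proof (induction p)
  case 0
  then show ?case by (simp add: Zero_fract_def)
next
  case (pCons a p)
  then have "poly (map_poly cst (pCons a p)) qq = cst a + qq * Fract p 1"
    by (subst map_poly_pCons) (simp_all add: cst_0)
  also have "\<dots> = Fract (pCons a p) 1"
    by (simp add: cst_def qq_def)
  finally show ?case .
qed

lemma at_inv_q_nonzero:
  assumes "p \<noteq> 0"
  shows "at_inv_q p \<noteq> 0"
proof
  assume "at_inv_q p = 0"
  then have "poly (reflect_poly (map_poly cst p)) qq = 0"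
    by (simp add: poly_reflect_poly_nz qq_nonzero at_inv_q_def)
  moreover have "cst c = 0 \<longleftrightarrow> c = 0" for c :: 'a
    by (simp add: cst_def Zero_fract_def eq_fract)
  then have "reflect_poly (map_poly cst p) = map_poly cst (reflect_poly p)"
    by (intro poly_eqI) (simp add: coeff_reflect_poly coeff_map_poly cst_0 degree_map_poly)
  ultimately have "Fract (reflect_poly p) 1 = 0"
    by (simp add: poly_cst_qq)
  with assms show False
    by (simp add: Zero_fract_def eq_fract)
qed

lemma bar_Fract:
  assumes "b \<noteq> 0"
  shows "bar (Fract a b) = at_inv_q a / at_inv_q b"
  unfolding bar_def
proof (rule the_equality)
  show "\<exists>a' b'. b' \<noteq> 0 \<and> Fract a b = Fract a' b' \<and> at_inv_q a / at_inv_q b = at_inv_q a' / at_inv_q b'"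
    using assms by blast
next
  fix g
  assume "\<exists>a' b'. b' \<noteq> 0 \<and> Fract a b = Fract a' b' \<and> g = at_inv_q a' / at_inv_q b'"
  then obtain a' b' where *: "b' \<noteq> 0" "Fract a b = Fract a' b'" "g = at_inv_q a' / at_inv_q b'"
    by blast
  then have "a * b' = a' * b"
    using assms by (simp add: eq_fract)
  then have "at_inv_q a * at_inv_q b' = at_inv_q a' * at_inv_q b"
    by (metis at_inv_q_mult)
  then show "g = at_inv_q a / at_inv_q b"
    using * assms by (simp add: frac_eq_eq at_inv_q_nonzero)
qed


section \<open>Points of the torus\<close>

text \<open>
  A point of the torus with coordinates in a field \<open>'f\<close> is a homomorphism from the character lattice
  to the multiplicative group of \<open>'f\<close>; the value of a character at the point is function
  application. A rational function in \<open>z\<close> is its own value at the tautological point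
  \<open>generic_pt\<close>, whose coordinates lie in the function field.
\<close>

definition torus_pt :: "('x::ab_group_add \<Rightarrow> 'f::field) \<Rightarrow> bool"
  where "torus_pt z \<longleftrightarrow> z 0 = 1 \<and> (\<forall>x y. z (x + y) = z x * z y)"

definition generic_pt :: "'x::linordered_ab_group_add \<Rightarrow> 'x torus_field"
  where "generic_pt x = Fract (Poly_Mapping.single x 1) 1"

definition inverse_pt :: "('x \<Rightarrow> 'f::field) \<Rightarrow> 'x \<Rightarrow> 'f"
  where "inverse_pt z = (\<lambda>x. inverse (z x))"

definition act_pt :: "('x \<Rightarrow> 'x) \<Rightarrow> ('x \<Rightarrow> 'f) \<Rightarrow> 'x \<Rightarrow> 'f"
  where "act_pt w z = (\<lambda>x. z (inv w x))"


section \<open>Root data and Weyl groups\<close>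

definition zmul :: "int \<Rightarrow> 'x::ab_group_add \<Rightarrow> 'x"
  where "zmul n x = (\<Sum>i<nat n. x) - (\<Sum>i<nat (- n). x)"

lemma zmul_succ: "zmul (n + 1) x = zmul n x + x"
proof (cases "0 \<le> n")
  case True
  then have "nat (n + 1) = Suc (nat n)" "nat (- n) = 0" "nat (- (n + 1)) = 0"
    by simp_all
  then show ?thesis by (simp add: zmul_def add.commute)
next
  case False
  then have "nat (- n) = Suc (nat (- (n + 1)))" "nat n = 0" "nat (n + 1) = 0"
    by simp_all
  then show ?thesis unfolding zmul_def by simp
qed

lemma zmul_pred: "zmul (n - 1) x = zmul n x - x"
  using zmul_succ[of "n - 1" x] by simp

lemma module_zmul: "module zmul"
proof
  have zero: "zmul 0 x = 0" for x :: 'a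
    by (simp add: zmul_def)
  show add_left: "zmul (a + b) x = zmul a x + zmul b x" for a b and x :: 'a
  proof (induction a rule: int_induct[where k = 0])
    case base
    then show ?case by (simp add: zero)
  next
    case (step1 i)
    then show ?case using zmul_succ[of "i + b" x] zmul_succ[of i x] by (simp add: algebra_simps)
  next
    case (step2 i)
    then show ?case using zmul_pred[of "i + b" x] zmul_pred[of i x]
      by (simp add: add.commute add_diff_eq)
  qed
  show "zmul a (x + y) = zmul a x + zmul a y" for a and x y :: 'a
    by (induction a rule: int_induct[where k = 0])
      (simp_all add: zero zmul_succ zmul_pred algebra_simps)
  show "zmul a (zmul b x) = zmul (a * b) x" for a b and x :: 'a
  proof (induction a rule: int_induct[where k = 0])
    case base
    then show ?case by (simp add: zero)
  next
    case (step1 i)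
    then show ?case using add_left[of "i * b" b x] zmul_succ[of i "zmul b x"]
      by (simp add: algebra_simps)
  next
    case (step2 i)
    then show ?case using add_left[of "(i - 1) * b" b x] zmul_pred[of i "zmul b x"]
      by (simp add: algebra_simps)
  qed
  show "zmul 1 x = x" for x :: 'a
    by (simp add: zmul_def)
qed

text \<open>
  A reduced root datum, as attached to a complex reductive group and a maximal torus. The
  cocharacter lattice is the dual of the character lattice, so a coroot is an additive map to the
  integers; \<open>coroot \<alpha> x\<close> is the pairing of \<open>x\<close> with the coroot of \<open>\<alpha>\<close>.
\<close>

locale root_datum =
  fixes \<Phi> :: "'x::linordered_ab_group_add set"
    and coroot :: "'x \<Rightarrow> 'x \<Rightarrow> int"
  assumes lattice:
      "\<exists>B. finite B \<and> \<not> module.dependent zmul B \<and> module.span zmul B = (UNIV :: 'x set)"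
    and finite_roots: "finite \<Phi>"
    and coroot_add: "\<alpha> \<in> \<Phi> \<Longrightarrow> coroot \<alpha> (x + y) = coroot \<alpha> x + coroot \<alpha> y"
    and coroot_inj: "inj_on coroot \<Phi>"
    and coroot_self: "\<alpha> \<in> \<Phi> \<Longrightarrow> coroot \<alpha> \<alpha> = 2"
    and refl_roots: "\<alpha> \<in> \<Phi> \<Longrightarrow> \<beta> \<in> \<Phi> \<Longrightarrow> \<beta> - zmul (coroot \<alpha> \<beta>) \<alpha> \<in> \<Phi>"
    and refl_coroots:
      "\<alpha> \<in> \<Phi> \<Longrightarrow> \<beta> \<in> \<Phi> \<Longrightarrow> (\<lambda>x. coroot \<beta> x - coroot \<beta> \<alpha> * coroot \<alpha> x) \<in> coroot ` \<Phi>"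
    and reduced: "\<alpha> \<in> \<Phi> \<Longrightarrow> \<alpha> + \<alpha> \<notin> \<Phi>"
begin

definition refl :: "'x \<Rightarrow> 'x \<Rightarrow> 'x"
  where "refl \<alpha> x = x - zmul (coroot \<alpha> x) \<alpha>"

definition refl_word :: "'x list \<Rightarrow> 'x \<Rightarrow> 'x"
  where "refl_word as = foldr (\<lambda>\<alpha> f. refl \<alpha> \<circ> f) as id"

definition weyl :: "('x \<Rightarrow> 'x) set"
  where "weyl = refl_word ` lists \<Phi>"

definition regular :: "('x \<Rightarrow> 'f::field) \<Rightarrow> bool"
  where "regular z \<longleftrightarrow> (\<forall>\<alpha>\<in>\<Phi>. z \<alpha> \<noteq> 1)"

end

locale positive_system = root_datum \<Phi> coroot
  for \<Phi> :: "'x::linordered_ab_group_add set" and coroot +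
  fixes pos :: "'x set"
  assumes pos_union: "\<Phi> = pos \<union> uminus ` pos"
    and pos_disjoint: "pos \<inter> uminus ` pos = {}"
    and pos_closed: "\<alpha> \<in> pos \<Longrightarrow> \<beta> \<in> pos \<Longrightarrow> \<alpha> + \<beta> \<in> \<Phi> \<Longrightarrow> \<alpha> + \<beta> \<in> pos"
begin

definition simple :: "'x set"
  where "simple = {\<alpha> \<in> pos. \<not> (\<exists>\<beta>\<in>pos. \<exists>\<gamma>\<in>pos. \<alpha> = \<beta> + \<gamma>)}"

definition len :: "('x \<Rightarrow> 'x) \<Rightarrow> nat"
  where "len w = (LEAST n. \<exists>as\<in>lists simple. length as = n \<and> refl_word as = w)"

text \<open>The Bruhat order, generated by the relations \<open>u < tu\<close> with \<open>t\<close> a reflection (not necessarily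
  simple) and \<open>len u < len (tu)\<close>.\<close>

definition bruhat :: "('x \<Rightarrow> 'x) \<Rightarrow> ('x \<Rightarrow> 'x) \<Rightarrow> bool"
  where "bruhat u v \<longleftrightarrow>
    u \<in> weyl \<and> v \<in> weyl \<and>
    (u, v) \<in> {(x, refl \<alpha> \<circ> x) | x \<alpha>. x \<in> weyl \<and> \<alpha> \<in> \<Phi> \<and> len x < len (refl \<alpha> \<circ> x)}\<^sup>*"

definition longest :: "'x \<Rightarrow> 'x"
  where "longest = (THE w. w \<in> weyl \<and> (\<forall>v\<in>weyl. len v \<le> len w))"

definition qw :: "('x \<Rightarrow> 'x) \<Rightarrow> 'x qz_field"
  where "qw w = qq ^ len w"

definition eps :: "('x \<Rightarrow> 'x) \<Rightarrow> 'x qz_field"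
  where "eps w = (- 1) ^ len w"

end


section \<open>The Iwahori Hecke algebra\<close>

locale hecke_algebra = positive_system \<Phi> coroot pos + vector_space scale
  for \<Phi> :: "'x::linordered_ab_group_add set" and coroot and pos
    and scale :: "'x qz_field \<Rightarrow> 'h::ring_1 \<Rightarrow> 'h" +
  fixes T :: "('x \<Rightarrow> 'x) \<Rightarrow> 'h"
  assumes scale_mult_left: "scale c (a * b) = scale c a * b"
    and scale_mult_right: "scale c (a * b) = a * scale c b"
    and T_inj: "inj_on T weyl"
    and T_independent: "independent (T ` weyl)"
    and T_span: "span (T ` weyl) = UNIV"
    and T_mult:
      "w \<in> weyl \<Longrightarrow> w' \<in> weyl \<Longrightarrow> len (w \<circ> w') = len w + len w' \<Longrightarrow> T w * T w' = T (w \<circ> w')"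
    and T_quadratic:
      "\<alpha> \<in> simple \<Longrightarrow> T (refl \<alpha>) * T (refl \<alpha>) = scale (qq - 1) (T (refl \<alpha>)) + scale qq 1"
begin

definition T_coeff :: "('x \<Rightarrow> 'x) \<Rightarrow> 'h \<Rightarrow> 'x qz_field"
  where "T_coeff w h = representation (T ` weyl) h (T w)"

definition Lam :: "'h \<Rightarrow> 'x qz_field"
  where "Lam h = T_coeff id h"

definition psi :: "('x \<Rightarrow> 'x) \<Rightarrow> 'h"
  where "psi u = (\<Sum>x\<in>{x \<in> weyl. bruhat u x}. T x)"

text \<open>The poles of the coefficients are excluded by requiring the point to be regular; the Weyl group
  preserves regularity.\<close>

definition mu_family :: "(('x \<Rightarrow> 'x torus_field) \<Rightarrow> ('x \<Rightarrow> 'x) \<Rightarrow> 'h) \<Rightarrow> bool"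
  where "mu_family \<mu> \<longleftrightarrow>
    (\<forall>z. torus_pt z \<and> regular z \<longrightarrow>
      \<mu> z id = 1 \<and>
      (\<forall>\<alpha>\<in>simple. \<mu> z (refl \<alpha>) =
        scale (inverse qq) (T (refl \<alpha>)) + scale ((1 - inverse qq) * cst (z \<alpha> / (1 - z \<alpha>))) 1) \<and>
      (\<forall>w1\<in>weyl. \<forall>w2\<in>weyl. len (w1 \<circ> w2) = len w1 + len w2 \<longrightarrow>
        \<mu> z (w1 \<circ> w2) = \<mu> z w2 * \<mu> (act_pt w2 z) w1))"

definition m ::
    "(('x \<Rightarrow> 'x torus_field) \<Rightarrow> ('x \<Rightarrow> 'x) \<Rightarrow> 'h) \<Rightarrow> ('x \<Rightarrow> 'x torus_field) \<Rightarrow>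
      ('x \<Rightarrow> 'x) \<Rightarrow> ('x \<Rightarrow> 'x) \<Rightarrow> 'x qz_field"
  where "m \<mu> z u v = Lam (psi u * \<mu> z v)"


subsection \<open>Kazhdan-Lusztig polynomials\<close>

text \<open>The bar involution of the Hecke algebra: semilinear over \<open>bar\<close>, and sending the basis element of
  \<open>w\<close> to the inverse of the basis element of the inverse of \<open>w\<close>.\<close>

definition hecke_bar :: "'h \<Rightarrow> 'h"
  where "hecke_bar h =
    (\<Sum>w\<in>weyl. scale (bar (T_coeff w h)) (THE y. T (inv w) * y = 1 \<and> y * T (inv w) = 1))"

definition at_q :: "int poly \<Rightarrow> 'x qz_field"
  where "at_q p = poly (map_poly of_int p) qq"

text \<open>The last condition is the invariance under \<open>hecke_bar\<close> of the Kazhdan-Lusztig element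
  \<open>C'\<^sub>w = q\<^bsup>-l(w)/2\<^esup> (\<Sum>x. P x w T\<^sub>x)\<close>, rearranged so as to avoid the square root of \<open>q\<close>.\<close>

definition KL_family :: "(('x \<Rightarrow> 'x) \<Rightarrow> ('x \<Rightarrow> 'x) \<Rightarrow> int poly) \<Rightarrow> bool"
  where "KL_family P \<longleftrightarrow>
    (\<forall>w\<in>weyl. P w w = 1) \<and>
    (\<forall>x\<in>weyl. \<forall>w\<in>weyl. \<not> bruhat x w \<longrightarrow> P x w = 0) \<and>
    (\<forall>x\<in>weyl. \<forall>w\<in>weyl. bruhat x w \<and> x \<noteq> w \<longrightarrow> 2 * degree (P x w) + 1 + len x \<le> len w) \<and>
    (\<forall>w\<in>weyl. hecke_bar (\<Sum>x\<in>weyl. scale (at_q (P x w)) (T x)) =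
      scale (inverse (qw w)) (\<Sum>x\<in>weyl. scale (at_q (P x w)) (T x)))"

definition inverse_KL ::
    "(('x \<Rightarrow> 'x) \<Rightarrow> ('x \<Rightarrow> 'x) \<Rightarrow> int poly) \<Rightarrow> ('x \<Rightarrow> 'x) \<Rightarrow> ('x \<Rightarrow> 'x) \<Rightarrow> int poly"
  where "inverse_KL P u v = P (longest \<circ> v) (longest \<circ> u)"

definition c ::
    "(('x \<Rightarrow> 'x) \<Rightarrow> ('x \<Rightarrow> 'x) \<Rightarrow> int poly) \<Rightarrow> ('x \<Rightarrow> 'x) \<Rightarrow> ('x \<Rightarrow> 'x) \<Rightarrow> 'x qz_field"
  where "c P u w =
    (\<Sum>(x, y, t)\<in>{(x, y, t). bruhat u x \<and> bruhat x y \<and> bruhat y t \<and> bruhat t w}.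
      eps x * eps y * inverse (qw y) * qw u * at_q (P x y) * bar (at_q (inverse_KL P y t))
        * eps t * eps w)"

end

end

theory Submission
  imports Defs
begin

text \<open>
  Let \<open>G\<close> be the matrix with entries \<open>Lam (T_inv (inv y) * T (inv x))\<close>, so that \<open>hecke_bar (T y)\<close> is the
  sum of the \<open>q\<^sub>x\<inverse> G x y T\<^sub>x\<close>. The involution \<open>hecke_bar\<close> maps \<open>\<mu>\<^sub>z(v)\<close> to \<open>q\<^sub>v\<close> times \<open>\<mu>\<close> at the inverse of
  \<open>z\<close>; as this holds on simple reflections, it follows by multiplicativity. Read off through the trace
  form \<open>Lam\<close>, it expresses the conjugates of the \<open>Lam (T\<^sub>x \<mu>\<^sub>z(v))\<close> through \<open>G\<close> and the same quantities at
  the inverse point. The \<open>m\<^bsub>u,v\<^esub>\<close> are the sums of these quantities over the upper intervals of the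
  Bruhat order, which Verma's formula for its Moebius function inverts.

  It remains to factor \<open>G\<close>. Write \<open>D\<close> and \<open>E\<close> for the diagonal matrices of the \<open>q\<^sub>w\<close> and \<open>\<epsilon>\<^sub>w\<close>, and a bar
  for conjugation. Invariance of the Kazhdan-Lusztig basis says that \<open>G P\<close>, with \<open>P\<close> barred, is \<open>D P D\<inverse>\<close>;
  moreover \<open>E G E = G\<inverse>\<close>, by the linear involution of the Hecke algebra, and \<open>G\<close> is transposed by
  \<open>w \<mapsto> w\<^sub>0 w\<close>, by the trace property. Hence \<open>X = E Q E P\<close> satisfies \<open>bar X = D X D\<inverse>\<close>, and the degree bound
  forces \<open>X = 1\<close>, so that \<open>G\<close> is \<open>D P D\<inverse> E Q E\<close> with \<open>Q\<close> barred.
\<close>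

section \<open>Root systems\<close>

text \<open>The summation indices of \<open>c\<close> have separate origins: \<open>x\<close>
  unfolds \<open>psi u\<close>, \<open>y\<close> is the inner index of the factored R-matrix and
  \<open>t\<close> its column, and \<open>eps t * eps w\<close> is the Moebius function that leads
  from the trace at \<open>t\<close> to the \<open>m\<close> at \<open>w\<close>; the bound by
  \<open>v\<close> is the support of \<mu>. The sign \<open>eps x\<close> enters because applying
  \<open>hecke_bar\<close> to \<mu> yields the values at the inverse point from the conjugated ones,
  the opposite of what is wanted, so that the R-matrix must be inverted. The degree bound decides
  because conjugation with the factor \<open>q^d\<close> reflects exponents about
  \<open>d/2\<close>, while an off-diagonal entry has all exponents below \<open>d/2\<close>. The
  combinatorics starts from little: positive roots are only closed under those sums that are roots,
  without a base or a positive functional, and the lattice may contain vectors killed by all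
  coroots. Two substitutes carry it: a semidefinite form that is positive on roots, and the fact
  that no nonempty sum of positive roots vanishes.\<close>

lemma zmul_0 [simp]: "zmul 0 x = 0"
  by (simp add: zmul_def)

lemma zmul_1 [simp]: "zmul 1 x = x"
  by (simp add: zmul_def)

lemma zmul_minus [simp]: "zmul (- n) x = - zmul n x"
  by (rule module.scale_minus_left[OF module_zmul])

lemma zmul_minus_right [simp]: "zmul n (- x) = - zmul n x"
  by (rule module.scale_minus_right[OF module_zmul])

lemma zmul_add: "zmul (m + n) x = zmul m x + zmul n x"
  by (rule module.scale_left_distrib[OF module_zmul])

lemma zmul_diff: "zmul (m - n) x = zmul m x - zmul n x"
  by (rule module.scale_left_diff_distrib[OF module_zmul])

context root_datum
begin

lemma coroot_0 [simp]: "\<alpha> \<in> \<Phi> \<Longrightarrow> coroot \<alpha> 0 = 0"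
  using coroot_add[of \<alpha> 0 0] by simp

lemma coroot_minus [simp]: "\<alpha> \<in> \<Phi> \<Longrightarrow> coroot \<alpha> (- x) = - coroot \<alpha> x"
  using coroot_add[of \<alpha> x "- x"] by simp

lemma coroot_diff: "\<alpha> \<in> \<Phi> \<Longrightarrow> coroot \<alpha> (x - y) = coroot \<alpha> x - coroot \<alpha> y"
  using coroot_add[of \<alpha> x "- y"] by simp

lemma coroot_zmul [simp]:
  assumes "\<alpha> \<in> \<Phi>" shows "coroot \<alpha> (zmul n x) = n * coroot \<alpha> x"
  by (induction n rule: int_induct[where k = 0])
    (use assms in \<open>simp_all add: zmul_succ zmul_pred coroot_add coroot_diff algebra_simps\<close>)

lemma root_nonzero: "\<alpha> \<in> \<Phi> \<Longrightarrow> \<alpha> \<noteq> 0"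
  using coroot_self[of \<alpha>] by auto

lemma refl_add: "\<alpha> \<in> \<Phi> \<Longrightarrow> refl \<alpha> (x + y) = refl \<alpha> x + refl \<alpha> y"
  by (simp add: refl_def coroot_add zmul_add algebra_simps)

lemma refl_refl [simp]: "\<alpha> \<in> \<Phi> \<Longrightarrow> refl \<alpha> (refl \<alpha> x) = x"
  by (simp add: refl_def coroot_diff coroot_self algebra_simps zmul_diff flip: zmul_add)

lemma refl_comp_refl [simp]: "\<alpha> \<in> \<Phi> \<Longrightarrow> refl \<alpha> \<circ> refl \<alpha> = id"
  by auto

lemma refl_self [simp]: "\<alpha> \<in> \<Phi> \<Longrightarrow> refl \<alpha> \<alpha> = - \<alpha>"
  using zmul_add[of 1 1 \<alpha>] by (simp add: refl_def coroot_self)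

lemma refl_root: "\<alpha> \<in> \<Phi> \<Longrightarrow> \<beta> \<in> \<Phi> \<Longrightarrow> refl \<alpha> \<beta> \<in> \<Phi>"
  by (simp add: refl_def refl_roots)

lemma minus_root: "\<alpha> \<in> \<Phi> \<Longrightarrow> - \<alpha> \<in> \<Phi>"
  using refl_root[of \<alpha> \<alpha>] by simp

lemma refl_minus: "\<alpha> \<in> \<Phi> \<Longrightarrow> refl \<alpha> (- x) = - refl \<alpha> x"
  by (simp add: refl_def)

text \<open>The classical Weyl-invariant form made from the coroots. It is only semidefinite, as
  vectors killed by all coroots lie in its radical, but it is positive on roots and
  integer-valued.\<close>

definition root_form :: "'x \<Rightarrow> 'x \<Rightarrow> int"
  where "root_form x y = (\<Sum>\<gamma>\<in>\<Phi>. coroot \<gamma> x * coroot \<gamma> y)"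

lemma root_form_commute: "root_form x y = root_form y x"
  by (simp add: root_form_def mult.commute)

lemma root_form_diff: "root_form x (y - z) = root_form x y - root_form x z"
  by (simp add: root_form_def coroot_diff algebra_simps flip: sum_subtractf)

lemma root_form_minus: "root_form x (- y) = - root_form x y"
  by (simp add: root_form_def sum_negf)

lemma root_form_zmul: "root_form x (zmul n y) = n * root_form x y"
  by (simp add: root_form_def sum_distrib_left mult.left_commute)

lemma root_form_pos:
  assumes "\<alpha> \<in> \<Phi>" shows "root_form \<alpha> \<alpha> > 0"
proof -
  have "coroot \<alpha> \<alpha> * coroot \<alpha> \<alpha> \<le> root_form \<alpha> \<alpha>"
    unfolding root_form_def
    by (rule member_le_sum[OF assms, where f = "\<lambda>\<gamma>. coroot \<gamma> \<alpha> * coroot \<gamma> \<alpha>"])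
      (auto simp: finite_roots)
  then show ?thesis by (simp add: coroot_self assms)
qed

text \<open>Composing with a reflection permutes the coroots, by \<open>refl_coroots\<close>, so the
  sum is merely reindexed. The map \<open>p\<close> on roots is injective because
  \<open>coroot\<close> is and the reflection is an involution.\<close>

lemma root_form_refl:
  assumes a: "\<alpha> \<in> \<Phi>"
  shows "root_form (refl \<alpha> x) (refl \<alpha> y) = root_form x y"
proof -
  have co: "coroot \<gamma> (refl \<alpha> x) = coroot \<gamma> x - coroot \<gamma> \<alpha> * coroot \<alpha> x" if "\<gamma> \<in> \<Phi>" for \<gamma> x
    using that by (simp add: refl_def coroot_diff)
  have "\<exists>\<delta>\<in>\<Phi>. \<forall>x. coroot \<delta> x = coroot \<gamma> (refl \<alpha> x)" if "\<gamma> \<in> \<Phi>" for \<gamma>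
    using refl_coroots[OF a that] co[OF that] by (auto simp: image_iff fun_eq_iff)
  then obtain p where p: "\<And>\<gamma>. \<gamma> \<in> \<Phi> \<Longrightarrow> p \<gamma> \<in> \<Phi>"
      and pc: "\<And>\<gamma> x. \<gamma> \<in> \<Phi> \<Longrightarrow> coroot (p \<gamma>) x = coroot \<gamma> (refl \<alpha> x)"
    by metis
  have inj: "inj_on p \<Phi>"
  proof (rule inj_onI)
    fix \<gamma> \<delta> assume g: "\<gamma> \<in> \<Phi>" "\<delta> \<in> \<Phi>" "p \<gamma> = p \<delta>"
    then have "coroot \<gamma> x = coroot \<delta> x" for x
      using pc[of \<gamma> "refl \<alpha> x"] pc[of \<delta> "refl \<alpha> x"] a by simp
    then show "\<gamma> = \<delta>" using coroot_inj g by (meson ext inj_onD)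
  qed
  then have "p ` \<Phi> = \<Phi>"
    using p finite_roots by (intro card_subset_eq) (auto simp: card_image)
  then have "(\<Sum>\<gamma>\<in>\<Phi>. coroot \<gamma> x * coroot \<gamma> y) = (\<Sum>\<gamma>\<in>\<Phi>. coroot (p \<gamma>) x * coroot (p \<gamma>) y)"
    using sum.reindex[OF inj, of "\<lambda>\<gamma>. coroot \<gamma> x * coroot \<gamma> y"] by simp
  then show ?thesis by (simp add: root_form_def pc)
qed

text \<open>Invariance under \<open>refl \<alpha>\<close>, which negates \<alpha>, recovers each
  coroot from the form. This is how coroots are later compared under negation and under the Weyl
  group.\<close>

lemma root_form_root:
  assumes a: "\<alpha> \<in> \<Phi>"
  shows "2 * root_form x \<alpha> = coroot \<alpha> x * root_form \<alpha> \<alpha>"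
proof -
  have "root_form x \<alpha> = root_form (refl \<alpha> x) (- \<alpha>)"
    using root_form_refl[OF a, of x \<alpha>] a by simp
  also have "\<dots> = - root_form \<alpha> (x - zmul (coroot \<alpha> x) \<alpha>)"
    by (metis root_form_minus root_form_commute refl_def)
  also have "\<dots> = - root_form x \<alpha> + coroot \<alpha> x * root_form \<alpha> \<alpha>"
    by (simp add: root_form_diff root_form_zmul root_form_commute)
  finally show ?thesis by simp
qed

lemma root_form_Cauchy_Schwarz:
  assumes "\<beta> \<in> \<Phi>"
  shows "(root_form \<alpha> \<beta>)\<^sup>2 \<le> root_form \<alpha> \<alpha> * root_form \<beta> \<beta>"
proof -
  let ?a = "root_form \<alpha> \<beta>" and ?b = "root_form \<beta> \<beta>"
  \<comment> \<open>The vector \<open>(\<beta>,\<beta>)\<alpha> - (\<alpha>,\<beta>)\<beta>\<close>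
    has nonnegative norm, and this norm is a multiple of the positive
    \<open>(\<beta>,\<beta>)\<close>, which then cancels.\<close>
  have "0 \<le> (\<Sum>\<gamma>\<in>\<Phi>. (?b * coroot \<gamma> \<alpha> - ?a * coroot \<gamma> \<beta>)\<^sup>2)"
    by (simp add: sum_nonneg)
  also have "\<dots> = (\<Sum>\<gamma>\<in>\<Phi>. ?b\<^sup>2 * (coroot \<gamma> \<alpha> * coroot \<gamma> \<alpha>)
      - 2 * ?a * ?b * (coroot \<gamma> \<alpha> * coroot \<gamma> \<beta>) + ?a\<^sup>2 * (coroot \<gamma> \<beta> * coroot \<gamma> \<beta>))"
    by (rule sum.cong) (auto simp: power2_eq_square algebra_simps)
  also have "\<dots> = ?b\<^sup>2 * root_form \<alpha> \<alpha> - 2 * ?a * ?b * ?a + ?a\<^sup>2 * ?b"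
    by (simp only: sum.distrib sum_subtractf sum_distrib_left[symmetric] root_form_def[symmetric])
  also have "\<dots> = ?b * (root_form \<alpha> \<alpha> * ?b - ?a\<^sup>2)"
    by (simp add: power2_eq_square algebra_simps)
  finally show ?thesis
    using root_form_pos[OF assms] by (simp add: zero_le_mult_iff)
qed

section \<open>When sums and differences of roots are roots\<close>

lemma coroot_pos_commute:
  assumes "\<alpha> \<in> \<Phi>" "\<beta> \<in> \<Phi>" "coroot \<alpha> \<beta> > 0"
  shows "coroot \<beta> \<alpha> > 0"
proof -
  have "coroot \<beta> \<alpha> * root_form \<beta> \<beta> = coroot \<alpha> \<beta> * root_form \<alpha> \<alpha>"
    using root_form_root[of \<alpha> \<beta>] root_form_root[of \<beta> \<alpha>] assms by (simp add: root_form_commute)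
  also have "\<dots> > 0" using assms root_form_pos[of \<alpha>] by simp
  finally show ?thesis
    using root_form_pos[OF assms(2)] by (simp add: zero_less_mult_iff)
qed

lemma coroot_mult_le_4:
  assumes a: "\<alpha> \<in> \<Phi>" and b: "\<beta> \<in> \<Phi>"
  shows "coroot \<alpha> \<beta> * coroot \<beta> \<alpha> \<le> 4"
proof -
  let ?A = "root_form \<alpha> \<alpha>" and ?B = "root_form \<beta> \<beta>"
  have "(coroot \<alpha> \<beta> * coroot \<beta> \<alpha>) * (?A * ?B) = (2 * root_form \<beta> \<alpha>) * (2 * root_form \<alpha> \<beta>)"
    using root_form_root[OF a] root_form_root[OF b] by simp
  also have "\<dots> = 4 * (root_form \<alpha> \<beta>)\<^sup>2" by (simp add: root_form_commute power2_eq_square)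
  also have "\<dots> \<le> 4 * (?A * ?B)" using root_form_Cauchy_Schwarz[OF b] by simp
  finally show ?thesis using root_form_pos[OF a] root_form_pos[OF b]
    by (simp add: mult_le_cancel_right zero_less_mult_iff)
qed

text \<open>Both pairings are positive with product at most 4. If one of them is 1, the difference
  is a reflected root up to sign. Otherwise both are 2, the difference has norm zero, and
  semidefiniteness gives equal coroots, hence equal roots by \<open>coroot_inj\<close>.\<close>

lemma diff_root:
  assumes a: "\<alpha> \<in> \<Phi>" and b: "\<beta> \<in> \<Phi>" and pos: "coroot \<alpha> \<beta> > 0" and ne: "\<alpha> \<noteq> \<beta>"
  shows "\<beta> - \<alpha> \<in> \<Phi>"
proof -
  have pos': "coroot \<beta> \<alpha> > 0" using coroot_pos_commute a b pos .
  consider "coroot \<alpha> \<beta> = 1" | "coroot \<beta> \<alpha> = 1" | "coroot \<alpha> \<beta> \<ge> 2" "coroot \<beta> \<alpha> \<ge> 2"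
    using pos pos' by linarith
  then show ?thesis
  proof cases
    case 1
    then show ?thesis using refl_root[OF a b] by (simp add: refl_def)
  next
    case 2
    then show ?thesis using minus_root[OF refl_root[OF b a]] by (simp add: refl_def)
  next
    case 3
    have "coroot \<alpha> \<beta> * coroot \<beta> \<alpha> \<ge> 2 * coroot \<alpha> \<beta>" "coroot \<alpha> \<beta> * coroot \<beta> \<alpha> \<ge> 2 * coroot \<beta> \<alpha>"
      using mult_left_mono[OF 3(2), of "coroot \<alpha> \<beta>"] mult_right_mono[OF 3(1), of "coroot \<beta> \<alpha>"] pos pos'
      by simp_all
    then have two: "coroot \<alpha> \<beta> = 2" "coroot \<beta> \<alpha> = 2"
      using coroot_mult_le_4[OF a b] 3 by linarith+
    have eq: "root_form \<alpha> \<beta> = root_form \<alpha> \<alpha>" "root_form \<alpha> \<beta> = root_form \<beta> \<beta>"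
      using root_form_root[OF a, of \<beta>] root_form_root[OF b, of \<alpha>] two by (simp_all add: root_form_commute)
    have "(\<Sum>\<gamma>\<in>\<Phi>. (coroot \<gamma> \<alpha> - coroot \<gamma> \<beta>)\<^sup>2) = (\<Sum>\<gamma>\<in>\<Phi>. coroot \<gamma> \<alpha> * coroot \<gamma> \<alpha>
        - 2 * (coroot \<gamma> \<alpha> * coroot \<gamma> \<beta>) + coroot \<gamma> \<beta> * coroot \<gamma> \<beta>)"
      by (rule sum.cong) (auto simp: power2_eq_square algebra_simps)
    also have "\<dots> = root_form \<alpha> \<alpha> - 2 * root_form \<alpha> \<beta> + root_form \<beta> \<beta>"
      by (simp only: sum.distrib sum_subtractf sum_distrib_left[symmetric] root_form_def[symmetric])
    finally have "(\<Sum>\<gamma>\<in>\<Phi>. (coroot \<gamma> \<alpha> - coroot \<gamma> \<beta>)\<^sup>2) = 0" using eq by simp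
    then have "\<forall>\<gamma>\<in>\<Phi>. coroot \<gamma> \<alpha> = coroot \<gamma> \<beta>"
      by (subst (asm) sum_nonneg_eq_0_iff) (auto simp: finite_roots)
    then have "root_form x \<alpha> = root_form x \<beta>" for x by (simp add: root_form_def)
    then have "coroot \<alpha> x * root_form \<alpha> \<alpha> = coroot \<beta> x * root_form \<alpha> \<alpha>" for x
      by (metis root_form_root[OF a] root_form_root[OF b] eq)
    then have "coroot \<alpha> = coroot \<beta>" using root_form_pos[OF a] by auto
    then show ?thesis using ne coroot_inj a b by (meson inj_onD)
  qed
qed

text \<open>The axioms do not mention the coroot of a negative root; it is recovered from the
  form.\<close>

lemma coroot_uminus:
  assumes a: "\<alpha> \<in> \<Phi>"
  shows "coroot (- \<alpha>) x = - coroot \<alpha> x"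
proof -
  have "root_form (- \<alpha>) (- \<alpha>) = root_form \<alpha> \<alpha>"
    by (metis root_form_minus root_form_commute minus_minus)
  then have "coroot (- \<alpha>) x * root_form \<alpha> \<alpha> = (- coroot \<alpha> x) * root_form \<alpha> \<alpha>"
    using root_form_root[OF minus_root[OF a], of x] root_form_root[OF a, of x]
    by (simp add: root_form_minus)
  then show ?thesis using root_form_pos[OF a] by (simp only: mult_cancel_right) simp
qed

lemma refl_uminus: "\<alpha> \<in> \<Phi> \<Longrightarrow> refl (- \<alpha>) = refl \<alpha>"
  by (simp add: refl_def coroot_uminus fun_eq_iff)

lemma sum_root:
  assumes "\<alpha> \<in> \<Phi>" "\<beta> \<in> \<Phi>" "coroot \<alpha> \<beta> < 0" "\<beta> \<noteq> - \<alpha>"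
  shows "\<alpha> + \<beta> \<in> \<Phi>"
  using diff_root[of "- \<alpha>" \<beta>] assms by (auto simp: minus_root coroot_uminus add.commute)

section \<open>The Weyl group\<close>

lemma refl_word_Nil [simp]: "refl_word [] = id"
  by (simp add: refl_word_def)

lemma refl_word_Cons [simp]: "refl_word (\<alpha> # as) = refl \<alpha> \<circ> refl_word as"
  by (simp add: refl_word_def)

lemma refl_word_append: "refl_word (as @ bs) = refl_word as \<circ> refl_word bs"
  by (induction as) (auto simp: comp_assoc)

lemma id_weyl [simp, intro]: "id \<in> weyl"
  unfolding weyl_def by (rule image_eqI[of _ _ "[]"]) auto

lemma refl_weyl [simp, intro]: "\<alpha> \<in> \<Phi> \<Longrightarrow> refl \<alpha> \<in> weyl"
  unfolding weyl_def by (rule image_eqI[of _ _ "[\<alpha>]"]) auto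

lemma comp_weyl [simp, intro]: "v \<in> weyl \<Longrightarrow> w \<in> weyl \<Longrightarrow> v \<circ> w \<in> weyl"
  unfolding weyl_def by (force simp flip: refl_word_append)

lemma refl_word_rev: "as \<in> lists \<Phi> \<Longrightarrow> refl_word as \<circ> refl_word (rev as) = id"
proof (induction as)
  case (Cons a as)
  have "refl_word (a # as) \<circ> refl_word (rev (a # as)) =
      refl a \<circ> (refl_word as \<circ> refl_word (rev as)) \<circ> refl a"
    by (simp add: refl_word_append comp_assoc)
  also have "\<dots> = id" using Cons by (auto simp: fun_eq_iff)
  finally show ?case .
qed simp

lemma inv_refl_word: "as \<in> lists \<Phi> \<Longrightarrow> inv (refl_word as) = refl_word (rev as)"
  using refl_word_rev[of as] refl_word_rev[of "rev as"] by (intro inv_unique_comp) (auto simp: in_lists_conv_set)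

lemma bij_weyl: "w \<in> weyl \<Longrightarrow> bij w"
  unfolding weyl_def using refl_word_rev refl_word_rev[of "rev as" for as]
  by (auto intro!: o_bij simp: in_lists_conv_set)

lemma inv_weyl [simp, intro]: "w \<in> weyl \<Longrightarrow> inv w \<in> weyl"
  unfolding weyl_def using inv_refl_word by (auto simp: in_lists_conv_set intro!: image_eqI)

lemma weyl_inv_comp [simp]: "w \<in> weyl \<Longrightarrow> inv w \<circ> w = id" "w \<in> weyl \<Longrightarrow> w \<circ> inv w = id"
  using bij_weyl by (auto simp: bij_is_inj bij_is_surj fun_eq_iff surj_f_inv_f)

lemma weyl_inv_apply [simp]: "w \<in> weyl \<Longrightarrow> inv w (w x) = x" "w \<in> weyl \<Longrightarrow> w (inv w x) = x"
  using bij_weyl by (auto simp: bij_is_inj bij_is_surj surj_f_inv_f)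

lemma inv_inv_weyl [simp]: "w \<in> weyl \<Longrightarrow> inv (inv w) = w"
  by (simp add: bij_weyl inv_inv_eq)

lemma inv_comp_weyl: "v \<in> weyl \<Longrightarrow> w \<in> weyl \<Longrightarrow> inv (v \<circ> w) = inv w \<circ> inv v"
  by (simp add: bij_weyl o_inv_distrib)

lemma inv_refl [simp]: "\<alpha> \<in> \<Phi> \<Longrightarrow> inv (refl \<alpha>) = refl \<alpha>"
  using refl_comp_refl by (intro inv_unique_comp) auto

lemma weyl_refl_induct [consumes 1, case_names id refl]:
  assumes "w \<in> weyl" "P id"
    and "\<And>\<alpha> w. \<alpha> \<in> \<Phi> \<Longrightarrow> w \<in> weyl \<Longrightarrow> P w \<Longrightarrow> P (refl \<alpha> \<circ> w)"
  shows "P w"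
proof -
  have "P (refl_word as)" if "as \<in> lists \<Phi>" for as
    using that assms(2,3) by (induction as) (auto simp: weyl_def)
  then show ?thesis using assms(1) by (auto simp: weyl_def)
qed

lemma weyl_add: "w \<in> weyl \<Longrightarrow> w (x + y) = w x + w y"
  by (induction rule: weyl_refl_induct) (auto simp: refl_add)

lemma weyl_0 [simp]: "w \<in> weyl \<Longrightarrow> w 0 = 0"
  using weyl_add[of w 0 0] by simp

lemma weyl_minus [simp]: "w \<in> weyl \<Longrightarrow> w (- x) = - w x"
  using weyl_add[of w x "- x"] by (simp add: eq_neg_iff_add_eq_0 add.commute)

lemma weyl_diff: "w \<in> weyl \<Longrightarrow> w (x - y) = w x - w y"
  using weyl_add[of w x "- y"] by simp

lemma weyl_zmul: "w \<in> weyl \<Longrightarrow> w (zmul n x) = zmul n (w x)"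
  by (induction n rule: int_induct[where k = 0])
    (simp_all add: zmul_succ zmul_pred weyl_add weyl_diff)

lemma weyl_root: "w \<in> weyl \<Longrightarrow> \<alpha> \<in> \<Phi> \<Longrightarrow> w \<alpha> \<in> \<Phi>"
  by (induction rule: weyl_refl_induct) (auto simp: refl_root)

lemma root_form_weyl: "w \<in> weyl \<Longrightarrow> root_form (w x) (w y) = root_form x y"
  by (induction rule: weyl_refl_induct) (auto simp: root_form_refl)

lemma coroot_weyl:
  assumes "w \<in> weyl" "\<alpha> \<in> \<Phi>"
  shows "coroot (w \<alpha>) (w x) = coroot \<alpha> x"
proof -
  have "coroot (w \<alpha>) (w x) * root_form \<alpha> \<alpha> = coroot \<alpha> x * root_form \<alpha> \<alpha>"
    by (metis root_form_root weyl_root root_form_weyl assms)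
  then show ?thesis using root_form_pos[OF assms(2)] by simp
qed

lemma refl_weyl_comp:
  assumes "w \<in> weyl" "\<alpha> \<in> \<Phi>"
  shows "refl (w \<alpha>) \<circ> w = w \<circ> refl \<alpha>"
  using assms by (auto simp: refl_def coroot_weyl weyl_diff weyl_zmul)

end

section \<open>Positive roots and the length function\<close>

context positive_system
begin

lemma pos_root: "\<alpha> \<in> pos \<Longrightarrow> \<alpha> \<in> \<Phi>"
  using pos_union by auto

lemma simple_pos: "\<alpha> \<in> simple \<Longrightarrow> \<alpha> \<in> pos"
  by (simp add: simple_def)

lemma simple_root: "\<alpha> \<in> simple \<Longrightarrow> \<alpha> \<in> \<Phi>"
  by (simp add: simple_pos pos_root)

lemma pos_minus: "\<alpha> \<in> pos \<Longrightarrow> - \<alpha> \<notin> pos"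
  using pos_disjoint by force

lemma not_pos_minus: "\<alpha> \<in> \<Phi> \<Longrightarrow> \<alpha> \<notin> pos \<Longrightarrow> - \<alpha> \<in> pos"
  using pos_union by auto

lemma finite_pos: "finite pos"
  using finite_roots pos_union by (metis finite_Un)

section \<open>Sums of positive roots and heights\<close>

lemma coroot_sum_list:
  "\<beta> \<in> \<Phi> \<Longrightarrow> coroot \<beta> (sum_list as) = (\<Sum>a\<leftarrow>as. coroot \<beta> a)"
  by (induction as) (auto simp: coroot_add)

text \<open>Takes the place of a functional positive on \<open>pos\<close>. In a vanishing sum,
  pairing with the coroot of the first term \<open>a\<close> yields a term \<open>b\<close> of
  negative pairing; then \<open>a + b\<close> is a positive root, and merging the two gives a
  shorter vanishing sum.\<close>

lemma sum_list_pos_nonzero: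
  assumes "as \<noteq> []" "set as \<subseteq> pos"
  shows "sum_list as \<noteq> 0"
  using assms
proof (induction "length as" arbitrary: as rule: less_induct)
  case less
  then obtain a bs where as: "as = a # bs" by (cases as) auto
  have a: "a \<in> pos" "a \<in> \<Phi>" using less.prems as pos_root by auto
  show ?case
  proof
    assume 0: "sum_list as = 0"
    then have "2 + (\<Sum>b\<leftarrow>bs. coroot a b) = 0"
      using coroot_sum_list[OF a(2), of as] a as coroot_self by simp
    then have "\<not> (\<forall>b\<in>set bs. coroot a b \<ge> 0)"
      using sum_list_nonneg[of "map (coroot a) bs"] by auto
    then obtain b where b: "b \<in> set bs" "coroot a b < 0" by auto
    have bp: "b \<in> pos" using b less.prems as by auto
    then have "b \<noteq> - a" using pos_minus a by auto
    then have "a + b \<in> \<Phi>" using sum_root[OF a(2) pos_root[OF bp] b(2)] by simp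
    then have ab: "a + b \<in> pos" by (rule pos_closed[OF a(1) bp])
    let ?cs = "(a + b) # remove1 b bs"
    have "sum_list ?cs = sum_list as"
      using b(1) as by (simp add: sum_list_map_remove1[of b bs "\<lambda>x. x", simplified] algebra_simps)
    moreover have "length ?cs < length as"
      using b(1) as length_pos_if_in_set[OF b(1)] by (simp add: length_remove1)
    moreover have "set ?cs \<subseteq> pos"
      using ab less.prems as set_remove1_subset[of b bs] by auto
    ultimately show False using less.hyps[of ?cs] 0 by simp
  qed
qed

definition root_less :: "'x \<Rightarrow> 'x \<Rightarrow> bool"
  where "root_less x y \<longleftrightarrow> (\<exists>as. as \<noteq> [] \<and> set as \<subseteq> pos \<and> y - x = sum_list as)"

lemma root_less_trans: "root_less x y \<Longrightarrow> root_less y z \<Longrightarrow> root_less x z"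
  unfolding root_less_def
proof (elim exE conjE)
  fix as bs assume "as \<noteq> []" "set as \<subseteq> pos" "y - x = sum_list as" "set bs \<subseteq> pos" "z - y = sum_list bs"
  then show "\<exists>as. as \<noteq> [] \<and> set as \<subseteq> pos \<and> z - x = sum_list as"
    by (intro exI[of _ "bs @ as"]) (auto simp flip: \<open>y - x = sum_list as\<close> \<open>z - y = sum_list bs\<close>)
qed

lemma root_less_irrefl: "\<not> root_less x x"
  unfolding root_less_def using sum_list_pos_nonzero by force

lemma root_less_add: "\<beta> \<in> pos \<Longrightarrow> root_less x (x + \<beta>)" "\<beta> \<in> pos \<Longrightarrow> root_less x (\<beta> + x)"
  unfolding root_less_def by (auto intro!: exI[of _ "[\<beta>]"])

text \<open>An induction measure in place of the height by simple coefficients; its strict growth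
  rests on \<open>root_less\<close> being irreflexive.\<close>

definition root_height :: "'x \<Rightarrow> nat"
  where "root_height \<beta> = card {\<gamma> \<in> pos. root_less \<gamma> \<beta>}"

lemma root_height_less:
  assumes "\<beta> \<in> pos" "root_less \<beta> \<gamma>"
  shows "root_height \<beta> < root_height \<gamma>"
proof -
  have "\<beta> \<in> {x \<in> pos. root_less x \<gamma>} - {x \<in> pos. root_less x \<beta>}"
    using assms root_less_irrefl by simp
  moreover have "{x \<in> pos. root_less x \<beta>} \<subseteq> {x \<in> pos. root_less x \<gamma>}"
    using assms root_less_trans by blast
  ultimately show ?thesis
    unfolding root_height_def by (intro psubset_card_mono) (auto simp: finite_pos)
qed

lemma pos_sum_simple:
  assumes "\<beta> \<in> pos"
  shows "\<exists>as. as \<noteq> [] \<and> set as \<subseteq> simple \<and> sum_list as = \<beta>"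
  using assms
proof (induction "root_height \<beta>" arbitrary: \<beta> rule: less_induct)
  case less
  show ?case
  proof (cases "\<beta> \<in> simple")
    case True
    then show ?thesis by (intro exI[of _ "[\<beta>]"]) auto
  next
    case False
    then obtain \<gamma> \<delta> where g: "\<gamma> \<in> pos" "\<delta> \<in> pos" "\<beta> = \<gamma> + \<delta>"
      using less.prems by (auto simp: simple_def)
    obtain as where as: "as \<noteq> []" "set as \<subseteq> simple" "sum_list as = \<gamma>"
      using less.hyps[of \<gamma>] root_height_less[of \<gamma> \<beta>] root_less_add g by metis
    obtain bs where bs: "bs \<noteq> []" "set bs \<subseteq> simple" "sum_list bs = \<delta>"
      using less.hyps[of \<delta>] root_height_less[of \<delta> \<beta>] root_less_add g by metis
    from as bs g show ?thesis by (intro exI[of _ "as @ bs"]) auto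
  qed
qed

section \<open>Simple reflections permute the other positive roots\<close>

lemma double_root: "\<beta> \<in> \<Phi> \<Longrightarrow> \<beta> \<noteq> zmul 2 \<alpha>" if "\<alpha> \<in> \<Phi>"
  using reduced[OF that] zmul_add[of 1 1 \<alpha>] by auto

lemma simple_diff_pos:
  assumes a: "\<alpha> \<in> simple" and b: "\<beta> \<in> pos" and "\<beta> \<noteq> \<alpha>" "coroot \<alpha> \<beta> > 0"
  shows "\<beta> - \<alpha> \<in> pos"
proof (rule ccontr)
  assume n: "\<beta> - \<alpha> \<notin> pos"
  have "\<beta> - \<alpha> \<in> \<Phi>" using diff_root[of \<alpha> \<beta>] assms simple_root pos_root by auto
  then have "\<alpha> - \<beta> \<in> pos" using n not_pos_minus[of "\<beta> - \<alpha>"] by simp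
  moreover have "\<alpha> = \<beta> + (\<alpha> - \<beta>)" by simp
  ultimately show False using a b unfolding simple_def by blast
qed

text \<open>The nonnegative case of \<open>refl_simple_pos\<close>, with \<gamma> standing for the
  negated reflection of \<beta>. Pairing 0 would make a sum of positive roots vanish, pairing 1
  would decompose \<alpha>, and from 2 on subtracting \<alpha> from both roots lowers the pairing by
  2.\<close>

lemma simple_string:
  assumes a: "\<alpha> \<in> simple"
  shows "\<beta> \<in> pos \<Longrightarrow> \<gamma> \<in> pos \<Longrightarrow> \<beta> \<noteq> \<alpha> \<Longrightarrow> \<gamma> \<noteq> \<alpha> \<Longrightarrow> coroot \<alpha> \<beta> = int n \<Longrightarrow>
    coroot \<alpha> \<gamma> = int n \<Longrightarrow> \<beta> + \<gamma> \<noteq> zmul (int n) \<alpha>"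
proof (induction n arbitrary: \<beta> \<gamma> rule: less_induct)
  case (less n)
  note aR = simple_root[OF a]
  show ?case
  proof
    assume eq: "\<beta> + \<gamma> = zmul (int n) \<alpha>"
    consider "n = 0" | "n = 1" | "n \<ge> 2" by linarith
    then show False
    proof cases
      case 1
      then show False using sum_list_pos_nonzero[of "[\<beta>, \<gamma>]"] eq less.prems by simp
    next
      case 2
      then show False using eq a less.prems unfolding simple_def by force
    next
      case 3
      have b: "\<beta> - \<alpha> \<in> pos" "\<gamma> - \<alpha> \<in> pos" using simple_diff_pos[OF a] less.prems 3 by auto
      have e2: "zmul 2 \<alpha> = \<alpha> + \<alpha>" using zmul_add[of 1 1 \<alpha>] by simp
      \<comment> \<open>Here reducedness enters: neither root is twice \<alpha>, so the induction
        hypothesis applies to the differences.\<close>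
      have "\<beta> - \<alpha> \<noteq> \<alpha>" "\<gamma> - \<alpha> \<noteq> \<alpha>"
        using double_root[OF aR, of \<beta>] double_root[OF aR, of \<gamma>] less.prems pos_root e2
        by (auto simp: diff_eq_eq)
      moreover have "int (n - 2) = int n - 2" using 3 by simp
      moreover have "(\<beta> - \<alpha>) + (\<gamma> - \<alpha>) = zmul (int n - 2) \<alpha>"
        using eq by (simp add: zmul_diff e2 algebra_simps)
      ultimately show False
        using less.IH[of "n - 2" "\<beta> - \<alpha>" "\<gamma> - \<alpha>"] b less.prems 3 aR
        by (simp add: coroot_diff coroot_self)
    qed
  qed
qed

text \<open>If the image were negative, \<beta> and the negated image \<gamma> would sum to a
  multiple of \<alpha>. A nonnegative multiple is excluded by \<open>simple_string\<close>; a
  negative one, moved to the other side, makes a sum of positive roots vanish.\<close>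

lemma refl_simple_pos:
  assumes a: "\<alpha> \<in> simple" and b: "\<beta> \<in> pos" and ne: "\<beta> \<noteq> \<alpha>"
  shows "refl \<alpha> \<beta> \<in> pos"
proof (rule ccontr)
  assume n: "refl \<alpha> \<beta> \<notin> pos"
  note aR = simple_root[OF a] and bR = pos_root[OF b]
  define \<gamma> where "\<gamma> = - refl \<alpha> \<beta>"
  have g: "\<gamma> \<in> pos" using n not_pos_minus[OF refl_root[OF aR bR]] by (simp add: \<gamma>_def)
  have sum: "\<beta> + \<gamma> = zmul (coroot \<alpha> \<beta>) \<alpha>" by (simp add: \<gamma>_def refl_def)
  have cg: "coroot \<alpha> \<gamma> = coroot \<alpha> \<beta>"
    using aR by (simp add: \<gamma>_def refl_def coroot_diff coroot_self)
  show False
  proof (cases "coroot \<alpha> \<beta> \<ge> 0")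
    case True
    have "\<gamma> \<noteq> \<alpha>"
    proof
      assume "\<gamma> = \<alpha>"
      then have "\<beta> = \<alpha>" using sum cg aR zmul_add[of 1 1 \<alpha>] by (simp add: coroot_self)
      then show False using ne by simp
    qed
    then show False
      using simple_string[OF a b g ne, of "nat (coroot \<alpha> \<beta>)"] sum cg True by simp
  next
    case False
    define k where "k = nat (- coroot \<alpha> \<beta>)"
    have "sum_list (replicate m \<alpha>) = zmul (int m) \<alpha>" for m
      by (induction m) (simp_all add: zmul_add)
    then have "sum_list (\<beta> # \<gamma> # replicate k \<alpha>) = \<beta> + \<gamma> + zmul (int k) \<alpha>" by (simp add: add.assoc)
    also have "\<dots> = 0" using sum False by (simp add: k_def)
    finally show False
      using sum_list_pos_nonzero[of "\<beta> # \<gamma> # replicate k \<alpha>"] b g simple_pos[OF a]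
      by (cases "k = 0") simp_all
  qed
qed

text \<open>A root pairs to 2 with itself, so some simple summand \<alpha> pairs positively with it.
  Reflecting in \<alpha> lowers the height, and \<open>refl \<beta>\<close> is the conjugate by
  \<open>refl \<alpha>\<close> of the lower reflection.\<close>

lemma refl_generated:
  assumes "\<beta> \<in> pos"
  shows "\<exists>as\<in>lists simple. refl \<beta> = refl_word as"
  using assms
proof (induction "root_height \<beta>" arbitrary: \<beta> rule: less_induct)
  case less
  note bR = pos_root[OF less.prems]
  show ?case
  proof (cases "\<beta> \<in> simple")
    case True
    then show ?thesis by (intro bexI[of _ "[\<beta>]"]) auto
  next
    case False
    obtain as where as: "set as \<subseteq> simple" "sum_list as = \<beta>"
      using pos_sum_simple less.prems by blast
    have "(\<Sum>a\<leftarrow>as. coroot \<beta> a) = 2"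
      using coroot_sum_list[OF bR, of as] as coroot_self[OF bR] by simp
    then have "\<not> (\<forall>a\<in>set as. coroot \<beta> a \<le> 0)"
      using sum_list_nonpos[of "map (coroot \<beta>) as"] by auto
    then obtain \<alpha> where a: "\<alpha> \<in> simple" "coroot \<beta> \<alpha> > 0" using as by force
    note aR = simple_root[OF a(1)]
    define k where "k = nat (coroot \<alpha> \<beta>)"
    have k: "coroot \<alpha> \<beta> = int k" "k > 0"
      using coroot_pos_commute[OF bR aR a(2)] by (auto simp: k_def)
    have p: "refl \<alpha> \<beta> \<in> pos" using refl_simple_pos a False less.prems by metis
    have "sum_list (replicate m \<alpha>) = zmul (int m) \<alpha>" for m
      by (induction m) (simp_all add: zmul_add)
    then have "root_less (refl \<alpha> \<beta>) \<beta>"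
      unfolding root_less_def using k a simple_pos
      by (intro exI[of _ "replicate k \<alpha>"]) (auto simp: refl_def)
    then obtain bs where bs: "bs \<in> lists simple" "refl (refl \<alpha> \<beta>) = refl_word bs"
      using less.hyps root_height_less p by blast
    have "refl \<beta> = refl \<alpha> \<circ> refl_word bs \<circ> refl \<alpha>"
      using refl_weyl_comp[of "refl \<alpha>" \<beta>] aR bR bs by (simp add: fun_eq_iff)
    then show ?thesis using bs a
      by (intro bexI[of _ "\<alpha> # bs @ [\<alpha>]"]) (auto simp: refl_word_append)
  qed
qed

section \<open>Words in simple reflections, length and exchange\<close>

lemma refl_word_simple_weyl: "as \<in> lists simple \<Longrightarrow> refl_word as \<in> weyl"
  using simple_root by (auto simp: weyl_def)

lemma weyl_simple_word:
  assumes "w \<in> weyl"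
  shows "\<exists>as\<in>lists simple. w = refl_word as"
  using assms
proof (induction rule: weyl_refl_induct)
  case id
  show ?case by (intro bexI[of _ "[]"]) auto
next
  case (refl \<alpha> w)
  have "\<exists>bs\<in>lists simple. refl \<alpha> = refl_word bs"
    using refl_generated[of \<alpha>] refl_generated[of "- \<alpha>"] not_pos_minus refl_uminus refl.hyps by metis
  then show ?case using refl.IH
    by (metis append_in_lists_conv refl_word_append)
qed

lemma len_word: "w \<in> weyl \<Longrightarrow> \<exists>as\<in>lists simple. length as = len w \<and> refl_word as = w"
  unfolding len_def by (rule LeastI_ex) (use weyl_simple_word in blast)

lemma len_le: "as \<in> lists simple \<Longrightarrow> len (refl_word as) \<le> length as"
  unfolding len_def by (rule Least_le) blast

lemma len_id [simp]: "len id = 0"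
  using len_le[of "[]"] by simp

lemma len_refl_le:
  assumes "\<alpha> \<in> simple" "w \<in> weyl"
  shows "len (refl \<alpha> \<circ> w) \<le> Suc (len w)"
  using len_word[OF assms(2)] len_le[of "\<alpha> # _"] assms by (metis Cons_in_lists_iff length_Cons refl_word_Cons)

lemma len_inv [simp]:
  assumes "w \<in> weyl"
  shows "len (inv w) = len w"
proof -
  have "len (inv w) \<le> len w" if w: "w \<in> weyl" for w
  proof -
    obtain as where as: "as \<in> lists simple" "length as = len w" "refl_word as = w"
      using len_word[OF w] by blast
    then have "inv w = refl_word (rev as)" using inv_refl_word simple_root by force
    moreover have "rev as \<in> lists simple" using as by (simp add: in_lists_conv_set)
    ultimately show ?thesis using len_le[of "rev as"] as by simp
  qed
  from this[of w] this[of "inv w"] show ?thesis using assms by auto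
qed

text \<open>Strong exchange, for all reflections. The hypothesis says that the inverse of the word
  makes \<beta> negative. A simple reflection changes the sign only of its own root and the negative
  of it, so while letters are stripped from the left the current root must at some point be the
  letter itself; that letter is dropped.\<close>

lemma exchange:
  assumes "as \<in> lists simple" "\<beta> \<in> pos" "\<gamma> \<in> pos" "refl_word as \<gamma> = - \<beta>"
  shows "\<exists>bs\<in>lists simple. length bs < length as \<and> refl_word bs = refl \<beta> \<circ> refl_word as"
  using assms
proof (induction as arbitrary: \<beta> rule: list.induct)
  case Nil
  then show ?case using pos_minus by auto
next
  case (Cons \<alpha> as)
  have "\<alpha> # as \<in> lists simple" by (rule Cons.prems)
  then have a: "\<alpha> \<in> simple" "as \<in> lists simple" by simp_all
  note aR = simple_root[OF a(1)]
  show ?case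
  proof (cases "\<beta> = \<alpha>")
    case True
    then show ?thesis using a aR by (intro bexI[of _ as]) (auto simp: fun_eq_iff)
  next
    case False
    have eq: "refl_word as \<gamma> = - refl \<alpha> \<beta>"
      using Cons.prems aR refl_refl[OF aR, of "refl_word as \<gamma>"] by (simp add: refl_minus)
    obtain bs where bs: "bs \<in> lists simple" "length bs < length as"
        "refl_word bs = refl (refl \<alpha> \<beta>) \<circ> refl_word as"
      using Cons.IH[OF a(2) refl_simple_pos[OF a(1) Cons.prems(2) False] Cons.prems(3) eq] by blast
    have "refl \<alpha> \<circ> refl (refl \<alpha> \<beta>) = refl \<beta> \<circ> refl \<alpha>"
      using refl_weyl_comp[of "refl \<alpha>" "refl \<alpha> \<beta>"] aR pos_root[OF Cons.prems(2)]
      by (simp add: refl_weyl refl_root)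
    then have "refl_word (\<alpha> # bs) = refl \<beta> \<circ> refl_word (\<alpha> # as)"
      using bs(3) by (simp add: comp_assoc[symmetric])
    then show ?thesis using bs a by (intro bexI[of _ "\<alpha> # bs"]) auto
  qed
qed

lemma len_refl_less:
  assumes "w \<in> weyl" "\<beta> \<in> pos" "inv w \<beta> \<notin> pos"
  shows "len (refl \<beta> \<circ> w) < len w"
proof -
  obtain as where as: "as \<in> lists simple" "length as = len w" "refl_word as = w"
    using len_word[OF assms(1)] by blast
  have "- inv w \<beta> \<in> pos" using assms not_pos_minus weyl_root pos_root by blast
  moreover have "refl_word as (- inv w \<beta>) = - \<beta>" using as assms by simp
  ultimately show ?thesis using exchange[OF as(1) assms(2)] as len_le by (metis order_le_less_trans)
qed

lemma len_less_refl:
  assumes "w \<in> weyl" "\<beta> \<in> pos" "inv w \<beta> \<in> pos"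
  shows "len w < len (refl \<beta> \<circ> w)"
proof -
  note bR = pos_root[OF assms(2)]
  have "inv (refl \<beta> \<circ> w) \<beta> = - inv w \<beta>"
    using assms bR by (simp add: inv_comp_weyl refl_weyl inv_weyl)
  then have "inv (refl \<beta> \<circ> w) \<beta> \<notin> pos" using assms pos_minus by simp
  from len_refl_less[OF _ assms(2) this] show ?thesis
    using assms bR by (simp add: comp_assoc[symmetric])
qed

lemma len_refl_simple:
  assumes "\<alpha> \<in> simple" "w \<in> weyl"
  shows "len (refl \<alpha> \<circ> w) = Suc (len w) \<or> len w = Suc (len (refl \<alpha> \<circ> w))"
proof -
  note aR = simple_root[OF assms(1)]
  have "len (refl \<alpha> \<circ> w) \<le> Suc (len w)" using len_refl_le assms by blast
  moreover have "len w \<le> Suc (len (refl \<alpha> \<circ> w))"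
    using len_refl_le[of \<alpha> "refl \<alpha> \<circ> w"] assms aR by (simp add: comp_assoc[symmetric] refl_weyl)
  moreover have "len (refl \<alpha> \<circ> w) \<noteq> len w"
    using len_refl_less[OF assms(2) simple_pos[OF assms(1)]]
      len_less_refl[OF assms(2) simple_pos[OF assms(1)]] by fastforce
  ultimately show ?thesis by linarith
qed

lemma refl_cancel [simp]: "\<alpha> \<in> \<Phi> \<Longrightarrow> refl \<alpha> \<circ> (refl \<alpha> \<circ> w) = w"
  by (simp add: comp_assoc[symmetric])

lemma weyl_descent:
  assumes "w \<in> weyl" "w \<noteq> id"
  shows "\<exists>\<alpha>\<in>simple. \<exists>w'\<in>weyl. w = refl \<alpha> \<circ> w' \<and> len w = Suc (len w')"
proof -
  obtain as where as: "as \<in> lists simple" "length as = len w" "refl_word as = w"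
    using len_word[OF assms(1)] by blast
  then obtain \<alpha> bs where c: "as = \<alpha> # bs" using assms by (cases as) auto
  have a: "\<alpha> \<in> simple" "bs \<in> lists simple" using as c by auto
  have w: "refl_word bs \<in> weyl" "w = refl \<alpha> \<circ> refl_word bs"
    using refl_word_simple_weyl a as c by auto
  have "len (refl_word bs) < len w" using len_le[OF a(2)] as c by auto
  then have "len w = Suc (len (refl_word bs))" using len_refl_simple[OF a(1) w(1)] w(2) by auto
  then show ?thesis using a w by blast
qed

lemma weyl_induct [consumes 1, case_names id refl]:
  assumes "w \<in> weyl" "P id"
    and step: "\<And>\<alpha> w. \<alpha> \<in> simple \<Longrightarrow> w \<in> weyl \<Longrightarrow> len (refl \<alpha> \<circ> w) = Suc (len w) \<Longrightarrow> P w \<Longrightarrow>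
      P (refl \<alpha> \<circ> w)"
  shows "P w"
  using assms(1)
proof (induction "len w" arbitrary: w rule: less_induct)
  case less
  show ?case
  proof (cases "w = id")
    case False
    then show ?thesis using weyl_descent[OF less.prems] less.hyps step by (metis lessI)
  qed (use assms in simp)
qed

section \<open>Inversions and the longest element\<close>

definition inversions :: "('x \<Rightarrow> 'x) \<Rightarrow> 'x set"
  where "inversions w = {\<beta> \<in> pos. w \<beta> \<notin> pos}"

text \<open>Lengthening by \<open>refl \<alpha>\<close> on the left adds the inversion \<alpha> and
  moves the others by \<open>refl \<alpha>\<close>.\<close>

lemma len_inversions:
  assumes "w \<in> weyl"
  shows "len w = card (inversions (inv w))"
  using assms
proof (induction rule: weyl_induct)
  case id
  have "inversions id = {}" by (simp add: inversions_def)
  then show ?case by (metis card.empty inv_id len_id)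
next
  case (refl \<alpha> w)
  note aR = simple_root[OF refl(1)] and aP = simple_pos[OF refl(1)]
  have inv: "inv (refl \<alpha> \<circ> w) = inv w \<circ> refl \<alpha>" using refl aR by (simp add: inv_comp_weyl refl_weyl)
  have iwa: "inv w \<alpha> \<in> pos"
    using len_refl_less[OF refl(2) aP] refl(3) by fastforce
  have "inversions (inv w \<circ> refl \<alpha>) = insert \<alpha> (refl \<alpha> ` inversions (inv w))"
  proof (intro set_eqI iffI)
    fix \<beta> assume b: "\<beta> \<in> inversions (inv w \<circ> refl \<alpha>)"
    show "\<beta> \<in> insert \<alpha> (refl \<alpha> ` inversions (inv w))"
    proof (cases "\<beta> = \<alpha>")
      case False
      then have "refl \<alpha> \<beta> \<in> inversions (inv w)"
        using b refl_simple_pos[OF refl(1)] by (auto simp: inversions_def)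
      then show ?thesis using aR by (metis image_eqI insertCI refl_refl)
    qed simp
  next
    fix \<beta> assume "\<beta> \<in> insert \<alpha> (refl \<alpha> ` inversions (inv w))"
    then consider "\<beta> = \<alpha>" | \<gamma> where "\<gamma> \<in> inversions (inv w)" "\<beta> = refl \<alpha> \<gamma>" by blast
    then show "\<beta> \<in> inversions (inv w \<circ> refl \<alpha>)"
    proof cases
      case 1
      then show ?thesis
        using iwa aP aR pos_minus refl(2) by (simp add: inversions_def inv_weyl)
    next
      case 2
      then have "\<gamma> \<noteq> \<alpha>" using iwa by (auto simp: inversions_def)
      then show ?thesis using 2 aR refl_simple_pos[OF refl(1)] by (simp add: inversions_def)
    qed
  qed
  moreover have "\<alpha> \<notin> refl \<alpha> ` inversions (inv w)"
  proof
    assume "\<alpha> \<in> refl \<alpha> ` inversions (inv w)"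
    then obtain \<gamma> where "\<gamma> \<in> pos" "\<alpha> = refl \<alpha> \<gamma>" by (auto simp: inversions_def)
    then have "\<gamma> = - \<alpha>" using aR by (metis refl_refl refl_self)
    then show False using \<open>\<gamma> \<in> pos\<close> pos_minus aP by simp
  qed
  moreover have "finite (inversions (inv w))" by (simp add: inversions_def finite_pos)
  moreover have "inj_on (refl \<alpha>) (inversions (inv w))"
    using aR by (metis inj_onI refl_refl)
  ultimately have "card (inversions (inv w \<circ> refl \<alpha>)) = Suc (len w)"
    using refl(4) by (simp add: card_image)
  then show "len (refl \<alpha> \<circ> w) = card (inversions (inv (refl \<alpha> \<circ> w)))"
    unfolding inv using refl(3) by simp
qed

lemma len_le_card_pos: "w \<in> weyl \<Longrightarrow> len w \<le> card pos"
  by (simp add: len_inversions inversions_def card_mono finite_pos)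

lemma len_0_iff: "w \<in> weyl \<Longrightarrow> len w = 0 \<longleftrightarrow> w = id"
  using weyl_descent by force

lemma finite_simple: "finite simple"
  using finite_pos by (simp add: simple_def)

lemma finite_weyl [simp]: "finite weyl"
proof (rule finite_subset)
  show "weyl \<subseteq> refl_word ` {as. set as \<subseteq> simple \<and> length as \<le> card pos}"
  proof
    fix w assume w: "w \<in> weyl"
    then obtain as where "as \<in> lists simple" "length as = len w" "refl_word as = w"
      using len_word by blast
    then show "w \<in> refl_word ` {as. set as \<subseteq> simple \<and> length as \<le> card pos}"
      using len_le_card_pos[OF w] by (auto intro!: image_eqI[of _ _ as])
  qed
  show "finite (refl_word ` {as. set as \<subseteq> simple \<and> length as \<le> card pos})"
    using finite_lists_length_le[OF finite_simple] by simp
qed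

lemma weyl_sum_list: "w \<in> weyl \<Longrightarrow> w (sum_list as) = sum_list (map w as)"
  by (induction as) (auto simp: weyl_add)

text \<open>For an element of maximal length, the inverse makes every simple root negative, since
  otherwise a simple reflection would lengthen the element; this spreads to all positive
  roots.\<close>

lemma longest_exists:
  "\<exists>w\<in>weyl. \<forall>\<beta>\<in>pos. w \<beta> \<notin> pos"
proof -
  obtain w where w: "w \<in> weyl" "\<And>v. v \<in> weyl \<Longrightarrow> len v \<le> len w"
    using ex_has_greatest_nat[of "\<lambda>w. w \<in> weyl" id len "Suc (card pos)"] len_le_card_pos
    by (metis id_weyl le_imp_less_Suc)
  have s: "inv w \<alpha> \<notin> pos" if "\<alpha> \<in> simple" for \<alpha>
    using len_less_refl[OF w(1) simple_pos[OF that]] w(2)[of "refl \<alpha> \<circ> w"] w(1) simple_root[OF that]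
    by (auto simp: refl_weyl)
  have "inv w \<beta> \<notin> pos" if b: "\<beta> \<in> pos" for \<beta>
  proof
    assume p: "inv w \<beta> \<in> pos"
    obtain as where as: "as \<noteq> []" "set as \<subseteq> simple" "sum_list as = \<beta>"
      using pos_sum_simple[OF b] by blast
    \<comment> \<open>If one positive root stayed positive, its image and the negated images of its
      simple summands would be positive roots with sum zero.\<close>
    let ?bs = "inv w \<beta> # map (\<lambda>a. - inv w a) as"
    have iw: "inv w \<in> weyl" using w by simp
    have "sum_list (map (\<lambda>a. - f a) as) = - sum_list (map f as)" for f :: "'x \<Rightarrow> 'x"
      by (induction as) auto
    then have "sum_list ?bs = 0"
      using weyl_sum_list[OF iw, of as] as(3) by simp
    moreover have "set ?bs \<subseteq> pos"
      using p s as(2) not_pos_minus weyl_root[OF iw] simple_root by auto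
    ultimately show False using sum_list_pos_nonzero[of ?bs] by simp
  qed
  then show ?thesis using w inv_weyl by blast
qed

text \<open>Maximal length means that all positive roots are inverted. Two such elements differ by
  one that inverts none, which has length 0; this uniqueness gives the definite description in
  \<open>longest\<close> its value.\<close>

lemma longest_props: "longest \<in> weyl" "len longest = card pos"
  and longest_unique: "\<And>v. v \<in> weyl \<Longrightarrow> len v = card pos \<Longrightarrow> v = longest"
proof -
  obtain w where w: "w \<in> weyl" "\<forall>\<beta>\<in>pos. w \<beta> \<notin> pos" using longest_exists by blast
  have lenw: "len w = card pos"
    using len_inversions[of "inv w"] w by (simp add: inversions_def Collect_conj_eq Int_absorb2 subset_iff)
  have uniq: "v = w" if v: "v \<in> weyl" "len v = card pos" for v
  proof -
    have "inversions (inv v) = pos"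
      using len_inversions v finite_pos by (intro card_subset_eq) (auto simp: inversions_def)
    then have neg: "inv v \<beta> \<notin> pos" if "\<beta> \<in> pos" for \<beta> using that by (auto simp: inversions_def)
    have "(inv v \<circ> w) \<beta> \<in> pos" if b: "\<beta> \<in> pos" for \<beta>
    proof -
      have "- w \<beta> \<in> pos" using w b not_pos_minus weyl_root pos_root by blast
      then have "inv v (- w \<beta>) \<notin> pos" by (rule neg)
      then show ?thesis
        using v w b not_pos_minus[of "inv v (- w \<beta>)"] weyl_root pos_root minus_root by (simp add: inv_weyl)
    qed
    then have "inversions (inv v \<circ> w) = {}" by (auto simp: inversions_def)
    then have "len (inv (inv v \<circ> w)) = 0"
      using len_inversions[of "inv (inv v \<circ> w)"] v w by (simp add: comp_weyl inv_weyl)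
    then have "inv (inv v \<circ> w) = id" using len_0_iff v w by (metis comp_weyl inv_weyl)
    then have "inv v \<circ> w = id" using v w by (metis comp_weyl inv_weyl inv_inv_weyl inv_id)
    then have "v \<circ> (inv v \<circ> w) = v" by simp
    then show ?thesis using v by (simp add: comp_assoc[symmetric])
  qed
  have "longest = w"
    unfolding longest_def
  proof (rule the_equality)
    show "w \<in> weyl \<and> (\<forall>v\<in>weyl. len v \<le> len w)" using w lenw len_le_card_pos by auto
    fix v assume "v \<in> weyl \<and> (\<forall>x\<in>weyl. len x \<le> len v)"
    then have "v \<in> weyl" "len v = card pos"
      using w(1) lenw len_le_card_pos[of v] by (auto simp: le_antisym)
    then show "v = w" by (rule uniq)
  qed
  then show "longest \<in> weyl" "len longest = card pos"
    "v \<in> weyl \<Longrightarrow> len v = card pos \<Longrightarrow> v = longest" for v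
    by (simp_all only: w(1) lenw uniq)
qed

lemma inv_longest: "inv longest = longest"
  using longest_unique[of "inv longest"] longest_props by auto

lemma longest_longest [simp]: "longest \<circ> longest = id"
  using weyl_inv_comp(2)[OF longest_props(1)] inv_longest by simp

lemma longest_cancel [simp]: "longest \<circ> (longest \<circ> w) = w"
  by (simp add: comp_assoc[symmetric])

lemma longest_inj: "x \<in> weyl \<Longrightarrow> w \<in> weyl \<Longrightarrow> longest \<circ> x = longest \<circ> w \<longleftrightarrow> x = w"
  by (metis longest_cancel)

text \<open>The longest element exchanges positive and negative roots, so the inversion sets counted
  by the two lengths are complementary in \<open>pos\<close>.\<close>

lemma len_comp_longest:
  assumes "w \<in> weyl"
  shows "len (w \<circ> longest) + len w = card pos"
proof -
  have "inversions (inv longest) = pos"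
    using longest_props len_inversions[of longest] finite_pos
    by (intro card_subset_eq) (auto simp: inversions_def)
  then have neg: "longest \<beta> \<notin> pos" if "\<beta> \<in> pos" for \<beta>
    using that inv_longest by (auto simp: inversions_def)
  have iw: "inv w \<in> weyl" using assms by simp
  have "longest (inv w \<beta>) \<notin> pos \<longleftrightarrow> inv w \<beta> \<in> pos" if b: "\<beta> \<in> pos" for \<beta>
  proof -
    have R: "inv w \<beta> \<in> \<Phi>" using weyl_root[OF iw] pos_root[OF b] .
    have "longest (inv w \<beta>) \<in> pos" if "inv w \<beta> \<notin> pos"
      using neg[of "- inv w \<beta>"] not_pos_minus[OF R that] longest_props(1) R
        not_pos_minus[of "- longest (inv w \<beta>)"] weyl_root minus_root by simp
    then show ?thesis using neg by blast
  qed
  then have "inversions (inv (w \<circ> longest)) = pos - inversions (inv w)"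
    using assms longest_props inv_longest by (auto simp: inversions_def inv_comp_weyl)
  moreover have "card (pos - inversions (inv w)) = card pos - card (inversions (inv w))"
    by (intro card_Diff_subset) (auto simp: inversions_def finite_pos)
  ultimately show ?thesis
    using len_inversions[OF assms] len_inversions[of "w \<circ> longest"] len_le_card_pos[OF assms] assms longest_props
    by (simp add: comp_weyl)
qed

lemma len_longest_comp:
  assumes "w \<in> weyl"
  shows "len (longest \<circ> w) + len w = card pos"
  using len_comp_longest[of "inv w"] assms longest_props len_inv[of "longest \<circ> w"]
  by (simp add: inv_comp_weyl inv_longest comp_weyl inv_weyl)

section \<open>Bruhat order\<close>

definition bruhat_step :: "('x \<Rightarrow> 'x) \<Rightarrow> ('x \<Rightarrow> 'x) \<Rightarrow> bool"
  where "bruhat_step u v \<longleftrightarrow> u \<in> weyl \<and> (\<exists>\<beta>\<in>pos. v = refl \<beta> \<circ> u) \<and> len u < len v"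

lemma bruhat_step_weyl: "bruhat_step u v \<Longrightarrow> u \<in> weyl \<and> v \<in> weyl"
  using pos_root by (auto simp: bruhat_step_def)

lemma bruhat_iff: "bruhat u v \<longleftrightarrow> u \<in> weyl \<and> bruhat_step\<^sup>*\<^sup>* u v"
proof -
  have "{(x, refl \<alpha> \<circ> x) | x \<alpha>. x \<in> weyl \<and> \<alpha> \<in> \<Phi> \<and> len x < len (refl \<alpha> \<circ> x)} =
      {(u, v). bruhat_step u v}"
    unfolding bruhat_step_def
    by (auto dest: pos_root) (metis not_pos_minus refl_uminus)+
  moreover have "v \<in> weyl" if "bruhat_step\<^sup>*\<^sup>* u v" "u \<in> weyl"
    using that by (induction rule: rtranclp_induct) (auto dest: bruhat_step_weyl)
  ultimately show ?thesis unfolding bruhat_def by (auto simp: rtranclp_rtrancl_eq)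
qed

lemma bruhat_weyl: "bruhat u v \<Longrightarrow> u \<in> weyl" "bruhat u v \<Longrightarrow> v \<in> weyl"
  by (auto simp: bruhat_def)

lemma bruhat_refl [simp]: "u \<in> weyl \<Longrightarrow> bruhat u u"
  by (simp add: bruhat_iff)

lemma bruhat_trans: "bruhat u v \<Longrightarrow> bruhat v w \<Longrightarrow> bruhat u w"
  by (auto simp: bruhat_iff)

lemma bruhat_len: "bruhat u v \<Longrightarrow> u = v \<or> len u < len v"
proof -
  have "u = v \<or> len u < len v" if "bruhat_step\<^sup>*\<^sup>* u v"
    using that by (induction rule: rtranclp_induct) (auto simp: bruhat_step_def)
  then show "bruhat u v \<Longrightarrow> u = v \<or> len u < len v" by (simp add: bruhat_iff)
qed

lemma bruhat_antisym: "bruhat u v \<Longrightarrow> bruhat v u \<Longrightarrow> u = v"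
  using bruhat_len[of u v] bruhat_len[of v u] by auto

lemma bruhat_refl_simple:
  assumes "\<alpha> \<in> simple" "w \<in> weyl" "len (refl \<alpha> \<circ> w) = Suc (len w)"
  shows "bruhat w (refl \<alpha> \<circ> w)"
proof -
  have "bruhat_step w (refl \<alpha> \<circ> w)" using assms simple_pos by (auto simp: bruhat_step_def)
  then show ?thesis using assms by (auto simp: bruhat_iff)
qed

text \<open>Conjugation turns the reflection in \<beta> into that in
  \<open>refl \<alpha> \<beta>\<close>, positive unless \<beta> is \<alpha>. The direction of a step
  depends only on the sign of \<open>inv u \<beta>\<close>, which this leaves unchanged.\<close>

lemma bruhat_step_refl:
  assumes a: "\<alpha> \<in> simple" and "bruhat_step u v"
  shows "v = refl \<alpha> \<circ> u \<or> bruhat_step (refl \<alpha> \<circ> u) (refl \<alpha> \<circ> v)"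
proof -
  note aR = simple_root[OF a]
  obtain \<beta> where b: "u \<in> weyl" "\<beta> \<in> pos" "v = refl \<beta> \<circ> u" "len u < len v"
    using assms by (auto simp: bruhat_step_def)
  note bR = pos_root[OF b(2)]
  show ?thesis
  proof (cases "\<beta> = \<alpha>")
    case False
    have s: "refl \<alpha> \<beta> \<in> pos" using refl_simple_pos[OF a b(2) False] .
    have v: "refl \<alpha> \<circ> v = refl (refl \<alpha> \<beta>) \<circ> (refl \<alpha> \<circ> u)"
      using refl_weyl_comp[of "refl \<alpha>" \<beta>] aR bR b(3) by (simp add: refl_weyl comp_assoc[symmetric])
    have "inv u \<beta> \<in> pos" using len_refl_less[OF b(1,2)] b(3,4) by fastforce
    then have "inv (refl \<alpha> \<circ> u) (refl \<alpha> \<beta>) \<in> pos"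
      using b(1) aR by (simp add: inv_comp_weyl refl_weyl)
    then have "len (refl \<alpha> \<circ> u) < len (refl \<alpha> \<circ> v)"
      unfolding v using len_less_refl[of "refl \<alpha> \<circ> u" "refl \<alpha> \<beta>"] s b(1) aR by (simp add: refl_weyl comp_weyl)
    then show ?thesis
      unfolding bruhat_step_def using s v b(1) aR by (auto simp: refl_weyl comp_weyl)
  qed (use b in simp)
qed

text \<open>Lifting property in a form free of length hypotheses. The steps of a chain are
  transported by \<open>refl \<alpha>\<close>; the first one that cannot be is multiplication by
  \<open>refl \<alpha>\<close> itself, after which the original chain continues.\<close>

lemma bruhat_lift_left:
  assumes a: "\<alpha> \<in> simple" and "bruhat u v"
  shows "bruhat (refl \<alpha> \<circ> u) v \<or> bruhat (refl \<alpha> \<circ> u) (refl \<alpha> \<circ> v)"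
proof -
  note aR = simple_root[OF a]
  have "bruhat (refl \<alpha> \<circ> u) v \<or> bruhat (refl \<alpha> \<circ> u) (refl \<alpha> \<circ> v)"
    if "bruhat_step\<^sup>*\<^sup>* u v" "u \<in> weyl" for u v
    using that
  proof (induction rule: converse_rtranclp_induct)
    case base
    then show ?case using aR by (metis bruhat_refl comp_weyl refl_weyl)
  next
    case (step u x)
    have x: "x \<in> weyl" using step bruhat_step_weyl by blast
    from bruhat_step_refl[OF a step(1)]
    show "bruhat (refl \<alpha> \<circ> u) v \<or> bruhat (refl \<alpha> \<circ> u) (refl \<alpha> \<circ> v)"
    proof
      assume "x = refl \<alpha> \<circ> u"
      moreover have "bruhat x v" using step(2) x by (simp add: bruhat_iff)
      ultimately show ?thesis by simp
    next
      assume "bruhat_step (refl \<alpha> \<circ> u) (refl \<alpha> \<circ> x)"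
      then have "bruhat (refl \<alpha> \<circ> u) (refl \<alpha> \<circ> x)"
        using bruhat_step_weyl by (auto simp: bruhat_iff)
      then show ?thesis using step.IH[OF x] bruhat_trans by blast
    qed
  qed
  then show ?thesis using assms by (simp add: bruhat_iff)
qed

lemma bruhat_lift_right:
  assumes a: "\<alpha> \<in> simple" and uv: "bruhat u v"
  shows "bruhat u (refl \<alpha> \<circ> v) \<or> bruhat (refl \<alpha> \<circ> u) (refl \<alpha> \<circ> v)"
proof -
  note aR = simple_root[OF a]
  have "u \<in> weyl" "bruhat_step\<^sup>*\<^sup>* u v" using uv by (auto simp: bruhat_iff)
  from this(2,1) show ?thesis
  proof (induction rule: rtranclp_induct)
    case base
    then show ?case using aR by (metis bruhat_refl comp_weyl refl_weyl)
  next
    case (step x v)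
    have x: "x \<in> weyl" "v \<in> weyl" using step bruhat_step_weyl by blast+
    have ux: "bruhat u x" using step by (simp add: bruhat_iff)
    from bruhat_step_refl[OF a step(2)]
    show "bruhat u (refl \<alpha> \<circ> v) \<or> bruhat (refl \<alpha> \<circ> u) (refl \<alpha> \<circ> v)"
    proof
      assume "v = refl \<alpha> \<circ> x"
      then show ?thesis using ux aR by simp
    next
      assume "bruhat_step (refl \<alpha> \<circ> x) (refl \<alpha> \<circ> v)"
      then have "bruhat (refl \<alpha> \<circ> x) (refl \<alpha> \<circ> v)"
        using bruhat_step_weyl by (auto simp: bruhat_iff)
      then show ?thesis using step.IH[OF step.prems] bruhat_trans by blast
    qed
  qed
qed

text \<open>Here and in the next lemma a length condition at one end merges the two alternatives of
  the lifting property.\<close>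

lemma bruhat_refl_le:
  assumes "\<alpha> \<in> simple" "bruhat u v" "len v = Suc (len (refl \<alpha> \<circ> v))"
  shows "bruhat (refl \<alpha> \<circ> u) v"
  using bruhat_lift_left[OF assms(1,2)] bruhat_refl_simple[of \<alpha> "refl \<alpha> \<circ> v"] bruhat_trans
    assms simple_root bruhat_weyl[OF assms(2)] by (auto simp: refl_weyl comp_weyl)

lemma bruhat_le_refl:
  assumes "\<alpha> \<in> simple" "bruhat u v" "len (refl \<alpha> \<circ> u) = Suc (len u)"
  shows "bruhat u (refl \<alpha> \<circ> v)"
  using bruhat_lift_right[OF assms(1,2)] bruhat_refl_simple[of \<alpha> u] bruhat_trans
    assms bruhat_weyl[OF assms(2)] by auto

text \<open>Each step is reversed: lengths become complementary, and conjugation by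
  \<open>longest\<close> turns a reflection into a reflection, whose root may need a change of sign
  to count as positive.\<close>

lemma bruhat_longest:
  assumes "bruhat u v"
  shows "bruhat (longest \<circ> v) (longest \<circ> u)"
proof -
  have "u \<in> weyl" "bruhat_step\<^sup>*\<^sup>* u v" using assms by (auto simp: bruhat_iff)
  from this(2,1) show ?thesis
  proof (induction rule: rtranclp_induct)
    case base
    then show ?case using longest_props by (metis bruhat_refl comp_weyl)
  next
    case (step x v)
    then obtain \<beta> where b: "x \<in> weyl" "\<beta> \<in> pos" "v = refl \<beta> \<circ> x" "len x < len v"
      by (auto simp: bruhat_step_def)
    note bR = pos_root[OF b(2)]
    have v: "v \<in> weyl" using b bR by (simp add: refl_weyl comp_weyl)
    let ?g = "longest \<beta>"
    have gR: "?g \<in> \<Phi>" using weyl_root[OF longest_props(1) bR] .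
    have "longest \<circ> refl \<beta> \<circ> v = refl ?g \<circ> (longest \<circ> v)"
      using refl_weyl_comp[OF longest_props(1) bR] by (metis comp_assoc)
    then have "longest \<circ> x = refl ?g \<circ> (longest \<circ> v)" using b bR by (simp add: comp_assoc)
    moreover have "len (longest \<circ> v) < len (longest \<circ> x)"
      using len_longest_comp[OF v] len_longest_comp[OF b(1)] b(4) by simp
    moreover have "refl ?g = refl (- ?g)" using refl_uminus[OF gR] by simp
    ultimately have "bruhat_step (longest \<circ> v) (longest \<circ> x)"
      unfolding bruhat_step_def using not_pos_minus[OF gR] longest_props v by (metis comp_weyl)
    then have "bruhat (longest \<circ> v) (longest \<circ> x)"
      using longest_props v by (simp add: bruhat_iff comp_weyl)
    then show ?case using step.IH[OF step.prems] bruhat_trans by blast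
  qed
qed

lemma bruhat_longest_iff:
  assumes "u \<in> weyl" "v \<in> weyl"
  shows "bruhat (longest \<circ> v) (longest \<circ> u) \<longleftrightarrow> bruhat u v"
  using bruhat_longest[of u v] bruhat_longest[of "longest \<circ> v" "longest \<circ> u"] by auto

end

section \<open>Rational functions in \<open>q\<close>\<close>

lemma Fract_cases_poly:
  fixes f :: "'f::field poly fract"
  obtains a b where "f = Fract a b" "b \<noteq> 0"
  by (cases f) auto

lemma cst_1: "cst 1 = 1"
  by (simp add: cst_def fract_collapse flip: one_pCons)

lemma at_inv_q_1: "at_inv_q 1 = 1"
  by (simp add: one_pCons at_inv_q_pCons at_inv_q_0) (simp add: cst_def One_fract_def one_pCons)

lemma bar_add: "bar (f + g) = bar f + bar g"
proof -
  obtain a b c d where "f = Fract a b" "b \<noteq> 0" "g = Fract c d" "d \<noteq> 0"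
    by (metis Fract_cases_poly)
  then show ?thesis
    by (simp add: bar_Fract at_inv_q_add at_inv_q_mult at_inv_q_nonzero field_simps)
qed

lemma bar_mult: "bar (f * g) = bar f * bar g"
proof -
  obtain a b c d where "f = Fract a b" "b \<noteq> 0" "g = Fract c d" "d \<noteq> 0"
    by (metis Fract_cases_poly)
  then show ?thesis
    by (simp add: bar_Fract at_inv_q_mult)
qed

lemma bar_0 [simp]: "bar 0 = 0"
  by (simp add: Zero_fract_def bar_Fract at_inv_q_0 at_inv_q_1)

lemma bar_1 [simp]: "bar 1 = 1"
  by (simp add: One_fract_def bar_Fract at_inv_q_1)

lemma bar_minus: "bar (- f) = - bar f"
  using bar_add[of f "- f"] by (simp add: eq_neg_iff_add_eq_0 add.commute)

lemma bar_diff: "bar (f - g) = bar f - bar g"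
  using bar_add[of f "- g"] by (simp add: bar_minus)

lemma bar_sum: "bar (sum f A) = (\<Sum>x\<in>A. bar (f x))"
  by (induction A rule: infinite_finite_induct) (auto simp: bar_add)

lemma bar_power: "bar (f ^ n) = bar f ^ n"
  by (induction n) (auto simp: bar_mult)

lemma bar_inverse: "bar (inverse f) = inverse (bar f)"
proof (cases "f = 0")
  case False
  then have "bar (inverse f) * bar f = 1" by (simp flip: bar_mult)
  then show ?thesis by (metis inverse_unique mult.commute)
qed simp

lemma bar_qq [simp]: "bar qq = inverse qq"
  by (simp add: qq_def bar_Fract at_inv_q_1)
    (simp add: at_inv_q_pCons at_inv_q_0 cst_0 at_inv_q_1 flip: one_pCons, simp add: qq_def cst_def One_fract_def flip: one_pCons)

lemma bar_cst [simp]: "bar (cst c) = cst c"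
  by (simp add: cst_def bar_Fract at_inv_q_1) (simp add: at_inv_q_pCons at_inv_q_0 cst_def)

text \<open>The reflected polynomial is \<open>q^deg r\<close> times the conjugate, so the
  hypothesis says that \<open>q^d\<close> times it equals \<open>q^deg r\<close> times
  \<open>r\<close>. The coefficient at \<open>2 deg r\<close> is the leading one of \<open>r\<close>
  on the right and, as \<open>2 deg r < d\<close>, zero on the left.\<close>

lemma bar_invariant_small_degree:
  assumes "2 * degree r < d" "bar (Fract r 1) = inverse qq ^ d * Fract r 1"
  shows "r = 0"
proof (rule ccontr)
  assume r: "r \<noteq> 0"
  have cst_0_iff: "cst c = 0 \<longleftrightarrow> c = 0" for c :: 'a
    by (simp add: cst_def Zero_fract_def eq_fract)
  have deg: "degree (map_poly cst r) = degree r"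
    by (simp add: degree_map_poly cst_0_iff)
  have refl: "reflect_poly (map_poly cst r) = map_poly cst (reflect_poly r)"
    by (intro poly_eqI) (simp add: coeff_reflect_poly coeff_map_poly cst_0 deg)
  have "Fract (reflect_poly r) 1 = poly (reflect_poly (map_poly cst r)) qq"
    by (simp add: poly_cst_qq refl)
  also have "\<dots> = qq ^ degree r * bar (Fract r 1)"
    by (simp add: poly_reflect_poly_nz qq_nonzero deg bar_Fract at_inv_q_1 at_inv_q_def[of r])
  also have "\<dots> = qq ^ degree r * (inverse qq ^ d * Fract r 1)"
    using assms(2) by simp
  finally have eq: "qq ^ d * Fract (reflect_poly r) 1 = qq ^ degree r * Fract r 1"
    using qq_nonzero[where 'a = 'a] by (simp add: field_simps)
  have pow: "qq ^ n = Fract (monom 1 n) 1" for n :: nat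
    by (induction n) (simp_all add: qq_def One_fract_def monom_Suc mult.commute flip: one_pCons)
  have "monom 1 d * reflect_poly r = monom 1 (degree r) * r"
    using eq by (simp add: pow eq_fract)
  moreover have "coeff (monom 1 (degree r) * r) (2 * degree r) \<noteq> 0"
    using r by (simp add: coeff_monom_mult)
  moreover have "coeff (monom 1 d * reflect_poly r) (2 * degree r) = 0"
    using assms(1) by (simp add: coeff_monom_mult)
  ultimately show False by simp
qed

text \<open>The Kazhdan-Lusztig degree bound for field elements that are polynomials in
  \<open>q\<close>, with \<open>d\<close> a difference of lengths. No element satisfies it for
  \<open>d = 0\<close>.\<close>

definition low_degree :: "nat \<Rightarrow> 'f::field poly fract \<Rightarrow> bool"
  where "low_degree d f \<longleftrightarrow> (\<exists>r. f = Fract r 1 \<and> 2 * degree r + 1 \<le> d)"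

lemma low_degree_0: "d > 0 \<Longrightarrow> low_degree d 0"
  unfolding low_degree_def by (intro exI[of _ 0]) (simp add: Zero_fract_def)

lemma low_degree_add: "low_degree d f \<Longrightarrow> low_degree d g \<Longrightarrow> low_degree d (f + g)"
  unfolding low_degree_def
proof (elim exE conjE)
  fix r s assume "f = Fract r 1" "g = Fract s 1" "2 * degree r + 1 \<le> d" "2 * degree s + 1 \<le> d"
  then show "\<exists>r. f + g = Fract r 1 \<and> 2 * degree r + 1 \<le> d"
    using degree_add_le_max[of r s] by (intro exI[of _ "r + s"]) auto
qed

lemma low_degree_minus: "low_degree d f \<Longrightarrow> low_degree d (- f)"
  unfolding low_degree_def
proof (elim exE conjE)
  fix r assume "f = Fract r 1" "2 * degree r + 1 \<le> d"
  then show "\<exists>r. - f = Fract r 1 \<and> 2 * degree r + 1 \<le> d"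
    by (intro exI[of _ "- r"]) auto
qed

lemma low_degree_mult: "low_degree d f \<Longrightarrow> low_degree e g \<Longrightarrow> low_degree (d + e) (f * g)"
  unfolding low_degree_def
proof (elim exE conjE)
  fix r s assume "f = Fract r 1" "g = Fract s 1" "2 * degree r + 1 \<le> d" "2 * degree s + 1 \<le> e"
  then show "\<exists>r. f * g = Fract r 1 \<and> 2 * degree r + 1 \<le> d + e"
    using degree_mult_le[of r s] by (intro exI[of _ "r * s"]) auto
qed

lemma low_degree_sum: "d > 0 \<Longrightarrow> (\<And>x. x \<in> A \<Longrightarrow> low_degree d (f x)) \<Longrightarrow> low_degree d (sum f A)"
  by (induction A rule: infinite_finite_induct) (auto simp: low_degree_0 low_degree_add)

lemma low_degree_bar_eq_0:
  assumes "low_degree d f" "bar f = inverse qq ^ d * f"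
  shows "f = 0"
proof -
  obtain r where r: "f = Fract r 1" "2 * degree r + 1 \<le> d" using assms(1) by (auto simp: low_degree_def)
  then have "r = 0" using bar_invariant_small_degree[of r d] assms(2) by simp
  then show ?thesis using r by (simp add: Zero_fract_def)
qed

lemma sum_mult_assoc:
  "(\<Sum>z\<in>A. f z * (\<Sum>y\<in>B. g z y * h y)) = (\<Sum>y\<in>B. (\<Sum>z\<in>A. f z * g z y) * h y)"
  for f :: "'i \<Rightarrow> 'f::field" and h :: "'j \<Rightarrow> 'f"
  by (simp add: sum_distrib_left sum_distrib_right mult.assoc) (rule sum.swap)

context positive_system
begin

section \<open>Verma's formula\<close>

text \<open>Multiplication by \<open>refl \<alpha>\<close> preserves the interval, because it is a
  descent of the upper end and an ascent of the lower one, and it flips every sign.\<close>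

lemma bruhat_interval_sum_0:
  assumes a: "\<alpha> \<in> simple" and "w \<in> weyl" "u \<in> weyl"
    and w: "len w = Suc (len (refl \<alpha> \<circ> w))" and u: "len (refl \<alpha> \<circ> u) = Suc (len u)"
  shows "(\<Sum>x\<in>{x. bruhat u x \<and> bruhat x w}. (- 1) ^ len x :: int) = 0"
proof -
  note aR = simple_root[OF a]
  let ?I = "{x. bruhat u x \<and> bruhat x w}"
  have mem: "refl \<alpha> \<circ> x \<in> ?I" if "x \<in> ?I" for x
    using that bruhat_refl_le[OF a _ w] bruhat_le_refl[OF a _ u] by auto
  have "(\<Sum>x\<in>?I. (- 1) ^ len x :: int) = (\<Sum>x\<in>?I. (- 1) ^ len (refl \<alpha> \<circ> x))"
    by (rule sum.reindex_bij_witness[of _ "\<lambda>x. refl \<alpha> \<circ> x" "\<lambda>x. refl \<alpha> \<circ> x"])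
      (use mem aR in simp_all)
  also have "\<dots> = (\<Sum>x\<in>?I. - ((- 1) ^ len x))"
  proof (rule sum.cong[OF refl])
    fix x assume "x \<in> ?I"
    then have "x \<in> weyl" using bruhat_weyl by auto
    from len_refl_simple[OF a this] show "(- 1) ^ len (refl \<alpha> \<circ> x) = - ((- 1) ^ len x :: int)" by auto
  qed
  finally show ?thesis by (simp add: sum_negf)
qed

lemma finite_bruhat [simp]:
  "finite {x. bruhat u x \<and> bruhat x w}" "finite {x. bruhat u x}" "finite {x. bruhat x w}"
  by (rule finite_subset[OF _ finite_weyl]; use bruhat_weyl in blast)+

text \<open>The proof compares the interval from \<open>u\<close> to \<open>w\<close> with the intervals obtained by replacing
  \<open>u\<close> and \<open>w\<close> by \<open>su\<close> and \<open>sw\<close>, where \<open>s\<close> is a left descent of \<open>w\<close>.\<close>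

lemma bruhat_interval_sum:
  assumes "w \<in> weyl" "u \<in> weyl"
  shows "(\<Sum>x\<in>{x. bruhat u x \<and> bruhat x w}. (- 1) ^ len x :: int) =
    (if u = w then (- 1) ^ len w else 0)"
  using assms
proof (induction arbitrary: u rule: weyl_induct)
  case id
  have "bruhat u x \<and> bruhat x id \<longleftrightarrow> u = id \<and> x = id" for x
    using bruhat_len[of x id] bruhat_len[of u id] bruhat_trans[of u x id] by auto
  then show "(\<Sum>x\<in>{x. bruhat u x \<and> bruhat x id}. (- 1) ^ len x :: int) =
      (if u = id then (- 1) ^ len id else 0)" by auto
next
  case (refl \<alpha> w)
  note a = refl(1) and aR = simple_root[OF refl(1)]
  define v where "v = local.refl \<alpha> \<circ> w"
  let ?S = "\<lambda>u w. \<Sum>x\<in>{x. bruhat u x \<and> bruhat x w}. (- 1) ^ len x :: int"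
  have v: "v \<in> weyl" "local.refl \<alpha> \<circ> v = w" using refl aR by (auto simp: v_def)
  have lv: "len v = Suc (len (local.refl \<alpha> \<circ> v))" using refl v by (simp add: v_def)
  have wv: "bruhat w v" using bruhat_refl_simple[OF refl(1,2)] refl(3) by (simp add: v_def)
  have su: "local.refl \<alpha> \<circ> u \<in> weyl" using refl.prems aR by auto
  have "?S u v = (if u = v then (- 1) ^ len v else 0)"
  proof (cases "len (local.refl \<alpha> \<circ> u) = Suc (len u)")
    case True
    then have "u \<noteq> v" using lv by auto
    then show ?thesis using bruhat_interval_sum_0[OF a v(1) refl.prems lv True] by simp
  next
    case False
    then have lu: "len u = Suc (len (local.refl \<alpha> \<circ> u))"
      using len_refl_simple[OF a refl.prems] by auto
    define u' where "u' = local.refl \<alpha> \<circ> u"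
    have u': "u' \<in> weyl" "local.refl \<alpha> \<circ> u' = u" "len u = Suc (len u')" using su lu aR by (auto simp: u'_def)
    have uu: "bruhat u' u" using bruhat_refl_simple[OF a u'(1)] u' by simp
    let ?X = "{x. bruhat u' x \<and> bruhat x v \<and> \<not> bruhat u x}"
    \<comment> \<open>An element above \<open>u'\<close> but not above \<open>u\<close> has no left
      descent at \<alpha>, since otherwise lifting would put \<open>u\<close> below it. Hence if it
      lies below \<open>v\<close> it lies below the shorter \<open>w\<close>, and the two difference
      sets agree.\<close>
    have "?X = {x. bruhat u' x \<and> bruhat x w \<and> \<not> bruhat u x}"
    proof (intro Collect_cong iffI conjI; elim conjE)
      fix x assume x: "bruhat u' x" "bruhat x v" "\<not> bruhat u x"
      have "len x \<noteq> Suc (len (local.refl \<alpha> \<circ> x))"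
        using bruhat_refl_le[OF a x(1)] x(3) u'(2) by auto
      then have "len (local.refl \<alpha> \<circ> x) = Suc (len x)"
        using len_refl_simple[OF a] bruhat_weyl[OF x(1)] by blast
      from bruhat_le_refl[OF a x(2) this] show "bruhat x w" using v by simp
    qed (use wv bruhat_trans in blast)+
    moreover have split: "?S u' y = ?S u y + (\<Sum>x\<in>{x. bruhat u' x \<and> bruhat x y \<and> \<not> bruhat u x}. (- 1) ^ len x)" for y
    proof -
      have "{x. bruhat u' x \<and> bruhat x y} = {x. bruhat u x \<and> bruhat x y} \<union>
          {x. bruhat u' x \<and> bruhat x y \<and> \<not> bruhat u x}"
        using uu bruhat_trans by blast
      moreover have "finite {x. bruhat u' x \<and> bruhat x y \<and> \<not> bruhat u x}"
        by (rule finite_subset[OF _ finite_bruhat(1)[of u' y]]) auto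
      ultimately show ?thesis by (simp add: sum.union_disjoint disjoint_iff)
    qed
    moreover have "?S u' v = 0" using bruhat_interval_sum_0[OF a v(1) u'(1) lv] u' by simp
    ultimately have "?S u v = ?S u w - ?S u' w" using split[of v] split[of w] by simp
    also have "\<dots> = (if u = w then (- 1) ^ len w else 0) - (if u' = w then (- 1) ^ len w else 0)"
      using refl.IH refl.prems u' by simp
    also have "u' = w \<longleftrightarrow> u = v" using aR by (auto simp: u'_def v_def)
    finally have "?S u v = (if u = w then (- 1) ^ len w else 0) - (if u = v then (- 1) ^ len w else 0)" .
    moreover have "u \<noteq> w" using lu lv v by (auto simp: v_def)
    ultimately show ?thesis using lv v by auto
  qed
  then show "?S u (local.refl \<alpha> \<circ> w) = (if u = local.refl \<alpha> \<circ> w then (- 1) ^ len (local.refl \<alpha> \<circ> w) else 0)"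
    by (simp only: v_def)
qed

section \<open>Signs, powers of \<open>q\<close> and Moebius inversion\<close>

lemma eps_mult_self [simp]: "eps x * eps x = 1"
  by (simp add: eps_def flip: power_mult_distrib)

lemma eps_mult_self_left [simp]: "eps x * (eps x * c) = c"
  by (simp flip: mult.assoc)

lemma qw_nonzero [simp]: "qw w \<noteq> 0"
  by (simp add: qw_def qq_nonzero)

lemma bar_qw [simp]: "bar (qw w) = inverse (qw w)"
  by (simp add: qw_def bar_power power_inverse)

lemma bar_eps [simp]: "bar (eps w) = eps w"
  by (simp add: eps_def bar_power bar_minus)

lemma qw_inv [simp]: "w \<in> weyl \<Longrightarrow> qw (inv w) = qw w"
  by (simp add: qw_def)

lemma qw_longest: "w \<in> weyl \<Longrightarrow> qw (longest \<circ> w) * qw w = qq ^ card pos"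
  using len_longest_comp[of w] by (simp add: qw_def flip: power_add)

lemma moebius:
  assumes "u \<in> weyl" "w \<in> weyl"
  shows "(\<Sum>x\<in>{x. bruhat u x \<and> bruhat x w}. eps x) = (if u = w then eps w else 0)"
proof -
  have "(\<Sum>x\<in>{x. bruhat u x \<and> bruhat x w}. eps x) =
      of_int (\<Sum>x\<in>{x. bruhat u x \<and> bruhat x w}. (- 1) ^ len x)"
    by (simp add: eps_def)
  then show ?thesis
    using bruhat_interval_sum[OF assms(2,1)] by (simp add: eps_def split: if_splits)
qed

lemma moebius_inversion:
  assumes "t \<in> weyl" "\<And>w. w \<in> weyl \<Longrightarrow> g w = (\<Sum>x\<in>{x. bruhat w x}. b x)"
  shows "b t = (\<Sum>w\<in>{w. bruhat t w}. eps t * eps w * g w)"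
proof -
  have "(\<Sum>w\<in>{w. bruhat t w}. eps t * eps w * g w) =
      (\<Sum>w\<in>{w. bruhat t w}. \<Sum>x\<in>{x. x \<in> weyl \<and> bruhat w x}. eps t * eps w * b x)"
    using assms bruhat_weyl by (intro sum.cong) (auto simp: sum_distrib_left intro!: sum.cong)
  also have "\<dots> = (\<Sum>x\<in>weyl. \<Sum>w\<in>{w \<in> {w. bruhat t w}. bruhat w x}. eps t * eps w * b x)"
    by (rule sum.swap_restrict) auto
  also have "\<dots> = (\<Sum>x\<in>weyl. eps t * (\<Sum>w\<in>{w. bruhat t w \<and> bruhat w x}. eps w) * b x)"
    by (simp add: sum_distrib_left sum_distrib_right mult.assoc)
  also have "\<dots> = (\<Sum>x\<in>weyl. if t = x then b x else 0)"
    using assms(1) by (intro sum.cong) (auto simp: moebius)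
  also have "\<dots> = b t" using assms(1) by simp
  finally show ?thesis by simp
qed

lemma weyl_induct_right [consumes 1, case_names id refl]:
  assumes "w \<in> weyl" "P id"
    and step: "\<And>\<alpha> w. \<alpha> \<in> simple \<Longrightarrow> w \<in> weyl \<Longrightarrow> len (w \<circ> refl \<alpha>) = Suc (len w) \<Longrightarrow> P w \<Longrightarrow>
      P (w \<circ> refl \<alpha>)"
  shows "P w"
proof -
  have "P (inv v)" if "v \<in> weyl" for v
    using that
  proof (induction rule: weyl_induct)
    case id
    show "P (inv id)" using assms(2) by (metis inv_id)
  next
    case (refl \<alpha> v)
    note aR = simple_root[OF refl(1)]
    have eq: "inv (local.refl \<alpha> \<circ> v) = inv v \<circ> local.refl \<alpha>" using refl aR by (simp add: inv_comp_weyl)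
    have "len (inv v \<circ> local.refl \<alpha>) = Suc (len (inv v))"
      unfolding eq[symmetric] using refl(2,3) aR by (metis comp_weyl len_inv refl_weyl)
    then show "P (inv (local.refl \<alpha> \<circ> v))"
      unfolding eq using step[OF refl(1)] refl by simp
  qed
  from this[of "inv w"] show ?thesis using assms by simp
qed

lemma len_refl_simple_right:
  assumes "\<alpha> \<in> simple" "w \<in> weyl"
  shows "len (w \<circ> refl \<alpha>) = Suc (len w) \<or> len w = Suc (len (w \<circ> refl \<alpha>))"
proof -
  have "len (w \<circ> refl \<alpha>) = len (refl \<alpha> \<circ> inv w)"
    using assms simple_root len_inv[of "w \<circ> refl \<alpha>"] by (simp add: inv_comp_weyl)
  then show ?thesis using len_refl_simple[of \<alpha> "inv w"] assms by simp
qed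

lemma len_refl [simp]:
  assumes "\<alpha> \<in> simple" shows "len (refl \<alpha>) = 1"
  using len_refl_simple[OF assms id_weyl] by simp

end

section \<open>The Hecke algebra\<close>

context hecke_algebra
begin

lemma T_expand: "h = (\<Sum>w\<in>weyl. scale (T_coeff w h) (T w))"
proof -
  have "(\<Sum>b\<in>T ` weyl. scale (representation (T ` weyl) h b) b) = h"
    by (rule sum_representation_eq) (auto simp: T_independent T_span)
  then show ?thesis by (simp add: sum.reindex T_inj T_coeff_def)
qed

lemma T_coeff_T: "w \<in> weyl \<Longrightarrow> v \<in> weyl \<Longrightarrow> T_coeff w (T v) = (if w = v then 1 else 0)"
  using T_inj by (auto simp: T_coeff_def representation_basis T_independent inj_on_def)

lemma T_coeff_add: "T_coeff w (a + b) = T_coeff w a + T_coeff w b"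
  by (simp add: T_coeff_def representation_add T_independent T_span)

lemma T_coeff_scale: "T_coeff w (scale k a) = k * T_coeff w a"
  by (simp add: T_coeff_def representation_scale T_independent T_span)

lemma T_coeff_0 [simp]: "T_coeff w 0 = 0"
  using T_coeff_scale[of w 0 0] by simp

lemma T_coeff_sum: "T_coeff w (sum f A) = (\<Sum>x\<in>A. T_coeff w (f x))"
  by (induction A rule: infinite_finite_induct) (auto simp: T_coeff_add)

lemma T_coeff_sum_T:
  assumes "x \<in> weyl"
  shows "T_coeff x (\<Sum>w\<in>weyl. scale (f w) (T w)) = f x"
proof -
  have "T_coeff x (\<Sum>w\<in>weyl. scale (f w) (T w)) = (\<Sum>w\<in>weyl. if x = w then f w else 0)"
    unfolding T_coeff_sum using assms by (intro sum.cong) (auto simp: T_coeff_scale T_coeff_T)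
  then show ?thesis using assms by simp
qed

text \<open>Covers linear maps and maps semilinear over \<open>bar\<close> at once, so that the bar
  involution, the sign involution and the flip are all determined on basis elements by the same
  lemmas.\<close>

definition semilinear :: "('x qz_field \<Rightarrow> 'x qz_field) \<Rightarrow> ('h \<Rightarrow> 'h) \<Rightarrow> bool"
  where "semilinear \<sigma> \<phi> \<longleftrightarrow>
    (\<forall>a b. \<phi> (a + b) = \<phi> a + \<phi> b) \<and> (\<forall>k a. \<phi> (scale k a) = scale (\<sigma> k) (\<phi> a))"

lemma semilinear_add: "semilinear \<sigma> \<phi> \<Longrightarrow> \<phi> (a + b) = \<phi> a + \<phi> b"
  and semilinear_scale: "semilinear \<sigma> \<phi> \<Longrightarrow> \<phi> (scale k a) = scale (\<sigma> k) (\<phi> a)"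
  by (auto simp: semilinear_def)

lemma semilinear_sum:
  assumes "semilinear \<sigma> \<phi>"
  shows "\<phi> (sum f A) = (\<Sum>x\<in>A. \<phi> (f x))"
proof -
  have "\<phi> 0 = 0" using semilinear_add[OF assms, of 0 0] by simp
  then show ?thesis
    by (induction A rule: infinite_finite_induct) (auto simp: semilinear_add[OF assms])
qed

lemma semilinear_eqI:
  assumes "semilinear \<sigma> \<phi>" "semilinear \<sigma> \<psi>" "\<And>w. w \<in> weyl \<Longrightarrow> \<phi> (T w) = \<psi> (T w)"
  shows "\<phi> h = \<psi> h"
proof -
  have "\<phi> (\<Sum>w\<in>weyl. scale (T_coeff w h) (T w)) = \<psi> (\<Sum>w\<in>weyl. scale (T_coeff w h) (T w))"
    by (simp add: semilinear_sum[OF assms(1)] semilinear_sum[OF assms(2)]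
        semilinear_scale[OF assms(1)] semilinear_scale[OF assms(2)] assms(3))
  then show ?thesis by (simp flip: T_expand)
qed

lemma semilinear_mult:
  assumes "semilinear \<sigma> \<phi>"
  shows "semilinear \<sigma> (\<lambda>h. g * \<phi> h)" "semilinear \<sigma> (\<lambda>h. \<phi> h * g)"
    "semilinear \<sigma> (\<lambda>h. \<phi> (g * h))" "semilinear \<sigma> (\<lambda>h. \<phi> (h * g))"
  using assms
  by (simp_all add: semilinear_def distrib_left distrib_right flip: scale_mult_left scale_mult_right)

lemma semilinear_compose:
  "semilinear \<sigma> \<phi> \<Longrightarrow> semilinear \<tau> \<psi> \<Longrightarrow> semilinear (\<tau> \<circ> \<sigma>) (\<psi> \<circ> \<phi>)"
  by (simp add: semilinear_def)

lemma semilinear_id: "semilinear id (\<lambda>h. h)"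
  by (simp add: semilinear_def)

lemma scale_mult_scale: "scale k a * scale l b = scale (k * l) (a * b)"
  by (simp flip: scale_mult_left scale_mult_right)

lemma T_id [simp]: "T id = 1"
proof -
  have "T id * h = h" for h
    by (rule semilinear_eqI[OF semilinear_mult(1)[OF semilinear_id] semilinear_id])
      (simp add: T_mult)
  from this[of 1] show ?thesis by simp
qed

lemma T_refl_mult_up:
  "\<alpha> \<in> simple \<Longrightarrow> w \<in> weyl \<Longrightarrow> len (refl \<alpha> \<circ> w) = Suc (len w) \<Longrightarrow> T (refl \<alpha>) * T w = T (refl \<alpha> \<circ> w)"
  by (rule T_mult) (auto simp: simple_root)

lemma T_mult_refl_up:
  "\<alpha> \<in> simple \<Longrightarrow> w \<in> weyl \<Longrightarrow> len (w \<circ> refl \<alpha>) = Suc (len w) \<Longrightarrow> T w * T (refl \<alpha>) = T (w \<circ> refl \<alpha>)"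
  by (rule T_mult) (auto simp: simple_root)

lemma T_refl_mult_down:
  assumes "\<alpha> \<in> simple" "w \<in> weyl" "len w = Suc (len (refl \<alpha> \<circ> w))"
  shows "T (refl \<alpha>) * T w = scale (qq - 1) (T w) + scale qq (T (refl \<alpha> \<circ> w))"
proof -
  let ?v = "refl \<alpha> \<circ> w"
  have R: "\<alpha> \<in> \<Phi>" using simple_root assms by blast
  have w: "T w = T (refl \<alpha>) * T ?v" using T_refl_mult_up[of \<alpha> ?v] assms R by simp
  have "T (refl \<alpha>) * T w = (T (refl \<alpha>) * T (refl \<alpha>)) * T ?v" by (simp add: w mult.assoc)
  also have "\<dots> = scale (qq - 1) (T (refl \<alpha>) * T ?v) + scale qq (T ?v)"
    by (simp add: T_quadratic assms distrib_right flip: scale_mult_left)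
  finally show ?thesis by (simp flip: w)
qed

lemma T_mult_refl_down:
  assumes "\<alpha> \<in> simple" "w \<in> weyl" "len w = Suc (len (w \<circ> refl \<alpha>))"
  shows "T w * T (refl \<alpha>) = scale (qq - 1) (T w) + scale qq (T (w \<circ> refl \<alpha>))"
proof -
  let ?v = "w \<circ> refl \<alpha>"
  have R: "\<alpha> \<in> \<Phi>" using simple_root assms by blast
  have w: "T w = T ?v * T (refl \<alpha>)" using T_mult_refl_up[of \<alpha> ?v] assms R by (simp add: comp_assoc)
  have "T w * T (refl \<alpha>) = T ?v * (T (refl \<alpha>) * T (refl \<alpha>))" by (simp add: w mult.assoc)
  also have "\<dots> = scale (qq - 1) (T ?v * T (refl \<alpha>)) + scale qq (T ?v)"
    by (simp add: T_quadratic assms distrib_left flip: scale_mult_right)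
  finally show ?thesis by (simp flip: w)
qed

section \<open>Semilinear algebra homomorphisms\<close>

definition T_extend :: "('x qz_field \<Rightarrow> 'x qz_field) \<Rightarrow> (('x \<Rightarrow> 'x) \<Rightarrow> 'h) \<Rightarrow> 'h \<Rightarrow> 'h"
  where "T_extend \<sigma> f h = (\<Sum>w\<in>weyl. scale (\<sigma> (T_coeff w h)) (f w))"

definition field_hom :: "('x qz_field \<Rightarrow> 'x qz_field) \<Rightarrow> bool"
  where "field_hom \<sigma> \<longleftrightarrow> (\<forall>a b. \<sigma> (a + b) = \<sigma> a + \<sigma> b) \<and> (\<forall>a b. \<sigma> (a * b) = \<sigma> a * \<sigma> b) \<and> \<sigma> 0 = 0 \<and> \<sigma> 1 = 1"

lemma field_hom_bar: "field_hom bar" and field_hom_id: "field_hom id"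
  by (simp_all add: field_hom_def bar_add bar_mult)

lemma semilinear_T_extend: "field_hom \<sigma> \<Longrightarrow> semilinear \<sigma> (T_extend \<sigma> f)"
  by (simp add: semilinear_def field_hom_def T_extend_def T_coeff_add T_coeff_scale
      scale_left_distrib sum.distrib scale_sum_right)

lemma T_extend_T:
  assumes "field_hom \<sigma>" "w \<in> weyl"
  shows "T_extend \<sigma> f (T w) = f w"
proof -
  have "T_extend \<sigma> f (T w) = (\<Sum>v\<in>weyl. if v = w then f v else 0)"
    unfolding T_extend_def using assms by (intro sum.cong) (auto simp: T_coeff_T field_hom_def)
  then show ?thesis using assms by simp
qed

text \<open>Semilinear ring maps from the presentation of the algebra: it is enough that the images
  respect lengthening by a simple reflection on the left and the quadratic relation with
  \<open>\<sigma> qq\<close> for \<open>qq\<close>.\<close>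

lemma T_extend_mult:
  assumes \<sigma>: "field_hom \<sigma>" and f_id: "f id = 1"
    and f_up: "\<And>\<alpha> w. \<alpha> \<in> simple \<Longrightarrow> w \<in> weyl \<Longrightarrow> len (refl \<alpha> \<circ> w) = Suc (len w) \<Longrightarrow>
      f (refl \<alpha> \<circ> w) = f (refl \<alpha>) * f w"
    and f_quad: "\<And>\<alpha>. \<alpha> \<in> simple \<Longrightarrow>
      f (refl \<alpha>) * f (refl \<alpha>) = scale (\<sigma> qq - 1) (f (refl \<alpha>)) + scale (\<sigma> qq) 1"
  shows "T_extend \<sigma> f (g * h) = T_extend \<sigma> f g * T_extend \<sigma> f h"
proof -
  let ?\<phi> = "T_extend \<sigma> f"
  note sl = semilinear_T_extend[OF \<sigma>, of f] and T = T_extend_T[OF \<sigma>]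
  have \<sigma>1: "\<sigma> (qq - 1) = \<sigma> qq - 1"
  proof -
    have "\<sigma> (qq - 1) + \<sigma> 1 = \<sigma> (qq - 1 + 1)" using \<sigma> unfolding field_hom_def by metis
    then show ?thesis using \<sigma> by (simp add: field_hom_def algebra_simps)
  qed
  have s: "?\<phi> (T (refl \<alpha>) * h) = f (refl \<alpha>) * ?\<phi> h" if a: "\<alpha> \<in> simple" for \<alpha> h
  proof (rule semilinear_eqI[OF semilinear_mult(3)[OF sl] semilinear_mult(1)[OF sl]])
    fix w assume w: "w \<in> weyl"
    note R = simple_root[OF a]
    from len_refl_simple[OF a w] show "?\<phi> (T (refl \<alpha>) * T w) = f (refl \<alpha>) * ?\<phi> (T w)"
    proof
      assume "len (refl \<alpha> \<circ> w) = Suc (len w)"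
      then show ?thesis using a w R by (simp add: T_refl_mult_up f_up T)
    next
      assume l: "len w = Suc (len (refl \<alpha> \<circ> w))"
      let ?v = "refl \<alpha> \<circ> w"
      have fw: "f w = f (refl \<alpha>) * f ?v" using f_up[OF a, of ?v] w R l by simp
      have "?\<phi> (T (refl \<alpha>) * T w) = scale (\<sigma> qq - 1) (f w) + scale (\<sigma> qq) (f ?v)"
        using a w R l
        by (simp add: T_refl_mult_down semilinear_add[OF sl] semilinear_scale[OF sl] T \<sigma>1)
      also have "\<dots> = (f (refl \<alpha>) * f (refl \<alpha>)) * f ?v"
        by (simp add: f_quad a distrib_right fw flip: scale_mult_left)
      also have "\<dots> = f (refl \<alpha>) * ?\<phi> (T w)" using w by (simp add: T fw mult.assoc)
      finally show ?thesis .
    qed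
  qed
  have w: "?\<phi> (T w * h) = f w * ?\<phi> h" if "w \<in> weyl" for w h
    using that
  proof (induction arbitrary: h rule: weyl_induct)
    case id
    show "?\<phi> (T id * h) = f id * ?\<phi> h" by (simp add: f_id)
  next
    case (refl \<alpha> w)
    then show "?\<phi> (T (local.refl \<alpha> \<circ> w) * h) = f (local.refl \<alpha> \<circ> w) * ?\<phi> h"
      by (simp add: f_up s mult.assoc flip: T_refl_mult_up)
  qed
  show ?thesis
    by (rule semilinear_eqI[OF semilinear_mult(4)[OF sl] semilinear_mult(2)[OF sl]]) (simp add: w T)
qed

section \<open>Inverses of the basis elements\<close>

definition T_inv :: "('x \<Rightarrow> 'x) \<Rightarrow> 'h"
  where "T_inv w = (THE y. T w * y = 1 \<and> y * T w = 1)"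

lemma T_inv_eqI:
  assumes "T w * y = 1" "y * T w = 1"
  shows "T_inv w = y"
  unfolding T_inv_def
proof (rule the_equality)
  fix z assume "T w * z = 1 \<and> z * T w = 1"
  then have "y * (T w * z) = y" by simp
  then show "z = y" using assms by (simp flip: mult.assoc)
qed (use assms in simp)

text \<open>The candidate comes from dividing the quadratic relation by \<open>qq\<close> and
  splitting off one factor \<open>T (refl \<alpha>)\<close>.\<close>

lemma T_refl_inverse:
  assumes "\<alpha> \<in> simple"
  defines "y \<equiv> scale (inverse qq) (T (refl \<alpha>)) + scale (inverse qq - 1) 1"
  shows "T (refl \<alpha>) * y = 1" "y * T (refl \<alpha>) = 1"
proof -
  have "scale (inverse qq * (qq - 1)) (T (refl \<alpha>)) + scale (inverse qq * qq) 1 + scale (inverse qq - 1) (T (refl \<alpha>)) = 1"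
    using qq_nonzero[where 'a = "'x torus_field"]
    by (simp add: algebra_simps flip: scale_left_distrib)
  then show "T (refl \<alpha>) * y = 1" "y * T (refl \<alpha>) = 1"
    unfolding y_def distrib_left distrib_right scale_mult_left[symmetric] scale_mult_right[symmetric]
      T_quadratic[OF assms(1)] by (simp_all add: scale_right_distrib)
qed

lemma T_inv_refl:
  "\<alpha> \<in> simple \<Longrightarrow> T_inv (refl \<alpha>) = scale (inverse qq) (T (refl \<alpha>)) + scale (inverse qq - 1) 1"
  by (rule T_inv_eqI) (rule T_refl_inverse, assumption)+

lemma T_invertible:
  assumes "w \<in> weyl"
  shows "\<exists>y. T w * y = 1 \<and> y * T w = 1"
  using assms
proof (induction rule: weyl_induct)
  case id
  show "\<exists>y. T id * y = 1 \<and> y * T id = 1" by (intro exI[of _ 1]) simp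
next
  case (refl \<alpha> w)
  then obtain y where y: "T w * y = 1" "y * T w = 1" by blast
  obtain z where z: "T (local.refl \<alpha>) * z = 1" "z * T (local.refl \<alpha>) = 1"
    using T_refl_inverse[OF refl(1)] by blast
  have T: "T (local.refl \<alpha> \<circ> w) = T (local.refl \<alpha>) * T w" using refl by (simp add: T_refl_mult_up)
  have "T (local.refl \<alpha> \<circ> w) * (y * z) = T (local.refl \<alpha>) * (T w * y) * z" by (simp add: T mult.assoc)
  moreover have "(y * z) * T (local.refl \<alpha> \<circ> w) = y * (z * T (local.refl \<alpha>)) * T w" by (simp add: T mult.assoc)
  ultimately show "\<exists>y. T (local.refl \<alpha> \<circ> w) * y = 1 \<and> y * T (local.refl \<alpha> \<circ> w) = 1"
    using y z by (intro exI[of _ "y * z"]) simp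
qed

lemma T_inv_right [simp]: "w \<in> weyl \<Longrightarrow> T w * T_inv w = 1"
  and T_inv_left [simp]: "w \<in> weyl \<Longrightarrow> T_inv w * T w = 1"
  using T_invertible T_inv_eqI by metis+

lemma T_inv_id [simp]: "T_inv id = 1"
  by (rule T_inv_eqI) auto

lemma T_inv_mult:
  assumes "v \<in> weyl" "w \<in> weyl" "len (v \<circ> w) = len v + len w"
  shows "T_inv (v \<circ> w) = T_inv w * T_inv v"
proof (rule T_inv_eqI)
  have T: "T (v \<circ> w) = T v * T w" using assms by (simp add: T_mult)
  have "T (v \<circ> w) * (T_inv w * T_inv v) = T v * (T w * T_inv w) * T_inv v"
    by (simp only: T mult.assoc)
  then show "T (v \<circ> w) * (T_inv w * T_inv v) = 1" using assms by simp
  have "T_inv w * T_inv v * T (v \<circ> w) = T_inv w * (T_inv v * T v) * T w"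
    by (simp only: T mult.assoc)
  then show "T_inv w * T_inv v * T (v \<circ> w) = 1" using assms by simp
qed

lemma T_inv_inv_refl:
  assumes "\<alpha> \<in> simple" "w \<in> weyl" "len (refl \<alpha> \<circ> w) = Suc (len w)"
  shows "T_inv (inv (refl \<alpha> \<circ> w)) = T_inv (inv (refl \<alpha>)) * T_inv (inv w)"
proof -
  note R = simple_root[OF assms(1)]
  have eq: "inv (refl \<alpha> \<circ> w) = inv w \<circ> refl \<alpha>" using assms R by (simp add: inv_comp_weyl)
  have "len (inv w \<circ> refl \<alpha>) = len (inv w) + len (refl \<alpha>)"
    unfolding eq[symmetric] using assms R by simp
  then show ?thesis using T_inv_mult[of "inv w" "refl \<alpha>"] assms R eq by simp
qed

lemma T_inv_refl_quadratic:
  assumes "\<alpha> \<in> simple"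
  shows "T_inv (refl \<alpha>) * T_inv (refl \<alpha>) =
    scale (inverse qq - 1) (T_inv (refl \<alpha>)) + scale (inverse qq) 1"
proof -
  note R = simple_root[OF assms]
  have "T_inv (refl \<alpha>) * T_inv (refl \<alpha>) =
      scale (inverse qq) (T_inv (refl \<alpha>) * T (refl \<alpha>)) + scale (inverse qq - 1) (T_inv (refl \<alpha>))"
    by (subst (2) T_inv_refl[OF assms]) (simp add: distrib_left flip: scale_mult_right)
  then show ?thesis using R by (simp add: add.commute)
qed

section \<open>The bar involution\<close>

lemma hecke_bar_eq: "hecke_bar = T_extend bar (\<lambda>w. T_inv (inv w))"
  by (simp add: fun_eq_iff hecke_bar_def T_extend_def T_inv_def)

lemma semilinear_hecke_bar: "semilinear bar hecke_bar"
  by (simp add: hecke_bar_eq semilinear_T_extend field_hom_bar)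

lemma hecke_bar_T: "w \<in> weyl \<Longrightarrow> hecke_bar (T w) = T_inv (inv w)"
  by (simp add: hecke_bar_eq T_extend_T field_hom_bar)

lemma hecke_bar_mult: "hecke_bar (g * h) = hecke_bar g * hecke_bar h"
  unfolding hecke_bar_eq
proof (rule T_extend_mult[OF field_hom_bar])
  show "T_inv (inv id) = 1" by (metis inv_id T_inv_id)
  fix \<alpha> assume a: "\<alpha> \<in> simple"
  then show "T_inv (inv (refl \<alpha>)) * T_inv (inv (refl \<alpha>)) =
      scale (bar qq - 1) (T_inv (inv (refl \<alpha>))) + scale (bar qq) 1"
    by (simp add: simple_root T_inv_refl_quadratic)
qed (rule T_inv_inv_refl)

lemma hecke_bar_1 [simp]: "hecke_bar 1 = 1"
  using hecke_bar_T[of id] by (metis T_id T_inv_id id_weyl inv_id)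

text \<open>The linear involution of Kazhdan and Lusztig. It is multiplicative because
  \<open>- q T_s^-1\<close> satisfies the same quadratic relation as \<open>T_s\<close>: the two
  roots \<open>q\<close> and \<open>-1\<close> are exchanged.\<close>

definition kl_involution :: "'h \<Rightarrow> 'h"
  where "kl_involution = T_extend id (\<lambda>w. scale (eps w * qw w) (T_inv (inv w)))"

lemma semilinear_kl_involution: "semilinear id kl_involution"
  by (simp add: kl_involution_def semilinear_T_extend field_hom_id)

lemma kl_involution_T: "w \<in> weyl \<Longrightarrow> kl_involution (T w) = scale (eps w * qw w) (T_inv (inv w))"
  by (simp add: kl_involution_def T_extend_T field_hom_id)

lemma kl_involution_mult: "kl_involution (g * h) = kl_involution g * kl_involution h"
  unfolding kl_involution_def
proof (rule T_extend_mult[OF field_hom_id])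
  show "scale (eps id * qw id) (T_inv (inv id)) = 1"
    by (simp add: eps_def qw_def)
next
  fix \<alpha> w assume aw: "\<alpha> \<in> simple" "w \<in> weyl" "len (refl \<alpha> \<circ> w) = Suc (len w)"
  then show "scale (eps (refl \<alpha> \<circ> w) * qw (refl \<alpha> \<circ> w)) (T_inv (inv (refl \<alpha> \<circ> w))) =
      scale (eps (refl \<alpha>) * qw (refl \<alpha>)) (T_inv (inv (refl \<alpha>))) * scale (eps w * qw w) (T_inv (inv w))"
    by (simp add: T_inv_inv_refl scale_mult_scale eps_def qw_def)
next
  fix \<alpha> assume a: "\<alpha> \<in> simple"
  have e: "eps (refl \<alpha>) = - 1" "qw (refl \<alpha>) = qq" using a by (simp_all add: eps_def qw_def)
  have q: "qq * qq * (inverse qq - 1) = - ((qq - 1) * qq)" "qq * qq * inverse qq = (qq :: 'x qz_field)"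
    using qq_nonzero[where 'a = "'x torus_field"] by (simp_all add: field_simps)
  show "scale (eps (refl \<alpha>) * qw (refl \<alpha>)) (T_inv (inv (refl \<alpha>))) *
      scale (eps (refl \<alpha>) * qw (refl \<alpha>)) (T_inv (inv (refl \<alpha>))) =
      scale (id qq - 1) (scale (eps (refl \<alpha>) * qw (refl \<alpha>)) (T_inv (inv (refl \<alpha>)))) + scale (id qq) 1"
    using a by (simp add: e simple_root scale_mult_scale T_inv_refl_quadratic scale_right_distrib q)
qed

lemma kl_involution_self: "kl_involution (kl_involution h) = h"
proof -
  have s: "kl_involution (kl_involution (T (refl \<alpha>))) = T (refl \<alpha>)" if a: "\<alpha> \<in> simple" for \<alpha>
  proof -
    note R = simple_root[OF a]
    have k: "kl_involution (T (refl \<alpha>)) = - T (refl \<alpha>) - scale (1 - qq) 1"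
      using a R qq_nonzero[where 'a = "'x torus_field"]
      by (simp add: kl_involution_T eps_def qw_def T_inv_refl scale_right_distrib right_diff_distrib)
        (simp add: scale_left_diff_distrib)
    have 1: "kl_involution 1 = 1" using kl_involution_T[of id] by (metis T_id T_inv_id id_weyl inv_id eps_def qw_def len_id power_0 mult_1 scale_one)
    have "kl_involution (- T (refl \<alpha>) - scale (1 - qq) 1) = kl_involution (scale (- 1) (T (refl \<alpha>)) + scale (qq - 1) 1)"
      by (simp add: scale_left_diff_distrib algebra_simps)
    also have "\<dots> = scale (- 1) (kl_involution (T (refl \<alpha>))) + scale (qq - 1) 1"
      by (simp only: semilinear_add[OF semilinear_kl_involution] semilinear_scale[OF semilinear_kl_involution] id_apply 1)
    also have "\<dots> = T (refl \<alpha>)" by (simp add: k scale_left_diff_distrib)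
    finally show ?thesis by (simp only: k)
  qed
  have "kl_involution (kl_involution (T w)) = T w" if "w \<in> weyl" for w
    using that
  proof (induction rule: weyl_induct)
    case id
    have "kl_involution 1 = 1" using kl_involution_T[of id] by (metis T_id T_inv_id id_weyl inv_id eps_def qw_def len_id power_0 mult_1 scale_one)
    then show "kl_involution (kl_involution (T id)) = T id" by simp
  next
    case (refl \<alpha> w)
    then show "kl_involution (kl_involution (T (local.refl \<alpha> \<circ> w))) = T (local.refl \<alpha> \<circ> w)"
      by (simp add: kl_involution_mult s flip: T_refl_mult_up)
  qed
  then show ?thesis
    using semilinear_eqI[OF semilinear_compose[OF semilinear_kl_involution semilinear_kl_involution], of "\<lambda>h. h" h] semilinear_id
    by simp
qed

section \<open>The trace form\<close>

lemma Lam_add: "Lam (a + b) = Lam a + Lam b"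
  by (simp add: Lam_def T_coeff_add)

lemma Lam_scale: "Lam (scale k a) = k * Lam a"
  by (simp add: Lam_def T_coeff_scale)

lemma Lam_sum: "Lam (sum f A) = (\<Sum>x\<in>A. Lam (f x))"
  by (simp add: Lam_def T_coeff_sum)

text \<open>Makes the \<open>T (inv x)\<close> a dual basis up to \<open>qw x\<close>. The induction
  moves a simple reflection from the end of \<open>x\<close> to the front of
  \<open>y\<close>.\<close>

lemma Lam_T_mult_T:
  assumes "x \<in> weyl" "y \<in> weyl"
  shows "Lam (T x * T y) = (if y = inv x then qw x else 0)"
  using assms
proof (induction arbitrary: y rule: weyl_induct_right)
  case id
  have "inv id = (id :: 'x \<Rightarrow> 'x)" by (rule inv_id)
  then show "Lam (T id * T y) = (if y = inv id then qw id else 0)"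
    using id by (simp add: Lam_def T_coeff_T qw_def)
next
  case (refl \<alpha> x)
  note R = simple_root[OF refl(1)]
  let ?s = "local.refl \<alpha>"
  have inv: "inv (x \<circ> ?s) = ?s \<circ> inv x" using refl R by (simp add: inv_comp_weyl)
  have len: "len (?s \<circ> inv x) = Suc (len (inv x))"
    unfolding inv[symmetric] using refl(2,3) R by simp
  have T: "T (x \<circ> ?s) * T y = T x * (T ?s * T y)" using refl by (simp add: mult.assoc flip: T_mult_refl_up)
  have IH: "Lam (T x * T y) = (if y = inv x then qw x else 0)" if "y \<in> weyl" for y
    using that by (rule refl.IH)
  have sy: "?s \<circ> y \<in> weyl" using refl.prems R by simp
  have y: "y = ?s \<circ> inv x \<longleftrightarrow> ?s \<circ> y = inv x" using R by (metis refl_cancel)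
  show "Lam (T (x \<circ> ?s) * T y) = (if y = inv (x \<circ> ?s) then qw (x \<circ> ?s) else 0)"
  proof (cases "len (?s \<circ> y) = Suc (len y)")
    case True
    have "?s \<circ> y \<noteq> inv x"
    proof
      assume e: "?s \<circ> y = inv x"
      have "len y = Suc (len (inv x))" using y[THEN iffD2, OF e] len by (simp only:)
      moreover have "len (inv x) = Suc (len y)" using True by (simp only: e)
      ultimately show False by simp
    qed
    then have "Lam (T x * (T ?s * T y)) = 0"
      using refl(1) refl.prems R by (simp add: T_refl_mult_up True IH[OF sy])
    then show ?thesis using \<open>?s \<circ> y \<noteq> inv x\<close> y by (simp add: T inv)
  next
    case False
    then have l: "len y = Suc (len (?s \<circ> y))" using len_refl_simple[OF refl(1) refl.prems] by auto
    \<comment> \<open>At a descent of \<open>y\<close> the quadratic relation contributes a multiple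
      of \<open>T y\<close>; as \<alpha> is an ascent of \<open>inv x\<close>, this term has trace
      zero.\<close>
    have "y \<noteq> inv x" using l len by auto
    then have "Lam (T x * (T ?s * T y)) = qq * (if ?s \<circ> y = inv x then qw x else 0)"
      using refl(1) refl.prems R l
      by (simp add: T_refl_mult_down distrib_left Lam_add Lam_scale IH flip: scale_mult_right)
    then show ?thesis using y refl(3) by (simp add: T inv qw_def)
  qed
qed

lemma Lam_mult:
  "Lam (a * b) = (\<Sum>x\<in>weyl. T_coeff x a * T_coeff (inv x) b * qw x)"
proof -
  have "Lam (a * b) = Lam ((\<Sum>x\<in>weyl. scale (T_coeff x a) (T x)) * (\<Sum>y\<in>weyl. scale (T_coeff y b) (T y)))"
    by (simp flip: T_expand)
  also have "\<dots> = (\<Sum>x\<in>weyl. \<Sum>y\<in>weyl. T_coeff x a * T_coeff y b * Lam (T x * T y))"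
    by (simp add: sum_product Lam_sum scale_mult_scale Lam_scale)
  also have "\<dots> = (\<Sum>x\<in>weyl. \<Sum>y\<in>weyl. if y = inv x then T_coeff x a * T_coeff y b * qw x else 0)"
    by (intro sum.cong) (auto simp: Lam_T_mult_T)
  also have "\<dots> = (\<Sum>x\<in>weyl. T_coeff x a * T_coeff (inv x) b * qw x)"
    by (intro sum.cong) auto
  finally show ?thesis .
qed

text \<open>The expansion in dual bases is symmetric under \<open>x \<mapsto> inv x\<close>, as
  inverses have equal length.\<close>

lemma Lam_commute: "Lam (a * b) = Lam (b * a)"
  unfolding Lam_mult
  by (rule sum.reindex_bij_witness[of _ inv inv]) (auto simp: mult_ac)

lemma Lam_T_mult:
  assumes "x \<in> weyl"
  shows "Lam (T x * h) = qw x * T_coeff (inv x) h"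
proof -
  have "Lam (T x * h) = (\<Sum>y\<in>weyl. if y = x then T_coeff (inv y) h * qw y else 0)"
    unfolding Lam_mult using assms by (intro sum.cong) (auto simp: T_coeff_T)
  then show ?thesis using assms by (simp add: mult.commute)
qed

lemma T_coeff_Lam:
  assumes "x \<in> weyl"
  shows "T_coeff x h = inverse (qw x) * Lam (h * T (inv x))"
  using Lam_T_mult[of "inv x" h] assms by (simp add: Lam_commute[of h])

text \<open>An antiautomorphism that preserves the trace; it reconciles two ways of writing an entry
  of the R-matrix, \<open>Lam (T x * T_inv y)\<close> and
  \<open>Lam (T_inv (inv y) * T (inv x))\<close>.\<close>

definition T_flip :: "'h \<Rightarrow> 'h"
  where "T_flip = T_extend id (\<lambda>w. T (inv w))"

lemma semilinear_T_flip: "semilinear id T_flip"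
  by (simp add: T_flip_def semilinear_T_extend field_hom_id)

lemma T_flip_T: "w \<in> weyl \<Longrightarrow> T_flip (T w) = T (inv w)"
  by (simp add: T_flip_def T_extend_T field_hom_id)

lemma T_flip_mult: "T_flip (g * h) = T_flip h * T_flip g"
proof -
  note sl = semilinear_T_flip
  have s: "T_flip (T (refl \<alpha>) * h) = T_flip h * T (refl \<alpha>)" if a: "\<alpha> \<in> simple" for \<alpha> h
  proof (rule semilinear_eqI[OF semilinear_mult(3)[OF sl] semilinear_mult(2)[OF sl]])
    fix w assume w: "w \<in> weyl"
    note R = simple_root[OF a]
    have inv: "inv (refl \<alpha> \<circ> w) = inv w \<circ> refl \<alpha>" using w R by (simp add: inv_comp_weyl)
    have len: "len (inv w \<circ> refl \<alpha>) = len (refl \<alpha> \<circ> w)" unfolding inv[symmetric] using w R by simp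
    from len_refl_simple[OF a w] show "T_flip (T (refl \<alpha>) * T w) = T_flip (T w) * T (refl \<alpha>)"
    proof
      assume "len (refl \<alpha> \<circ> w) = Suc (len w)"
      then show ?thesis using a w R len by (simp add: T_refl_mult_up T_mult_refl_up T_flip_T inv)
    next
      assume l: "len w = Suc (len (refl \<alpha> \<circ> w))"
      then have l': "len (inv w) = Suc (len (inv w \<circ> refl \<alpha>))" using w len by simp
      have "T_flip (T (refl \<alpha>) * T w) = scale (qq - 1) (T (inv w)) + scale qq (T (inv w \<circ> refl \<alpha>))"
        using a w R l
        by (simp add: T_refl_mult_down semilinear_add[OF sl] semilinear_scale[OF sl] T_flip_T inv)
      also have "\<dots> = T_flip (T w) * T (refl \<alpha>)"
        using T_mult_refl_down[OF a inv_weyl[OF w] l'] w by (simp add: T_flip_T)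
      finally show ?thesis .
    qed
  qed
  have w: "T_flip (T w * h) = T_flip h * T_flip (T w)" if "w \<in> weyl" for w h
    using that
  proof (induction arbitrary: h rule: weyl_induct)
    case id
    have "T_flip 1 = 1" using T_flip_T[OF id_weyl] by (metis T_id inv_id)
    then show "T_flip (T id * h) = T_flip h * T_flip (T id)" by simp
  next
    case (refl \<alpha> w)
    then show "T_flip (T (local.refl \<alpha> \<circ> w) * h) = T_flip h * T_flip (T (local.refl \<alpha> \<circ> w))"
      by (simp add: s mult.assoc flip: T_refl_mult_up)
  qed
  show ?thesis
    by (rule semilinear_eqI[OF semilinear_mult(4)[OF sl] semilinear_mult(1)[OF sl]]) (simp add: w)
qed

lemma T_flip_T_inv:
  assumes "w \<in> weyl"
  shows "T_flip (T_inv w) = T_inv (inv w)"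
proof -
  have 1: "T_flip 1 = 1" using T_flip_T[OF id_weyl] by (metis T_id inv_id)
  have "T (inv w) * T_flip (T_inv w) = T_flip (T_inv w * T w)"
    "T_flip (T_inv w) * T (inv w) = T_flip (T w * T_inv w)"
    using assms by (simp_all only: T_flip_mult T_flip_T)
  then show ?thesis using assms 1 by (intro T_inv_eqI[symmetric]) simp_all
qed

lemma Lam_T_flip: "Lam (T_flip h) = Lam h"
proof -
  have "Lam (T_flip h) = (\<Sum>w\<in>weyl. T_coeff w h * T_coeff id (T (inv w)))"
    by (simp add: T_flip_def T_extend_def Lam_sum Lam_scale) (simp add: Lam_def)
  also have "\<dots> = (\<Sum>w\<in>weyl. if w = id then T_coeff w h else 0)"
  proof (intro sum.cong refl)
    fix w assume w: "w \<in> weyl"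
    have "id = inv w \<longleftrightarrow> w = id" using w by (metis inv_id inv_inv_weyl)
    then show "T_coeff w h * T_coeff id (T (inv w)) = (if w = id then T_coeff w h else 0)"
      using w by (simp add: T_coeff_T)
  qed
  finally show ?thesis by (simp add: Lam_def)
qed

section \<open>The R-matrix\<close>

text \<open>These are the images under \<open>bar\<close> of the R-polynomials of Kazhdan and Lusztig.\<close>

definition bar_R :: "('x \<Rightarrow> 'x) \<Rightarrow> ('x \<Rightarrow> 'x) \<Rightarrow> 'x qz_field"
  where "bar_R x y = Lam (T_inv (inv y) * T (inv x))"

lemma T_coeff_T_inv_inv: "x \<in> weyl \<Longrightarrow> T_coeff x (T_inv (inv y)) = inverse (qw x) * bar_R x y"
  by (simp add: T_coeff_Lam bar_R_def)

lemma Lam_T_mult_T_inv: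
  assumes "x \<in> weyl" "y \<in> weyl"
  shows "Lam (T x * T_inv y) = bar_R x y"
proof -
  have "Lam (T x * T_inv y) = Lam (T_flip (T x * T_inv y))" by (simp only: Lam_T_flip)
  then show ?thesis using assms by (simp add: T_flip_mult T_flip_T T_flip_T_inv bar_R_def)
qed

text \<open>In the basis \<open>T\<close>, \<open>kl_involution\<close> is given by the R-matrix
  with signs, conjugated by powers of \<open>q\<close>. Its square is the identity, and the powers
  cancel.\<close>

lemma bar_R_eps:
  assumes "x \<in> weyl" "y \<in> weyl"
  shows "(\<Sum>z\<in>weyl. eps z * bar_R x z * bar_R z y) = (if x = y then eps x else 0)"
proof -
  let ?e = "eps y * qw y"
  have "(if x = y then 1 else 0) = T_coeff x (kl_involution (kl_involution (T y)))"
    using assms by (simp add: kl_involution_self T_coeff_T)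
  also have "kl_involution (T y) = (\<Sum>z\<in>weyl. scale (T_coeff z (kl_involution (T y))) (T z))"
    by (rule T_expand)
  also have "T_coeff x (kl_involution \<dots>) = (\<Sum>z\<in>weyl. T_coeff z (kl_involution (T y)) * T_coeff x (kl_involution (T z)))"
    by (simp add: semilinear_sum[OF semilinear_kl_involution] semilinear_scale[OF semilinear_kl_involution]
        T_coeff_sum T_coeff_scale)
  also have "\<dots> = (\<Sum>z\<in>weyl. (eps y * qw y * inverse (qw x)) * (eps z * bar_R x z * bar_R z y))"
    using assms by (intro sum.cong) (auto simp: kl_involution_T T_coeff_scale T_coeff_T_inv_inv field_simps)
  also have "\<dots> = (eps y * qw y * inverse (qw x)) * (\<Sum>z\<in>weyl. eps z * bar_R x z * bar_R z y)"
    by (simp add: sum_distrib_left)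
  finally have "eps y * qw x * inverse (qw y) * (if x = y then 1 else 0) =
      eps y * qw x * inverse (qw y) * (eps y * qw y * inverse (qw x)) * (\<Sum>z\<in>weyl. eps z * bar_R x z * bar_R z y)"
    by (simp only: mult.assoc)
  also have "eps y * qw x * inverse (qw y) * (eps y * qw y * inverse (qw x)) = 1"
    by (simp add: field_simps)
  finally show ?thesis by (auto simp: field_simps)
qed

text \<open>Lengths add in \<open>x \<circ> (inv x \<circ> longest) = longest\<close>. Thus
  \<open>T longest\<close> trades inverses of basis elements for basis elements, which is how the
  transposition of the R-matrix arises.\<close>

lemma T_comp_longest:
  assumes "x \<in> weyl"
  shows "T (inv x \<circ> longest) = T_inv x * T longest"
proof -
  have "len (x \<circ> (inv x \<circ> longest)) = len x + len (inv x \<circ> longest)"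
    using assms len_comp_longest[of "inv x"] longest_props by (simp add: comp_assoc[symmetric])
  then have "T x * T (inv x \<circ> longest) = T longest"
    using assms longest_props T_mult[of x "inv x \<circ> longest"] by (simp add: comp_assoc[symmetric])
  then have "T_inv x * T longest = T_inv x * T x * T (inv x \<circ> longest)" by (simp add: mult.assoc)
  then show ?thesis using assms by simp
qed

lemma T_inv_comp_longest:
  assumes "x \<in> weyl"
  shows "T_inv (inv x \<circ> longest) = T_inv longest * T x"
proof (rule T_inv_eqI)
  note l = longest_props(1)
  have "T (inv x \<circ> longest) * (T_inv longest * T x) = T_inv x * (T longest * T_inv longest) * T x"
    using assms by (simp only: T_comp_longest mult.assoc)
  then show "T (inv x \<circ> longest) * (T_inv longest * T x) = 1" using assms l by simp
  have "(T_inv longest * T x) * T (inv x \<circ> longest) = T_inv longest * (T x * T_inv x) * T longest"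
    using assms by (simp only: T_comp_longest mult.assoc)
  then show "(T_inv longest * T x) * T (inv x \<circ> longest) = 1" using assms l by simp
qed

lemma bar_R_longest:
  assumes "x \<in> weyl" "w \<in> weyl"
  shows "bar_R (longest \<circ> w) (longest \<circ> x) = bar_R x w"
proof -
  note l = longest_props(1)
  have inv: "inv (longest \<circ> v) = inv v \<circ> longest" if "v \<in> weyl" for v
    using that l by (simp add: inv_comp_weyl inv_longest)
  have "bar_R (longest \<circ> w) (longest \<circ> x) = Lam (T_inv longest * (T x * T_inv w * T longest))"
    using assms by (simp add: bar_R_def inv T_inv_comp_longest T_comp_longest mult.assoc)
  also have "\<dots> = Lam (T x * T_inv w * (T longest * T_inv longest))"
    by (subst Lam_commute) (simp only: mult.assoc)
  also have "\<dots> = bar_R x w" using assms l by (simp add: Lam_T_mult_T_inv)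
  finally show ?thesis .
qed

section \<open>Kazhdan-Lusztig polynomials\<close>

lemma at_q_Fract: "at_q p = Fract (map_poly of_int p) 1"
proof -
  have "cst (of_int n) = (of_int n :: 'x qz_field)" for n
  proof (induction n rule: int_induct[where k = 0])
    case base
    show ?case by (simp add: cst_0)
  next
    case (step1 i)
    then show ?case by (simp add: cst_add cst_1)
  next
    case (step2 i)
    have "cst (of_int (i - 1)) + cst 1 = (cst (of_int i) :: 'x qz_field)" by (simp flip: cst_add)
    then show ?case using step2 by (simp add: cst_1 algebra_simps)
  qed
  then have "map_poly of_int p = map_poly cst (map_poly of_int p :: 'x torus_field poly)"
    by (intro poly_eqI) (simp add: coeff_map_poly cst_0)
  then show ?thesis by (simp add: at_q_def poly_cst_qq)
qed

lemma at_q_0 [simp]: "at_q 0 = 0" and at_q_1 [simp]: "at_q 1 = 1"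
  by (simp_all add: at_q_def)

lemma low_degree_eps: "low_degree d f \<Longrightarrow> low_degree d (eps x * f)"
  using low_degree_minus[of d f] by (cases "even (len x)") (simp_all add: eps_def)

lemma low_degree_at_q: "2 * degree p + 1 \<le> d \<Longrightarrow> low_degree d (at_q p)"
  unfolding low_degree_def at_q_Fract
  using map_poly_degree_leq[of "of_int :: int \<Rightarrow> 'x torus_field" p] by (intro exI[of _ "map_poly of_int p"]) (auto intro: order_trans)

context
  fixes P :: "('x \<Rightarrow> 'x) \<Rightarrow> ('x \<Rightarrow> 'x) \<Rightarrow> int poly"
  assumes KL: "KL_family P"
begin

abbreviation kl :: "('x \<Rightarrow> 'x) \<Rightarrow> ('x \<Rightarrow> 'x) \<Rightarrow> 'x qz_field"
  where "kl x w \<equiv> at_q (P x w)"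

abbreviation ikl :: "('x \<Rightarrow> 'x) \<Rightarrow> ('x \<Rightarrow> 'x) \<Rightarrow> 'x qz_field"
  where "ikl x w \<equiv> at_q (inverse_KL P x w)"

lemma kl_diag: "w \<in> weyl \<Longrightarrow> kl w w = 1"
  using KL by (simp add: KL_family_def)

lemma kl_eq_0: "x \<in> weyl \<Longrightarrow> w \<in> weyl \<Longrightarrow> \<not> bruhat x w \<Longrightarrow> kl x w = 0"
  using KL by (simp add: KL_family_def)

lemma kl_small:
  assumes "bruhat x w" "x \<noteq> w"
  shows "low_degree (len w - len x) (kl x w)"
proof -
  have "2 * degree (P x w) + 1 + len x \<le> len w"
    using KL assms bruhat_weyl[OF assms(1)] unfolding KL_family_def by blast
  then show ?thesis by (intro low_degree_at_q) simp
qed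

lemma ikl_diag: "w \<in> weyl \<Longrightarrow> ikl w w = 1"
  using longest_props by (simp add: inverse_KL_def kl_diag)

lemma ikl_eq_0: "x \<in> weyl \<Longrightarrow> w \<in> weyl \<Longrightarrow> \<not> bruhat x w \<Longrightarrow> ikl x w = 0"
  using longest_props by (simp add: inverse_KL_def kl_eq_0 bruhat_longest_iff)

lemma ikl_small:
  assumes "bruhat x w" "x \<noteq> w"
  shows "low_degree (len w - len x) (ikl x w)"
proof -
  note W = bruhat_weyl[OF assms(1)]
  have "longest \<circ> w \<noteq> longest \<circ> x" using assms W longest_inj by simp
  then have "low_degree (len (longest \<circ> x) - len (longest \<circ> w)) (ikl x w)"
    unfolding inverse_KL_def by (rule kl_small[OF bruhat_longest[OF assms(1)]])
  moreover have "len (longest \<circ> x) - len (longest \<circ> w) = len w - len x"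
    using len_longest_comp[OF W(1)] len_longest_comp[OF W(2)] by linarith
  ultimately show ?thesis by simp
qed

lemma kl_bar:
  assumes "x \<in> weyl" "w \<in> weyl"
  shows "(\<Sum>y\<in>weyl. bar_R x y * bar (kl y w)) = qw x * inverse (qw w) * kl x w"
proof -
  have "hecke_bar (\<Sum>y\<in>weyl. scale (kl y w) (T y)) = scale (inverse (qw w)) (\<Sum>y\<in>weyl. scale (kl y w) (T y))"
    using KL assms unfolding KL_family_def by blast
  then have "T_coeff x (hecke_bar (\<Sum>y\<in>weyl. scale (kl y w) (T y))) = inverse (qw w) * kl x w"
    using assms by (simp add: T_coeff_scale T_coeff_sum_T)
  also have "hecke_bar (\<Sum>y\<in>weyl. scale (kl y w) (T y)) = (\<Sum>y\<in>weyl. scale (bar (kl y w)) (T_inv (inv y)))"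
    by (simp add: semilinear_sum[OF semilinear_hecke_bar] semilinear_scale[OF semilinear_hecke_bar] hecke_bar_T)
  also have "T_coeff x \<dots> = inverse (qw x) * (\<Sum>y\<in>weyl. bar_R x y * bar (kl y w))"
    using assms by (simp add: T_coeff_sum T_coeff_scale T_coeff_T_inv_inv sum_distrib_left mult_ac)
  finally show ?thesis by (simp add: field_simps)
qed

text \<open>This is \<open>kl_bar\<close> transported by multiplication with \<open>longest\<close>:
  the R-matrix is transposed, and complementary lengths turn the ratio of powers of \<open>q\<close>
  into the one stated.\<close>

lemma ikl_bar:
  assumes "x \<in> weyl" "w \<in> weyl"
  shows "(\<Sum>z\<in>weyl. bar (ikl x z) * bar_R z w) = qw x * inverse (qw w) * ikl x w"
proof -
  note l = longest_props(1)
  have "(\<Sum>z\<in>weyl. bar (ikl x z) * bar_R z w) =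
      (\<Sum>y\<in>weyl. bar_R (longest \<circ> w) y * bar (kl y (longest \<circ> x)))"
    by (rule sum.reindex_bij_witness[of _ "\<lambda>y. longest \<circ> y" "\<lambda>y. longest \<circ> y"])
      (use assms l in \<open>simp_all add: inverse_KL_def bar_R_longest\<close>)
  also have "\<dots> = qw (longest \<circ> w) * inverse (qw (longest \<circ> x)) * ikl x w"
    using assms l by (simp add: kl_bar inverse_KL_def)
  also have "qw (longest \<circ> w) * inverse (qw (longest \<circ> x)) = qw x * inverse (qw w)"
    using qw_longest[OF assms(1)] qw_longest[OF assms(2)] by (simp add: field_simps)
  finally show ?thesis .
qed

lemma bar_kl_eq:
  assumes "z \<in> weyl" "w \<in> weyl"
  shows "bar (kl z w) = (\<Sum>y\<in>weyl. eps z * eps y * bar_R z y * (qw y * inverse (qw w) * kl y w))"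
proof -
  have "(\<Sum>y\<in>weyl. eps z * eps y * bar_R z y * (qw y * inverse (qw w) * kl y w)) =
      (\<Sum>y\<in>weyl. eps z * eps y * bar_R z y * (\<Sum>t\<in>weyl. bar_R y t * bar (kl t w)))"
    using assms by (intro sum.cong) (auto simp: kl_bar)
  also have "\<dots> = (\<Sum>t\<in>weyl. (\<Sum>y\<in>weyl. eps z * eps y * bar_R z y * bar_R y t) * bar (kl t w))"
    by (rule sum_mult_assoc)
  also have "\<dots> = (\<Sum>t\<in>weyl. (eps z * (\<Sum>y\<in>weyl. eps y * bar_R z y * bar_R y t)) * bar (kl t w))"
    by (simp add: sum_distrib_left mult.assoc)
  also have "\<dots> = (\<Sum>t\<in>weyl. if z = t then bar (kl t w) else 0)"
    using assms by (intro sum.cong) (auto simp: bar_R_eps)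
  finally show ?thesis using assms by simp
qed

definition ikl_kl :: "('x \<Rightarrow> 'x) \<Rightarrow> ('x \<Rightarrow> 'x) \<Rightarrow> 'x qz_field"
  where "ikl_kl x w = (\<Sum>z\<in>weyl. eps x * eps z * ikl x z * kl z w)"

lemma bar_ikl_kl:
  assumes "x \<in> weyl" "w \<in> weyl"
  shows "bar (ikl_kl x w) = qw x * inverse (qw w) * ikl_kl x w"
proof -
  have "bar (ikl_kl x w) = (\<Sum>z\<in>weyl. eps x * eps z * bar (ikl x z) * bar (kl z w))"
    by (simp add: ikl_kl_def bar_sum bar_mult)
  also have "\<dots> = (\<Sum>z\<in>weyl. eps x * bar (ikl x z) * (\<Sum>y\<in>weyl. eps y * bar_R z y * (qw y * inverse (qw w) * kl y w)))"
    using assms by (intro sum.cong) (auto simp: bar_kl_eq sum_distrib_left mult_ac intro!: sum.cong)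
  also have "\<dots> = (\<Sum>y\<in>weyl. (\<Sum>z\<in>weyl. eps x * bar (ikl x z) * (eps y * bar_R z y)) * (qw y * inverse (qw w) * kl y w))"
    by (rule sum_mult_assoc)
  also have "\<dots> = (\<Sum>y\<in>weyl. eps x * eps y * (\<Sum>z\<in>weyl. bar (ikl x z) * bar_R z y) * (qw y * inverse (qw w) * kl y w))"
    by (simp add: sum_distrib_left mult_ac)
  also have "\<dots> = (\<Sum>y\<in>weyl. eps x * eps y * (qw x * inverse (qw y) * ikl x y) * (qw y * inverse (qw w) * kl y w))"
    using assms by (intro sum.cong) (auto simp: ikl_bar)
  also have "\<dots> = qw x * inverse (qw w) * ikl_kl x w"
    unfolding ikl_kl_def sum_distrib_left by (intro sum.cong) (auto simp: field_simps)
  finally show ?thesis .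
qed

text \<open>The inversion formula of Kazhdan and Lusztig: off the diagonal, the matrix product has entries
  of low_degree degree that are palindromic.\<close>

lemma ikl_kl_eq:
  assumes "x \<in> weyl" "w \<in> weyl"
  shows "ikl_kl x w = (if x = w then 1 else 0)"
proof (cases "bruhat x w")
  case False
  have "eps x * eps z * ikl x z * kl z w = 0" if "z \<in> weyl" for z
    using that False bruhat_trans[of x z w] assms ikl_eq_0[of x z] kl_eq_0[of z w] by auto
  then have "ikl_kl x w = 0" unfolding ikl_kl_def by (intro sum.neutral) blast
  then show ?thesis using False assms by auto
next
  case True
  show ?thesis
  proof (cases "x = w")
    case eq: True
    have "ikl_kl w w = (\<Sum>z\<in>weyl. if z = w then 1 else 0)"
      unfolding ikl_kl_def
    proof (intro sum.cong refl)
      fix z assume z: "z \<in> weyl"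
      show "eps w * eps z * ikl w z * kl z w = (if z = w then 1 else 0)"
        using z assms bruhat_antisym[of z w] ikl_eq_0[of w z] kl_eq_0[of z w]
        by (auto simp: ikl_diag kl_diag)
    qed
    then show ?thesis using eq assms by simp
  next
    case ne: False
    let ?d = "len w - len x"
    have d: "?d > 0" using bruhat_len[OF True] ne by simp
    have "low_degree ?d (ikl_kl x w)"
      unfolding ikl_kl_def
    proof (rule low_degree_sum[OF d])
      fix z assume z: "z \<in> weyl"
      have "low_degree ?d (ikl x z * kl z w)"
      proof (cases "bruhat x z \<and> bruhat z w")
        case False
        then have "ikl x z * kl z w = 0" using z assms ikl_eq_0[of x z] kl_eq_0[of z w] by auto
        then show ?thesis using low_degree_0[OF d] by (simp only:)
      next
        case b: True
        \<comment> \<open>At both ends one factor is a diagonal 1, which has no low degree for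
          length difference 0; only strictly inside can the two bounds be multiplied.\<close>
        consider "z = x" | "z = w" | "z \<noteq> x" "z \<noteq> w" by blast
        then show ?thesis
        proof cases
          case 1
          then show ?thesis using kl_small[OF True ne] assms by (simp add: ikl_diag)
        next
          case 2
          then show ?thesis using ikl_small[OF True ne] assms by (simp add: kl_diag)
        next
          case 3
          have "low_degree (len z - len x) (ikl x z)" "low_degree (len w - len z) (kl z w)"
            using b 3 ikl_small[of x z] kl_small[of z w] by auto
          from low_degree_mult[OF this] show ?thesis
            using bruhat_len[of x z] bruhat_len[of z w] b 3 by auto
        qed
      qed
      then show "low_degree ?d (eps x * eps z * ikl x z * kl z w)"
        using low_degree_eps[of ?d _ x] low_degree_eps[of ?d _ z] by (simp add: mult.assoc)
    qed
    moreover have "bar (ikl_kl x w) = inverse qq ^ ?d * ikl_kl x w"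
    proof -
      have "qw w = qw x * qq ^ ?d" using bruhat_len[OF True] by (auto simp: qw_def simp flip: power_add)
      then show ?thesis using bar_ikl_kl[OF assms] by (simp add: field_simps power_inverse)
    qed
    ultimately show ?thesis using low_degree_bar_eq_0 ne by simp
  qed
qed

text \<open>The product in the other order is idempotent and unitriangular, hence the identity.\<close>

definition kl_ikl :: "('x \<Rightarrow> 'x) \<Rightarrow> ('x \<Rightarrow> 'x) \<Rightarrow> 'x qz_field"
  where "kl_ikl x w = (\<Sum>z\<in>weyl. kl x z * (eps z * eps w * ikl z w))"

lemma kl_ikl_idem:
  assumes "x \<in> weyl" "w \<in> weyl"
  shows "(\<Sum>z\<in>weyl. kl_ikl x z * kl_ikl z w) = kl_ikl x w"
proof -
  have "(\<Sum>z\<in>weyl. kl_ikl x z * kl_ikl z w) =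
      (\<Sum>z\<in>weyl. kl_ikl x z * (\<Sum>t\<in>weyl. kl z t * (eps t * eps w * ikl t w)))"
    by (simp add: kl_ikl_def)
  also have "\<dots> = (\<Sum>t\<in>weyl. (\<Sum>z\<in>weyl. kl_ikl x z * kl z t) * (eps t * eps w * ikl t w))"
    by (rule sum_mult_assoc)
  also have "\<dots> = (\<Sum>t\<in>weyl. kl x t * (eps t * eps w * ikl t w))"
  proof (intro sum.cong refl)
    fix t assume t: "t \<in> weyl"
    have "(\<Sum>z\<in>weyl. kl_ikl x z * kl z t) =
        (\<Sum>s\<in>weyl. kl x s * (\<Sum>z\<in>weyl. (eps s * eps z * ikl s z) * kl z t))"
      by (simp add: kl_ikl_def sum_mult_assoc)
    also have "\<dots> = (\<Sum>s\<in>weyl. if s = t then kl x s else 0)"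
      using t by (intro sum.cong) (auto simp: ikl_kl_eq simp flip: ikl_kl_def)
    finally show "(\<Sum>z\<in>weyl. kl_ikl x z * kl z t) * (eps t * eps w * ikl t w) =
        kl x t * (eps t * eps w * ikl t w)" using t by simp
  qed
  finally show ?thesis by (simp add: kl_ikl_def)
qed

text \<open>In the idempotent relation all strictly intermediate terms vanish by induction on the
  length difference, and the two ends leave \<open>e = e + e\<close>.\<close>

lemma kl_ikl_eq:
  assumes "x \<in> weyl" "w \<in> weyl"
  shows "kl_ikl x w = (if x = w then 1 else 0)"
proof -
  have triangular: "kl_ikl x w = 0" if "x \<in> weyl" "w \<in> weyl" "\<not> bruhat x w" for x w
    using that bruhat_trans[of x _ w] ikl_eq_0[of _ w] kl_eq_0[of x]
    unfolding kl_ikl_def by (intro sum.neutral) auto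
  have diag: "kl_ikl w w = 1" if w: "w \<in> weyl" for w
  proof -
    have "kl_ikl w w = (\<Sum>z\<in>weyl. if z = w then 1 else 0)"
      unfolding kl_ikl_def
    proof (intro sum.cong refl)
      fix z assume z: "z \<in> weyl"
      show "kl w z * (eps z * eps w * ikl z w) = (if z = w then 1 else 0)"
        using z w bruhat_antisym[of z w] ikl_eq_0[of z w] kl_eq_0[of w z]
        by (auto simp: ikl_diag kl_diag)
    qed
    then show ?thesis using w by simp
  qed
  show ?thesis
    using assms
  proof (induction "len w - len x" arbitrary: x w rule: less_induct)
    case less
    show ?case
    proof (cases "bruhat x w \<and> x \<noteq> w")
      case False
      then show ?thesis using less.prems triangular diag by auto
    next
      case True
      then have lt: "len x < len w" using bruhat_len by blast
      have "kl_ikl x w = (\<Sum>z\<in>weyl. kl_ikl x z * kl_ikl z w)"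
        using less.prems by (simp add: kl_ikl_idem)
      also have "\<dots> = (\<Sum>z\<in>weyl. (if z = x then kl_ikl x w else 0) + (if z = w then kl_ikl x w else 0))"
      proof (intro sum.cong refl)
        fix z assume z: "z \<in> weyl"
        consider "z = x" | "z = w" | "z \<noteq> x" "z \<noteq> w" by blast
        then show "kl_ikl x z * kl_ikl z w = (if z = x then kl_ikl x w else 0) + (if z = w then kl_ikl x w else 0)"
        proof cases
          case 3
          have "kl_ikl x z = 0 \<or> kl_ikl z w = 0"
          proof (cases "bruhat x z \<and> bruhat z w")
            case b: True
            then have "len z - len x < len w - len x" using bruhat_len[of x z] bruhat_len[of z w] 3 by auto
            then show ?thesis using less.hyps[of z x] z less.prems 3 by simp
          qed (use triangular z less.prems in blast)
          then show ?thesis using 3 by auto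
        qed (use True less.prems diag in auto)
      qed
      also have "\<dots> = kl_ikl x w + kl_ikl x w"
        using less.prems by (simp add: sum.distrib)
      finally have "kl_ikl x w = 0" by (simp only: add_cancel_right_right)
      then show ?thesis using True by simp
    qed
  qed
qed

lemma bar_R_eq:
  assumes "x \<in> weyl" "t \<in> weyl"
  shows "bar_R x t = (\<Sum>y\<in>weyl. qw x * inverse (qw y) * kl x y * (eps y * eps t * bar (ikl y t)))"
proof -
  have "(\<Sum>y\<in>weyl. qw x * inverse (qw y) * kl x y * (eps y * eps t * bar (ikl y t))) =
      (\<Sum>y\<in>weyl. (\<Sum>z\<in>weyl. bar_R x z * bar (kl z y)) * (eps y * eps t * bar (ikl y t)))"
    using assms by (intro sum.cong) (auto simp: kl_bar)
  also have "\<dots> = (\<Sum>z\<in>weyl. bar_R x z * (\<Sum>y\<in>weyl. bar (kl z y) * (eps y * eps t * bar (ikl y t))))"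
    by (rule sum_mult_assoc[symmetric])
  also have "\<dots> = (\<Sum>z\<in>weyl. bar_R x z * bar (kl_ikl z t))"
    by (simp add: kl_ikl_def bar_sum bar_mult)
  also have "\<dots> = (\<Sum>z\<in>weyl. if z = t then bar_R x z else 0)"
    using assms by (intro sum.cong) (auto simp: kl_ikl_eq)
  finally show ?thesis using assms by simp
qed

end

end

section \<open>The elements \<open>\<mu>\<close>\<close>

lemma torus_pt_inverse_pt: "torus_pt z \<Longrightarrow> torus_pt (inverse_pt z)"
  by (simp add: torus_pt_def inverse_pt_def)

lemma inverse_pt_act_pt: "inverse_pt (act_pt w z) = act_pt w (inverse_pt z)"
  by (simp add: inverse_pt_def act_pt_def)

lemma torus_pt_generic: "torus_pt generic_pt"
  by (simp add: torus_pt_def generic_pt_def mult_single fract_collapse)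

context root_datum
begin

lemma regular_act_pt:
  assumes "regular z" "w \<in> weyl"
  shows "regular (act_pt w z)"
  unfolding regular_def act_pt_def using assms weyl_root[of "inv w"] by (auto simp: regular_def)

lemma torus_pt_act_pt:
  assumes "torus_pt z" "w \<in> weyl"
  shows "torus_pt (act_pt w z)"
  unfolding torus_pt_def act_pt_def using assms weyl_add[of "inv w"] by (simp add: torus_pt_def)

lemma regular_inverse_pt: "regular z \<Longrightarrow> regular (inverse_pt z)"
  by (simp add: regular_def inverse_pt_def)

text \<open>Roots are nonzero, so they give monomials of the group algebra different from 1.\<close>

lemma regular_generic: "regular generic_pt"
  unfolding regular_def
proof
  fix \<alpha> assume a: "\<alpha> \<in> \<Phi>"
  have "Poly_Mapping.single \<alpha> (1 :: complex) \<noteq> 1"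
    using root_nonzero[OF a] by (metis lookup_single_eq lookup_single_not_eq single_one zero_neq_one)
  then show "generic_pt \<alpha> \<noteq> 1"
    by (simp add: generic_pt_def One_fract_def eq_fract)
qed

end

context hecke_algebra
begin

lemma T_mult_refl_support:
  assumes a: "\<alpha> \<in> simple" and y: "y \<in> weyl" and x: "x \<in> weyl" and nz: "T_coeff x (T y * T (refl \<alpha>)) \<noteq> 0"
  shows "x = y \<or> x = y \<circ> refl \<alpha>"
proof -
  note R = simple_root[OF a]
  from len_refl_simple_right[OF a y] show ?thesis
  proof
    assume "len (y \<circ> refl \<alpha>) = Suc (len y)"
    then have "T y * T (refl \<alpha>) = T (y \<circ> refl \<alpha>)" using a y by (simp add: T_mult_refl_up)
    then show ?thesis using nz x y R by (auto simp: T_coeff_T split: if_splits)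
  next
    assume "len y = Suc (len (y \<circ> refl \<alpha>))"
    then have "T y * T (refl \<alpha>) = scale (qq - 1) (T y) + scale qq (T (y \<circ> refl \<alpha>))"
      using a y by (simp add: T_mult_refl_down)
    then show ?thesis using nz x y R by (auto simp: T_coeff_T T_coeff_add T_coeff_scale split: if_splits)
  qed
qed

section \<open>Conjugation and support of \<mu>\<close>

context
  fixes \<mu> :: "('x \<Rightarrow> 'x torus_field) \<Rightarrow> ('x \<Rightarrow> 'x) \<Rightarrow> 'h"
  assumes mu: "mu_family \<mu>"
begin

lemma mu_id: "torus_pt z \<Longrightarrow> regular z \<Longrightarrow> \<mu> z id = 1"
  using mu by (simp add: mu_family_def)

lemma mu_refl:
  "torus_pt z \<Longrightarrow> regular z \<Longrightarrow> \<alpha> \<in> simple \<Longrightarrow> \<mu> z (refl \<alpha>) =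
    scale (inverse qq) (T (refl \<alpha>)) + scale ((1 - inverse qq) * cst (z \<alpha> / (1 - z \<alpha>))) 1"
  using mu by (simp add: mu_family_def)

lemma mu_refl_comp:
  assumes "torus_pt z" "regular z" "\<alpha> \<in> simple" "w \<in> weyl" "len (refl \<alpha> \<circ> w) = Suc (len w)"
  shows "\<mu> z (refl \<alpha> \<circ> w) = \<mu> z w * \<mu> (act_pt w z) (refl \<alpha>)"
proof -
  have "refl \<alpha> \<in> weyl" "len (refl \<alpha> \<circ> w) = len (refl \<alpha>) + len w"
    using assms by (simp_all add: simple_root)
  then show ?thesis using mu assms unfolding mu_family_def by blast
qed

text \<open>Conjugation leaves the torus coefficient alone, so everything rests on the identity
  \<open>k + l = -1\<close> between the coefficients at a point and at its inverse; the
  \<open>-1\<close> absorbs the constant term of the inverse of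
  \<open>T (refl \<alpha>)\<close>.\<close>

lemma hecke_bar_mu_refl:
  assumes z: "torus_pt z" "regular z" and a: "\<alpha> \<in> simple"
  shows "hecke_bar (\<mu> z (refl \<alpha>)) = scale qq (\<mu> (inverse_pt z) (refl \<alpha>))"
proof -
  note R = simple_root[OF a] and sl = semilinear_hecke_bar
  have za: "z \<alpha> \<noteq> 1" using z(2) R by (auto simp: regular_def)
  have "z (\<alpha> + - \<alpha>) = z \<alpha> * z (- \<alpha>)" using z(1) unfolding torus_pt_def by blast
  then have z0: "z \<alpha> \<noteq> 0" using z(1) by (auto simp: torus_pt_def)
  define k l where "k = z \<alpha> / (1 - z \<alpha>)" and "l = inverse (z \<alpha>) / (1 - inverse (z \<alpha>))"
  have "1 - inverse (z \<alpha>) = (z \<alpha> - 1) * inverse (z \<alpha>)" using z0 by (simp add: left_diff_distrib)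
  then have l: "l = 1 / (z \<alpha> - 1)" using z0 by (simp add: l_def)
  have k: "k = - (z \<alpha> / (z \<alpha> - 1))" by (metis k_def minus_diff_eq minus_divide_right)
  have "k + l = - 1" unfolding k l using za by (simp add: field_simps)
  then have "cst k + cst l = cst (- 1)" by (simp flip: cst_add)
  also have "cst (- 1) + cst 1 = (cst 0 :: 'x qz_field)" by (simp flip: cst_add)
  then have "cst (- 1) = (- 1 :: 'x qz_field)" by (simp add: cst_0 cst_1 eq_neg_iff_add_eq_0)
  finally have kl: "cst k = - 1 - cst l" by (simp add: algebra_simps)
  have q: "qq * inverse qq = (1 :: 'x qz_field)"
    using qq_nonzero[where 'a = "'x torus_field"] by simp
  have "hecke_bar (\<mu> z (refl \<alpha>)) = scale qq (T_inv (refl \<alpha>)) + scale ((1 - qq) * cst k) 1"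
    using z a R
    by (simp add: mu_refl semilinear_add[OF sl] semilinear_scale[OF sl] hecke_bar_T bar_inverse
        bar_mult bar_diff flip: k_def)
  also have "\<dots> = T (refl \<alpha>) + scale (qq * (inverse qq - 1) + (1 - qq) * cst k) 1"
    using a q by (simp add: T_inv_refl scale_right_distrib scale_left_distrib)
  also have "qq * (inverse qq - 1) + (1 - qq) * cst k = qq * ((1 - inverse qq) * cst l)"
  proof -
    have "qq * (inverse qq - 1) = (1 - qq :: 'x qz_field)" "qq * ((1 - inverse qq) * cst l) = (qq - 1) * cst l"
      using q by (simp_all add: right_diff_distrib left_diff_distrib flip: mult.assoc)
    then show ?thesis unfolding kl by (simp add: algebra_simps)
  qed
  also have "T (refl \<alpha>) + scale (qq * ((1 - inverse qq) * cst l)) 1 = scale qq (\<mu> (inverse_pt z) (refl \<alpha>))"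
    using z a q
    by (simp add: mu_refl torus_pt_inverse_pt regular_inverse_pt scale_right_distrib)
      (simp add: l_def inverse_pt_def)
  finally show ?thesis .
qed

lemma hecke_bar_mu:
  assumes "v \<in> weyl" "torus_pt z" "regular z"
  shows "hecke_bar (\<mu> z v) = scale (qw v) (\<mu> (inverse_pt z) v)"
  using assms(1)
proof (induction rule: weyl_induct)
  case id
  show "hecke_bar (\<mu> z id) = scale (qw id) (\<mu> (inverse_pt z) id)"
    using assms by (simp add: mu_id torus_pt_inverse_pt regular_inverse_pt qw_def)
next
  case (refl \<alpha> v)
  let ?s = "local.refl \<alpha>"
  have z': "torus_pt (act_pt v z)" "regular (act_pt v z)"
    using assms refl by (simp_all add: torus_pt_act_pt regular_act_pt)
  have IH: "hecke_bar (\<mu> z v) = scale (qw v) (\<mu> (inverse_pt z) v)" by (rule refl.IH)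
  have "hecke_bar (\<mu> z (?s \<circ> v)) = scale (qw v) (\<mu> (inverse_pt z) v) * scale qq (\<mu> (inverse_pt (act_pt v z)) ?s)"
    using assms refl(1-3) z' by (simp add: mu_refl_comp hecke_bar_mult IH hecke_bar_mu_refl)
  also have "\<dots> = scale (qw v * qq) (\<mu> (inverse_pt z) v * \<mu> (act_pt v (inverse_pt z)) ?s)"
    by (simp add: scale_mult_scale inverse_pt_act_pt)
  also have "\<dots> = scale (qw v * qq) (\<mu> (inverse_pt z) (?s \<circ> v))"
    using assms refl(1-3) by (simp add: mu_refl_comp torus_pt_inverse_pt regular_inverse_pt)
  also have "qw v * qq = qw (?s \<circ> v)" using refl(3) by (simp add: qw_def)
  finally show "hecke_bar (\<mu> z (?s \<circ> v)) = scale (qw (?s \<circ> v)) (\<mu> (inverse_pt z) (?s \<circ> v))" .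
qed

text \<open>The inverse appears because \<mu> acquires a factor on the right when \<open>v\<close>
  grows on the left. Each factor keeps the index or multiplies it by \<open>refl \<alpha>\<close>,
  so the lifting property confines the support.\<close>

lemma mu_support:
  assumes "v \<in> weyl" "torus_pt z" "regular z" "x \<in> weyl" "T_coeff x (\<mu> z v) \<noteq> 0"
  shows "bruhat (inv x) v"
  using assms(1,4,5)
proof (induction arbitrary: x rule: weyl_induct)
  case id
  have "T_coeff x (\<mu> z id) \<noteq> 0" by (rule id.prems)
  then have "x = id"
    using id.prems(1) assms(2,3) T_coeff_T[of x id] by (simp add: mu_id split: if_splits)
  then show "bruhat (inv x) id" by (metis bruhat_refl id_weyl inv_id)
next
  case (refl \<alpha> v)
  let ?s = "local.refl \<alpha>" and ?v = "local.refl \<alpha> \<circ> v"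
  note a = refl(1) and R = simple_root[OF refl(1)]
  have IH: "bruhat (inv y) v" if "y \<in> weyl" "T_coeff y (\<mu> z v) \<noteq> 0" for y
    using that by (rule refl.IH)
  have vs: "bruhat v ?v" using bruhat_refl_simple refl(1-3) by blast
  have z': "torus_pt (act_pt v z)" "regular (act_pt v z)"
    using assms refl(2) by (simp_all add: torus_pt_act_pt regular_act_pt)
  obtain k l where "\<mu> (act_pt v z) ?s = scale k (T ?s) + scale l 1"
    using mu_refl[OF z' a] by blast
  then have "\<mu> z ?v = scale k (\<mu> z v * T ?s) + scale l (\<mu> z v)"
    using assms refl(1-3) by (simp add: mu_refl_comp distrib_left flip: scale_mult_right)
  moreover have "T_coeff x (\<mu> z ?v) \<noteq> 0" by (rule refl.prems(2))
  ultimately have "T_coeff x (\<mu> z v * T ?s) \<noteq> 0 \<or> T_coeff x (\<mu> z v) \<noteq> 0"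
    by (auto simp: T_coeff_add T_coeff_scale)
  then show "bruhat (inv x) ?v"
  proof
    assume "T_coeff x (\<mu> z v) \<noteq> 0"
    then show ?thesis using IH refl.prems(1) vs bruhat_trans by blast
  next
    assume nz: "T_coeff x (\<mu> z v * T ?s) \<noteq> 0"
    have "\<mu> z v * T ?s = (\<Sum>y\<in>weyl. scale (T_coeff y (\<mu> z v)) (T y)) * T ?s"
      by (simp flip: T_expand)
    also have "\<dots> = (\<Sum>y\<in>weyl. scale (T_coeff y (\<mu> z v)) (T y * T ?s))"
      by (simp add: sum_distrib_right scale_mult_left)
    finally have "(\<Sum>y\<in>weyl. T_coeff y (\<mu> z v) * T_coeff x (T y * T ?s)) \<noteq> 0"
      using nz by (simp add: T_coeff_sum T_coeff_scale)
    then obtain y where y: "y \<in> weyl" "T_coeff y (\<mu> z v) * T_coeff x (T y * T ?s) \<noteq> 0"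
      by (meson sum.neutral)
    then have yv: "bruhat (inv y) v" using IH by auto
    have "x = y \<or> x = y \<circ> ?s" using T_mult_refl_support[OF a y(1) refl.prems(1)] y by auto
    then show ?thesis
    proof
      assume "x = y"
      then show ?thesis using yv vs bruhat_trans by blast
    next
      assume "x = y \<circ> ?s"
      then have "inv x = ?s \<circ> inv y" using y R by (simp add: inv_comp_weyl)
      then show ?thesis using bruhat_lift_left[OF a yv] vs bruhat_trans by auto
    qed
  qed
qed

section \<open>The quantities \<open>m\<close> and their conjugates\<close>

lemma m_eq_sum: "m \<mu> z u v = (\<Sum>x\<in>{x. bruhat u x}. Lam (T x * \<mu> z v))"
proof -
  have "{x \<in> weyl. bruhat u x} = {x. bruhat u x}" using bruhat_weyl by auto
  then show ?thesis by (simp add: m_def psi_def sum_distrib_right Lam_sum)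
qed

lemma m_eq_0:
  assumes "v \<in> weyl" "torus_pt z" "regular z" "\<not> bruhat u v"
  shows "m \<mu> z u v = 0"
  unfolding m_eq_sum
proof (intro sum.neutral ballI)
  fix x assume "x \<in> {x. bruhat u x}"
  then have x: "bruhat u x" "x \<in> weyl" using bruhat_weyl by auto
  then have "\<not> bruhat x v" using assms bruhat_trans by blast
  then show "Lam (T x * \<mu> z v) = 0"
    using mu_support[OF assms(1-3), of "inv x"] x by (auto simp: Lam_T_mult)
qed

text \<open>Pairing \<open>hecke_bar_mu\<close> with the basis expresses the values at the inverse
  point by the conjugated ones; \<open>bar_R_eps\<close> inverts this system, whence the
  signs.\<close>

lemma bar_Lam_mu:
  assumes "v \<in> weyl" "torus_pt z" "regular z" "x \<in> weyl"
  shows "bar (Lam (T x * \<mu> z v)) =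
    (\<Sum>y\<in>weyl. qw v * inverse (qw x) * eps x * eps y * bar_R x y * Lam (T y * \<mu> (inverse_pt z) v))"
proof -
  let ?a = "\<lambda>x. bar (Lam (T x * \<mu> z v))" and ?b = "\<lambda>x. Lam (T x * \<mu> (inverse_pt z) v)"
  have b: "qw v * ?b y = (\<Sum>w\<in>weyl. bar_R y w * (qw w * ?a w))" if y: "y \<in> weyl" for y
  proof -
    have "qw v * ?b y = Lam (T y * hecke_bar (\<mu> z v))"
      using assms by (simp add: hecke_bar_mu Lam_scale flip: scale_mult_right)
    also have "hecke_bar (\<mu> z v) = (\<Sum>w\<in>weyl. scale (bar (T_coeff w (\<mu> z v))) (T_inv (inv w)))"
      by (simp add: hecke_bar_eq T_extend_def)
    \<comment> \<open>Indexing by inverses makes coefficients into traces, since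
      \<open>Lam (T w * h)\<close> is \<open>qw w\<close> times the coefficient at
      \<open>inv w\<close>. Conjugation inverts this factor, hence the \<open>qw w\<close> in front
      of \<open>?a w\<close>.\<close>
    also have "\<dots> = (\<Sum>w\<in>weyl. scale (bar (T_coeff (inv w) (\<mu> z v))) (T_inv w))"
      by (rule sum.reindex_bij_witness[of _ inv inv]) auto
    also have "Lam (T y * \<dots>) = (\<Sum>w\<in>weyl. bar (T_coeff (inv w) (\<mu> z v)) * bar_R y w)"
      using y by (simp add: sum_distrib_left Lam_sum Lam_scale Lam_T_mult_T_inv flip: scale_mult_right)
    also have "\<dots> = (\<Sum>w\<in>weyl. bar_R y w * (qw w * ?a w))"
      by (intro sum.cong) (auto simp: Lam_T_mult bar_mult)
    finally show ?thesis .
  qed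
  have "(\<Sum>y\<in>weyl. qw v * inverse (qw x) * eps x * eps y * bar_R x y * ?b y) =
      (\<Sum>y\<in>weyl. inverse (qw x) * eps x * eps y * bar_R x y * (\<Sum>w\<in>weyl. bar_R y w * (qw w * ?a w)))"
  proof (intro sum.cong refl)
    fix y assume y: "y \<in> weyl"
    show "qw v * inverse (qw x) * eps x * eps y * bar_R x y * ?b y =
        inverse (qw x) * eps x * eps y * bar_R x y * (\<Sum>w\<in>weyl. bar_R y w * (qw w * ?a w))"
      unfolding b[OF y, symmetric] by (simp only: mult_ac)
  qed
  also have "\<dots> = (\<Sum>w\<in>weyl. (\<Sum>y\<in>weyl. inverse (qw x) * eps x * eps y * bar_R x y * bar_R y w) * (qw w * ?a w))"
    by (rule sum_mult_assoc)
  also have "\<dots> = (\<Sum>w\<in>weyl. inverse (qw x) * eps x * (\<Sum>y\<in>weyl. eps y * bar_R x y * bar_R y w) * (qw w * ?a w))"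
    by (simp add: sum_distrib_left mult.assoc)
  also have "\<dots> = (\<Sum>w\<in>weyl. if x = w then ?a w else 0)"
  proof (intro sum.cong refl)
    fix w assume w: "w \<in> weyl"
    show "inverse (qw x) * eps x * (\<Sum>y\<in>weyl. eps y * bar_R x y * bar_R y w) * (qw w * ?a w) =
        (if x = w then ?a w else 0)"
      unfolding bar_R_eps[OF assms(4) w] by (simp add: mult.assoc)
  qed
  finally show ?thesis using assms(4) by simp
qed

lemma bar_m:
  assumes P: "KL_family P" and v: "v \<in> weyl" and z: "torus_pt z" "regular z"
  shows "bar (m \<mu> z u v) = qw v * inverse (qw u) *
    (\<Sum>w\<in>{w. bruhat u w \<and> bruhat w v}. c P u w * m \<mu> (inverse_pt z) w v)"
proof -
  let ?b = "\<lambda>x. Lam (T x * \<mu> (inverse_pt z) v)" and ?m = "\<lambda>w. m \<mu> (inverse_pt z) w v"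
  \<comment> \<open>The summand without order conditions and without the powers of \<open>q\<close>
    attached to \<open>u\<close> and \<open>v\<close>.\<close>
  define F where "F x y t w = eps x * eps y * inverse (qw y) * at_q (P x y) *
    bar (at_q (inverse_KL P y t)) * eps t * eps w * ?m w" for x y t w
  have z': "torus_pt (inverse_pt z)" "regular (inverse_pt z)"
    using z by (simp_all add: torus_pt_inverse_pt regular_inverse_pt)
  have b: "?b t = (\<Sum>w\<in>weyl. if bruhat t w then eps t * eps w * ?m w else 0)" if t: "t \<in> weyl" for t
  proof -
    have "?b t = (\<Sum>w\<in>{w. bruhat t w}. eps t * eps w * ?m w)"
      by (rule moebius_inversion[OF t m_eq_sum])
    also have "\<dots> = (\<Sum>w\<in>{w \<in> weyl. bruhat t w}. eps t * eps w * ?m w)"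
      using bruhat_weyl by (intro sum.cong) auto
    finally show ?thesis by (simp add: sum.If_cases Int_def)
  qed
  have a: "bar (Lam (T x * \<mu> z v)) = (\<Sum>t\<in>weyl. \<Sum>y\<in>weyl. \<Sum>w\<in>weyl. if bruhat t w then qw v * F x y t w else 0)"
    if x: "x \<in> weyl" for x
  proof -
    have "bar (Lam (T x * \<mu> z v)) =
        (\<Sum>t\<in>weyl. qw v * inverse (qw x) * eps x * eps t * bar_R x t * ?b t)"
      by (rule bar_Lam_mu[OF v z x])
    also have "\<dots> = (\<Sum>t\<in>weyl. \<Sum>y\<in>weyl. qw v * eps x * eps y * inverse (qw y) *
        at_q (P x y) * bar (at_q (inverse_KL P y t)) * ?b t)"
    proof (intro sum.cong refl)
      fix t assume t: "t \<in> weyl"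
      have "qw v * inverse (qw x) * eps x * eps t * bar_R x t * ?b t = (\<Sum>y\<in>weyl. qw v * inverse (qw x) * eps x * eps t *
          (qw x * inverse (qw y) * at_q (P x y) * (eps y * eps t * bar (at_q (inverse_KL P y t)))) * ?b t)"
        by (simp only: bar_R_eq[OF P x t] sum_distrib_left sum_distrib_right)
      \<comment> \<open>The factor \<open>eps t\<close> of the inverted R-matrix cancels the one of
        its factorization; the \<open>eps t\<close> in \<open>c\<close> is the one brought by
        Moebius inversion.\<close>
      also have "\<dots> = (\<Sum>y\<in>weyl. (inverse (qw x) * qw x) * (eps t * eps t) * (qw v * eps x * eps y * inverse (qw y) *
          at_q (P x y) * bar (at_q (inverse_KL P y t)) * ?b t))"
        by (simp only: mult_ac)
      finally show "qw v * inverse (qw x) * eps x * eps t * bar_R x t * ?b t = (\<Sum>y\<in>weyl. qw v * eps x * eps y *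
          inverse (qw y) * at_q (P x y) * bar (at_q (inverse_KL P y t)) * ?b t)" by simp
    qed
    also have "\<dots> = (\<Sum>t\<in>weyl. \<Sum>y\<in>weyl. \<Sum>w\<in>weyl. if bruhat t w then qw v * F x y t w else 0)"
      by (intro sum.cong refl) (simp add: b sum_distrib_left F_def mult_ac if_distrib cong: if_cong)
    finally show ?thesis .
  qed
  \<comment> \<open>The relations between \<open>x\<close>, \<open>y\<close> and \<open>t\<close>
    and the bound by \<open>v\<close> are enforced by the factors themselves, so only
    \<open>bruhat u x\<close> and \<open>bruhat t w\<close> are carried as conditions while the sums
    are exchanged.\<close>
  have F0: "F x y t w = 0" if "x \<in> weyl" "y \<in> weyl" "t \<in> weyl" "w \<in> weyl"
      "\<not> (bruhat x y \<and> bruhat y t \<and> bruhat w v)" for x y t w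
    using that kl_eq_0[OF P, of x y] ikl_eq_0[OF P, of y t] m_eq_0[OF v z', of w] by (auto simp: F_def)
  have c: "c P u w * ?m w = qw u * (\<Sum>x\<in>weyl. \<Sum>y\<in>weyl. \<Sum>t\<in>weyl.
      if bruhat u x \<and> bruhat x y \<and> bruhat y t \<and> bruhat t w then F x y t w else 0)" for w
  proof -
    let ?S = "{(x, y, t). bruhat u x \<and> bruhat x y \<and> bruhat y t \<and> bruhat t w}"
    have "c P u w * ?m w = (\<Sum>(x, y, t)\<in>?S. qw u * F x y t w)"
      unfolding c_def sum_distrib_right by (intro sum.cong refl) (auto simp: F_def mult_ac)
    also have "\<dots> = (\<Sum>(x, y, t)\<in>weyl \<times> weyl \<times> weyl.
        if bruhat u x \<and> bruhat x y \<and> bruhat y t \<and> bruhat t w then qw u * F x y t w else 0)"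
      by (rule sum.mono_neutral_cong_left) (use bruhat_weyl in \<open>auto split: if_splits\<close>)
    also have "\<dots> = (\<Sum>x\<in>weyl. \<Sum>y\<in>weyl. \<Sum>t\<in>weyl.
        if bruhat u x \<and> bruhat x y \<and> bruhat y t \<and> bruhat t w then qw u * F x y t w else 0)"
      by (simp add: sum.cartesian_product)
    finally show ?thesis by (simp add: sum_distrib_left if_distrib cong: if_cong)
  qed
  have "bar (m \<mu> z u v) = (\<Sum>x\<in>{x \<in> weyl. bruhat u x}. bar (Lam (T x * \<mu> z v)))"
    unfolding m_eq_sum bar_sum using bruhat_weyl by (intro sum.cong) auto
  also have "\<dots> = (\<Sum>x\<in>weyl. if bruhat u x then bar (Lam (T x * \<mu> z v)) else 0)"
    by (simp add: sum.If_cases Int_def)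
  also have "\<dots> = (\<Sum>x\<in>weyl. \<Sum>t\<in>weyl. \<Sum>y\<in>weyl. \<Sum>w\<in>weyl. if bruhat u x \<and> bruhat t w then qw v * F x y t w else 0)"
    by (intro sum.cong refl) (simp add: a)
  also have "\<dots> = (\<Sum>x\<in>weyl. \<Sum>y\<in>weyl. \<Sum>t\<in>weyl. \<Sum>w\<in>weyl. if bruhat u x \<and> bruhat t w then qw v * F x y t w else 0)"
    by (intro sum.cong refl sum.swap)
  also have "\<dots> = (\<Sum>x\<in>weyl. \<Sum>y\<in>weyl. \<Sum>w\<in>weyl. \<Sum>t\<in>weyl. if bruhat u x \<and> bruhat t w then qw v * F x y t w else 0)"
    by (intro sum.cong refl sum.swap)
  also have "\<dots> = (\<Sum>x\<in>weyl. \<Sum>w\<in>weyl. \<Sum>y\<in>weyl. \<Sum>t\<in>weyl. if bruhat u x \<and> bruhat t w then qw v * F x y t w else 0)"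
    by (intro sum.cong refl sum.swap)
  also have "\<dots> = (\<Sum>w\<in>weyl. \<Sum>x\<in>weyl. \<Sum>y\<in>weyl. \<Sum>t\<in>weyl. if bruhat u x \<and> bruhat t w then qw v * F x y t w else 0)"
    by (rule sum.swap)
  also have "\<dots> = (\<Sum>w\<in>weyl. if bruhat u w \<and> bruhat w v then qw v * inverse (qw u) * (c P u w * ?m w) else 0)"
  proof (intro sum.cong refl)
    fix w assume w: "w \<in> weyl"
    let ?L = "\<Sum>x\<in>weyl. \<Sum>y\<in>weyl. \<Sum>t\<in>weyl. if bruhat u x \<and> bruhat t w then qw v * F x y t w else 0"
    show "?L = (if bruhat u w \<and> bruhat w v then qw v * inverse (qw u) * (c P u w * ?m w) else 0)"
    proof (cases "bruhat u w \<and> bruhat w v")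
      case True
      have "?L = (\<Sum>x\<in>weyl. \<Sum>y\<in>weyl. \<Sum>t\<in>weyl.
          if bruhat u x \<and> bruhat x y \<and> bruhat y t \<and> bruhat t w then qw v * F x y t w else 0)"
        by (intro sum.cong refl) (use F0 w in auto)
      moreover have cancel: "qw v * inverse (qw u) * (qw u * k) = qw v * k" for k
        by (simp add: field_simps)
      ultimately show ?thesis using True by (simp add: c sum_distrib_left if_distrib cancel cong: if_cong)
    next
      case False
      \<comment> \<open>A surviving chain from \<open>u\<close> to \<open>w\<close> would give
        \<open>bruhat u w\<close> by transitivity, so outside the interval every term is
        zero.\<close>
      have "(if bruhat u x \<and> bruhat t w then qw v * F x y t w else 0) = 0"
        if "x \<in> weyl" "y \<in> weyl" "t \<in> weyl" for x y t
      proof (cases "bruhat u x \<and> bruhat t w")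
        case True
        then have "\<not> (bruhat x y \<and> bruhat y t \<and> bruhat w v)"
          using False bruhat_trans by blast
        then show ?thesis using F0 that w by simp
      qed auto
      then have "?L = 0" by (intro sum.neutral ballI)
      then show ?thesis using False by auto
    qed
  qed
  also have "\<dots> = (\<Sum>w\<in>{w \<in> weyl. bruhat u w \<and> bruhat w v}. qw v * inverse (qw u) * (c P u w * ?m w))"
    by (simp add: sum.If_cases Int_def)
  also have "{w \<in> weyl. bruhat u w \<and> bruhat w v} = {w. bruhat u w \<and> bruhat w v}"
    using bruhat_weyl by auto
  finally show ?thesis by (simp add: sum_distrib_left)
qed

end

end

theorem theorem4:
  fixes \<Phi> pos :: "'x::linordered_ab_group_add set"
    and coroot :: "'x \<Rightarrow> 'x \<Rightarrow> int"
    and scale :: "'x qz_field \<Rightarrow> 'h::ring_1 \<Rightarrow> 'h"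
    and T :: "('x \<Rightarrow> 'x) \<Rightarrow> 'h"
    and \<mu> :: "('x \<Rightarrow> 'x torus_field) \<Rightarrow> ('x \<Rightarrow> 'x) \<Rightarrow> 'h"
    and P :: "('x \<Rightarrow> 'x) \<Rightarrow> ('x \<Rightarrow> 'x) \<Rightarrow> int poly"
    and u v :: "'x \<Rightarrow> 'x"
  assumes "hecke_algebra \<Phi> coroot pos scale T"
    and "hecke_algebra.mu_family \<Phi> coroot pos scale T \<mu>"
    and "hecke_algebra.KL_family \<Phi> coroot pos scale T P"
    and "u \<in> root_datum.weyl \<Phi> coroot"
    and "v \<in> root_datum.weyl \<Phi> coroot"
    and "positive_system.bruhat \<Phi> coroot pos u v"
  shows "bar (hecke_algebra.m \<Phi> coroot pos scale T \<mu> generic_pt u v) =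
    positive_system.qw coroot pos v * inverse (positive_system.qw coroot pos u) *
    (\<Sum>w\<in>{w. positive_system.bruhat \<Phi> coroot pos u w \<and> positive_system.bruhat \<Phi> coroot pos w v}.
      hecke_algebra.c \<Phi> coroot pos P u w *
      hecke_algebra.m \<Phi> coroot pos scale T \<mu> (inverse_pt generic_pt) w v)"
proof -
  interpret hecke_algebra \<Phi> coroot pos scale T by (rule assms(1))
  show ?thesis
    by (rule bar_m[OF assms(2,3,5) torus_pt_generic regular_generic])
qed

end
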